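(* Fix a standardisation variant. Let $\pi$ be a filling of a moon polyomino $M$. For a column $c$ of the current polyomino, let $R_c$ be the largest rectangle contained in the polyomino whose first (leftmost) column is column $c$ in its entirety (so $R_c$ has exactly the rows of $c$ and extends to the right as far as possible), and let $T_c$ be the operation which replaces the filling of $R_c$ by $\overline j$ of it, leaves all other entries unchanged, and cyclically shifts the columns of $R_c$ so that column $c$ becomes the last column of the rectangle and the other columns of $R_c$ (together with their cells outside $R_c$) move one position to the left, keeping their vertical positions; the result is a filling of a moon polyomino. Columns are tracked as physical columns through such shifts. Then for any two columns $c_1,c_2$ of $M$, applying $T_{c_1}$ and then $T_{c_2}$ to $\pi$ gives the same filling (of the same polyomino) as applying $T_{c_2}$ and then $T_{c_1}$.
   Context: A moon polyomino is a finite set of cells of $\mathbb Z^2$ that is convex (cells between two cells of a column or of a row belong to it) and intersection-free (for two columns, the row set of one contains that of the other). Fillings assign non-negative integers to cells ($0$-$1$ for the variants dual RSK and RSK'). Partitions: weakly decreasing sequences of positive integers, French Ferrers diagrams; $\cup,\cap$ partwise max/min; $\lambda^t$ conjugate; horizontal (vertical) strip: $\mu\subseteq\lambda$ with at most one cell of $\lambda\setminus\mu$ per column (row). Growth diagram of a partial filling ($0/1$, at most one $1$ per row and column) of a rectangle: corners labelled by partitions, $\emptyset$ on the left and bottom border; for a cell with lower-left $\lambda$, upper-left $\mu$, lower-right $\nu$, upper-right $\rho$: empty, $\lambda=\mu=\nu$: $\rho=\lambda$; empty, $\mu\ne\nu$: $\rho=\mu\cup\nu$; empty, $\lambda\subsetneq\mu=\nu$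 differing in part $i$: $\rho=\mu$ with part $i+1$ increased by one; cell with $1$: $\rho=\lambda$ with first part increased by one. $Q$ = top border labels left to right, $P$ = right border labels bottom to top. Variants RSK, dual RSK', dual RSK, RSK': standardisation replaces each column/row by as many as its entry sum, each unit becoming a $1$; $1$'s from one original column form a north-east chain (RSK, dual RSK) or south-east chain (dual RSK', RSK'); from one original row a north-east chain (RSK, RSK') or south-east chain (dual RSK', dual RSK). $(P,Q)$ of a rectangular filling are the growth-diagram labels of its standardisation at the boundaries between blocks of original rows/columns; this is a bijection onto pairs of sequences from $\emptyset$ with common last partition whose steps are horizontal strips ($Q$: RSK, dual RSK; $P$: RSK, RSK') or vertical strips (otherwise). $jdt$ of $(\emptyset=\lambda^0,\dots,\lambda^n)$ with horizontal strip steps is $(\emptyset=\mu^0,\dots,\mu^{n-1})$: if $\lambda^1=\emptyset$, $\mu^i=\lambda^{i+1}$; else $\mu^0=\emptyset$ and for $i\ge1$: if $\lambda^{i+1}=\lambda^i$, $\mu^i=\mu^{i-1}$; otherwise colour $\lambda^{i+1}\setminus\lambda^i$ green and $\lambda^i\setminus\mu^{i-1}$ red, swap colours in each column containing both, move red cells right of green cells in each row, and let $\mu^i$ be $\lambda^{i+1}$ without red cells. For vertical strip steps $jdt(Q)=jdt(Q^t)^t$. $\overline{jdt}(Q)$ = $jdt(Q)$ followed by the last partition of $Q$. For a rectangular filling corresponding to $(P,Q)$, $\overline j$ of it is the filling corresponding to $(P,\overline{jdt}(Q))$.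
   Formalization: Two distinct columns are required to have different sets of rows; for distinct columns with the same rows the claim fails (one row of two cells filled with 1, 0: one order gives 1, 0 and the other 0, 1). *)

theory Defs
  imports Main
begin

section \<open>Moon polyominoes\<close>

text \<open>A cell is a pair (column, row); columns are numbered from left to right and rows from
  bottom to top.\<close>

definition col_rows :: "(int \<times> int) set \<Rightarrow> int \<Rightarrow> int set" where
  "col_rows M x = {y. (x, y) \<in> M}"

definition moon_polyomino :: "(int \<times> int) set \<Rightarrow> bool" where
  "moon_polyomino M \<longleftrightarrow>
     finite M \<and>
     (\<forall>x y1 y y2. (x, y1) \<in> M \<and> (x, y2) \<in> M \<and> y1 \<le> y \<and> y \<le> y2 \<longrightarrow> (x, y) \<in> M) \<and>
     (\<forall>x1 x x2 y. (x1, y) \<in> M \<and> (x2, y) \<in> M \<and> x1 \<le> x \<and> x \<le> x2 \<longrightarrow> (x, y) \<in> M) \<and>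
     (\<forall>x1 x2. col_rows M x1 \<subseteq> col_rows M x2 \<or> col_rows M x2 \<subseteq> col_rows M x1)"


section \<open>Partitions\<close>

text \<open>A partition is represented by its parts in weakly decreasing order, padded with zeros:
  part number i + 1 of p is p i.  The empty partition is then the constant function 0, and the
  partwise maximum is the lattice operation sup on functions.\<close>

type_synonym partition = "nat \<Rightarrow> nat"

definition empty_partition :: partition where
  "empty_partition = (\<lambda>_. 0)"

definition conjugate :: "partition \<Rightarrow> partition" where
  "conjugate p = (\<lambda>j. card {i. j < p i})"

text \<open>Cells of the French Ferrers diagram, again as pairs (column, row).\<close>

definition diagram :: "partition \<Rightarrow> (nat \<times> nat) set" where
  "diagram p = {(a, b). a < p b}"


section \<open>Growth diagrams\<close>

text \<open>The corners of a cell are labelled l (lower left), m (upper left) and n (lower right); the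
  result is the label of the upper right corner.  In the case \<open>m = n \<noteq> l\<close> the partitions l and m
  differ in a single part.\<close>

definition local_rule :: "bool \<Rightarrow> partition \<Rightarrow> partition \<Rightarrow> partition \<Rightarrow> partition" where
  "local_rule one l m n =
     (if one then l(0 := Suc (l 0))
      else if m \<noteq> n then sup m n
      else if l = m then l
      else let i = (THE i. l i \<noteq> m i) in m(Suc i := Suc (m (Suc i))))"

text \<open>S is the set of those cells of a partial filling that contain a 1; the cell (i, j) has the
  corners (i, j), (i, j + 1), (i + 1, j) and (i + 1, j + 1).\<close>

fun growth :: "(nat \<times> nat) set \<Rightarrow> nat \<Rightarrow> nat \<Rightarrow> partition" where
  "growth S 0 j = empty_partition"
| "growth S (Suc i) 0 = empty_partition"
| "growth S (Suc i) (Suc j) =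
     local_rule ((i, j) \<in> S) (growth S i j) (growth S i (Suc j)) (growth S (Suc i) j)"


section \<open>Standardisation\<close>

datatype variant = RSK | dualRSK' | dualRSK | RSK'

definition column_NE :: "variant \<Rightarrow> bool" where
  "column_NE v \<longleftrightarrow> v = RSK \<or> v = dualRSK"

definition row_NE :: "variant \<Rightarrow> bool" where
  "row_NE v \<longleftrightarrow> v = RSK \<or> v = RSK'"

definition zero_one :: "variant \<Rightarrow> bool" where
  "zero_one v \<longleftrightarrow> v = dualRSK \<or> v = RSK'"

text \<open>A filling F of the rectangle with n columns and m rows has the entry F x y in column x and
  row y (counted from 0), and is 0 outside of the rectangle.\<close>

definition rect_filling :: "variant \<Rightarrow> nat \<Rightarrow> nat \<Rightarrow> (nat \<Rightarrow> nat \<Rightarrow> nat) \<Rightarrow> bool" where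
  "rect_filling v n m F \<longleftrightarrow>
     (\<forall>x y. \<not> (x < n \<and> y < m) \<longrightarrow> F x y = 0) \<and> (zero_one v \<longrightarrow> (\<forall>x y. F x y \<le> 1))"

text \<open>The first x columns (the first y rows) of F become the first column_start x columns
  (row_start y rows) of the standardisation.\<close>

definition column_start :: "nat \<Rightarrow> (nat \<Rightarrow> nat \<Rightarrow> nat) \<Rightarrow> nat \<Rightarrow> nat" where
  "column_start m F x = (\<Sum>x'<x. \<Sum>y<m. F x' y)"

definition row_start :: "nat \<Rightarrow> (nat \<Rightarrow> nat \<Rightarrow> nat) \<Rightarrow> nat \<Rightarrow> nat" where
  "row_start n F y = (\<Sum>y'<y. \<Sum>x<n. F x y')"

text \<open>The unit number k of the cell (x, y) becomes a 1 in column unit_column k of the block of x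
  and in row unit_row k of the block of y.  Units of a cell are numbered from left to right.  In a
  north-east (south-east) chain of units from one column, a unit is preceded by the units from
  lower (higher) rows; in a north-east (south-east) chain of units from one row, a unit lies above
  the units that come from the columns to its left (right).\<close>

definition unit_column :: "variant \<Rightarrow> nat \<Rightarrow> (nat \<Rightarrow> nat \<Rightarrow> nat) \<Rightarrow> nat \<Rightarrow> nat \<Rightarrow> nat \<Rightarrow> nat" where
  "unit_column v m F x y k =
     (if column_NE v then (\<Sum>y'<y. F x y') + k else (\<Sum>y'\<in>{y<..<m}. F x y') + k)"

definition unit_row :: "variant \<Rightarrow> nat \<Rightarrow> (nat \<Rightarrow> nat \<Rightarrow> nat) \<Rightarrow> nat \<Rightarrow> nat \<Rightarrow> nat \<Rightarrow> nat" where
  "unit_row v n F x y k =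
     (if row_NE v then (\<Sum>x'<x. F x' y) + k
      else (\<Sum>x'\<in>{x<..<n}. F x' y) + (F x y - 1 - k))"

definition standardisation ::
    "variant \<Rightarrow> nat \<Rightarrow> nat \<Rightarrow> (nat \<Rightarrow> nat \<Rightarrow> nat) \<Rightarrow> (nat \<times> nat) set" where
  "standardisation v n m F =
     {(column_start m F x + unit_column v m F x y k, row_start n F y + unit_row v n F x y k)
      | x y k. x < n \<and> y < m \<and> k < F x y}"

text \<open>The sequences P and Q of a filling: the labels on the right border, from bottom to top, and
  on the top border, from left to right, at the boundaries between blocks.\<close>

definition P_seq :: "variant \<Rightarrow> nat \<Rightarrow> nat \<Rightarrow> (nat \<Rightarrow> nat \<Rightarrow> nat) \<Rightarrow> partition list" where
  "P_seq v n m F =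
     map (\<lambda>y. growth (standardisation v n m F) (column_start m F n) (row_start n F y)) [0..<Suc m]"

definition Q_seq :: "variant \<Rightarrow> nat \<Rightarrow> nat \<Rightarrow> (nat \<Rightarrow> nat \<Rightarrow> nat) \<Rightarrow> partition list" where
  "Q_seq v n m F =
     map (\<lambda>x. growth (standardisation v n m F) (column_start m F x) (row_start n F m)) [0..<Suc n]"


section \<open>Jeu de taquin\<close>

text \<open>One step: for the partitions l and l' at positions i and i + 1 of the original sequence and
  the partition mu at position i - 1 of the new one, determine the partition at position i of the
  new sequence.  After the colours have been swapped, moving the red cells of a row to the right of
  its green cells and deleting them leaves, in row b, the first (l' b minus number of red cells in
  row b) cells of l'.\<close>

definition jdt_step :: "partition \<Rightarrow> partition \<Rightarrow> partition \<Rightarrow> partition" where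
  "jdt_step l l' mu =
     (if l' = l then mu
      else
        let green = diagram l' - diagram l;
            red = diagram l - diagram mu;
            red' = {(a, b). (a, b) \<in> red \<and> a \<notin> fst ` green \<or> (a, b) \<in> green \<and> a \<in> fst ` red}
        in (\<lambda>b. l' b - card {a. (a, b) \<in> red'}))"

primrec jdt_part :: "partition list \<Rightarrow> nat \<Rightarrow> partition" where
  "jdt_part Q 0 = empty_partition"
| "jdt_part Q (Suc i) = jdt_step (Q ! Suc i) (Q ! Suc (Suc i)) (jdt_part Q i)"

definition jdt :: "partition list \<Rightarrow> partition list" where
  "jdt Q = (if Q ! 1 = empty_partition then tl Q else map (jdt_part Q) [0..<length Q - 1])"

text \<open>The steps of Q are horizontal strips if the units of a column form a north-east chain, and
  vertical strips otherwise.\<close>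

definition jdt_variant :: "variant \<Rightarrow> partition list \<Rightarrow> partition list" where
  "jdt_variant v Q = (if column_NE v then jdt Q else map conjugate (jdt (map conjugate Q)))"

definition jdt_bar :: "variant \<Rightarrow> partition list \<Rightarrow> partition list" where
  "jdt_bar v Q = jdt_variant v Q @ [last Q]"

definition j_bar ::
    "variant \<Rightarrow> nat \<Rightarrow> nat \<Rightarrow> (nat \<Rightarrow> nat \<Rightarrow> nat) \<Rightarrow> (nat \<Rightarrow> nat \<Rightarrow> nat)" where
  "j_bar v n m F =
     (THE G. rect_filling v n m G \<and>
        P_seq v n m G = P_seq v n m F \<and> Q_seq v n m G = jdt_bar v (Q_seq v n m F))"


section \<open>Moving columns of a filling of a moon polyomino\<close>

definition filling :: "variant \<Rightarrow> (int \<times> int) set \<Rightarrow> (int \<times> int \<Rightarrow> nat) \<Rightarrow> bool" where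
  "filling v M p \<longleftrightarrow> (\<forall>z. z \<notin> M \<longrightarrow> p z = 0) \<and> (zero_one v \<longrightarrow> (\<forall>z. p z \<le> 1))"

text \<open>The largest rectangle whose first column is the entire column c of M has the columns from c
  to last_column M c and the rows of column c.\<close>

definition last_column :: "(int \<times> int) set \<Rightarrow> int \<Rightarrow> int" where
  "last_column M c = Max {e. c \<le> e \<and> {c..e} \<times> col_rows M c \<subseteq> M}"

definition rectangle :: "(int \<times> int) set \<Rightarrow> int \<Rightarrow> (int \<times> int) set" where
  "rectangle M c = {c..last_column M c} \<times> col_rows M c"

text \<open>The new position of the column at position x when column c is moved.\<close>

definition shift_column :: "(int \<times> int) set \<Rightarrow> int \<Rightarrow> int \<Rightarrow> int" where
  "shift_column M c x =
     (if x = c then last_column M c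
      else if c < x \<and> x \<le> last_column M c then x - 1
      else x)"

text \<open>The filling of the rectangle is replaced by its image under j_bar in place: this image already
  accounts for the cyclic shift, since the entry sum of its i-th column is that of column i + 1 of
  the original filling, and the entry sum of its last column is that of the original first one.
  The cells outside of the rectangle carry their entries along.\<close>

definition move_column ::
    "variant \<Rightarrow> int \<Rightarrow> (int \<times> int) set \<times> (int \<times> int \<Rightarrow> nat) \<Rightarrow> (int \<times> int) set \<times> (int \<times> int \<Rightarrow> nat)"
  where
  "move_column v c = (\<lambda>(M, p).
     let n = nat (last_column M c - c + 1);
         m = card (col_rows M c);
         r = Min (col_rows M c);
         F = (\<lambda>i j. if i < n \<and> j < m then p (c + int i, r + int j) else 0);
         G = j_bar v n m F
     in ({(shift_column M c x, y) | x y. (x, y) \<in> M},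
         (\<lambda>(x, y). if (x, y) \<in> rectangle M c then G (nat (x - c)) (nat (y - r))
                   else p (inv (shift_column M c) x, y))))"

end

theory Submission
  imports Defs "HOL-Library.Multiset"
begin

text \<open>
  Reading a column-wise filling as a word of row numbers, the pair (P, Q) becomes the RSK pair of the
  word, with ties broken by position.  Recording a growth diagram by edge labels, i.e. by the numbers
  of the parts that increase, turns Q into a lattice word, and an elementary Knuth move on three
  adjacent letters of the word fixes P and acts on Q by the same kind of move at the same place.
  Any two lattice words with the same content are connected by such moves, and two lattice words
  are equal if all sequences of moves produce the same descents from them.

  Jeu de taquin commutes with the moves that do not touch the first column.  Hence, if
  the rows of \<open>c\<^sub>1\<close> are properly contained in those of \<open>c\<^sub>2\<close> and the rectangles meet, write the
  change of the rectangle of \<open>c\<^sub>2\<close> as a sequence of Knuth moves.  The letters from the rows of \<open>c\<^sub>1\<close>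
  form an interval, so each move either is a Knuth move of the word of the rectangle of \<open>c\<^sub>1\<close>
  or does not change that word; either way it commutes with the move of \<open>c\<^sub>1\<close>.  The same sequence of moves is
  the right one after \<open>c\<^sub>1\<close> has moved, because the words of the rectangle of \<open>c\<^sub>2\<close> before and after have
  the same descents under all moves and therefore the same Q.
\<close>

text \<open>The obstacle is that the overlap of the two rectangles consists of some columns of one
  and of a band of rows of the other, so each move rearranges cells that the other one reads. After
  the move of \<open>c\<^sub>1\<close>, the word of the taller rectangle retains its letters outside
  the band and the positions of the letters inside it, but not those letters themselves. As the band
  is an interval, this is enough to compare any two letters that do not both lie in it. The
  remaining comparisons are descents of the word of the other rectangle, and jeu de taquin preserves
  the descents after the first column. Hence the proof follows descents instead of entries.

  If letter number i of a lattice word is read as the row of the entry i of a standard tableau, a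
  move is an elementary dual equivalence in the sense of Haiman, and connectedness says that all
  standard tableaux of a given shape are dual equivalent.

  The four variants amount to two independent flags: how ties between equal letters are broken
  (\<open>row_NE\<close>), and in which direction a column is read (\<open>column_NE\<close>). Moves
  see only the first flag and jeu de taquin only the second.\<close>

section \<open>Knuth moves\<close>

text \<open>An elementary Knuth move, uniformly for all kinds of words: D a b says that a, standing before b,
  forms a descent with it.  Unless the median of the three letters stands in the middle, the
  smallest and the largest of them are adjacent and change places.\<close>

definition mv3 :: "('a \<Rightarrow> 'a \<Rightarrow> bool) \<Rightarrow> 'a \<Rightarrow> 'a \<Rightarrow> 'a \<Rightarrow> 'a list" where
  "mv3 D a b c = (if D a b = D b c then [a, b, c] else if D a b = D a c then [b, a, c] else [a, c, b])"

definition mv :: "('a \<Rightarrow> 'a \<Rightarrow> bool) \<Rightarrow> nat \<Rightarrow> 'a list \<Rightarrow> 'a list" where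
  "mv D i w = (if i + 2 < length w
     then take i w @ mv3 D (w ! i) (w ! (i + 1)) (w ! (i + 2)) @ drop (i + 3) w else w)"

definition mvs :: "('a \<Rightarrow> 'a \<Rightarrow> bool) \<Rightarrow> nat list \<Rightarrow> 'a list \<Rightarrow> 'a list" where
  "mvs D \<sigma> = fold (mv D) \<sigma>"

text \<open>A move beyond the end of a word does nothing, so a sequence of moves found for a prefix
  could change its meaning on the whole word. This condition excludes that.\<close>

definition within :: "nat list \<Rightarrow> nat \<Rightarrow> bool" where
  "within \<sigma> n \<longleftrightarrow> (\<forall>i\<in>set \<sigma>. i + 2 < n)"

text \<open>Strict and weak linear orders both qualify, so one theory of moves serves lattice words,
  permutations and words with either convention for ties.\<close>

definition ordering :: "('a \<Rightarrow> 'a \<Rightarrow> bool) \<Rightarrow> bool" where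
  "ordering D \<longleftrightarrow> (\<forall>a b c. D a b \<longrightarrow> D b c \<longrightarrow> D a c) \<and>
     (\<forall>a b c. \<not> D a b \<longrightarrow> \<not> D b c \<longrightarrow> \<not> D a c)"

lemma mvs_simps [simp]:
  "mvs D [] w = w" "mvs D (i # \<sigma>) w = mvs D \<sigma> (mv D i w)" "mvs D (\<sigma> @ \<tau>) w = mvs D \<tau> (mvs D \<sigma> w)"
  by (simp_all add: mvs_def)

lemma within_simps [simp]:
  "within [] n" "within (i # \<sigma>) n \<longleftrightarrow> i + 2 < n \<and> within \<sigma> n"
  "within (\<sigma> @ \<tau>) n \<longleftrightarrow> within \<sigma> n \<and> within \<tau> n" "within (rev \<sigma>) n \<longleftrightarrow> within \<sigma> n"
  by (auto simp: within_def)

lemma length_mv3 [simp]: "length (mv3 D a b c) = 3"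
  by (simp add: mv3_def)

lemma mset_mv3 [simp]: "mset (mv3 D a b c) = {#a, b, c#}"
  by (simp add: mv3_def add_mset_commute)

lemma split3:
  assumes "i + 2 < length w"
  obtains U a b c V where "w = U @ a # b # c # V" "length U = i"
proof
  have "drop i w = w ! i # w ! Suc i # w ! Suc (Suc i) # drop (Suc (Suc (Suc i))) w"
    using assms by (simp add: Cons_nth_drop_Suc)
  then show "w = take i w @ w ! i # w ! Suc i # w ! Suc (Suc i) # drop (Suc (Suc (Suc i))) w"
    by (metis append_take_drop_id)
qed (use assms in simp)

lemma mv_append: "mv D (length U) (U @ a # b # c # V) = U @ mv3 D a b c @ V"
  by (simp add: mv_def nth_append)

lemma length_mv [simp]: "length (mv D i w) = length w"
  by (auto simp: mv_def)

lemma mset_mv [simp]: "mset (mv D i w) = mset w"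
proof (cases "i + 2 < length w")
  case True
  then obtain U a b c V where "w = U @ a # b # c # V" "length U = i"
    by (rule split3)
  then show ?thesis using mv_append[of D U a b c V] by simp
qed (simp add: mv_def)

lemma length_mvs [simp]: "length (mvs D \<sigma> w) = length w"
  by (induction \<sigma> arbitrary: w) simp_all

lemma mset_mvs [simp]: "mset (mvs D \<sigma> w) = mset w"
  by (induction \<sigma> arbitrary: w) simp_all

text \<open>Transitivity of \<open>D\<close> and of its negation keeps the median at the same end of
  the triple, so the second move exchanges the same two letters back.\<close>

lemma mv_mv:
  assumes "ordering D"
  shows "mv D i (mv D i w) = w"
proof (cases "i + 2 < length w")
  case True
  then obtain U a b c V where w: "w = U @ a # b # c # V" and i: "i = length U"
    by (metis split3)
  have tr: "D x y \<Longrightarrow> D y z \<Longrightarrow> D x z" "\<not> D x y \<Longrightarrow> \<not> D y z \<Longrightarrow> \<not> D x z" for x y z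
    using assms unfolding ordering_def by blast+
  consider "D a b = D b c" | "D a b \<noteq> D b c" "D a b = D a c" | "D a b \<noteq> D b c" "D a b \<noteq> D a c"
    by blast
  then show ?thesis
  proof cases
    case 1
    then show ?thesis by (simp add: w i mv_append mv3_def)
  next
    case 2
    moreover from 2 have "D b a \<noteq> D a c" using tr by blast
    ultimately show ?thesis by (simp add: w i mv_append mv3_def)
  next
    case 3
    moreover from 3 have "D c b \<noteq> D a c" using tr by blast
    ultimately show ?thesis by (simp add: w i mv_append mv3_def)
  qed
qed (simp add: mv_def)

lemma mvs_rev_mvs:
  assumes "ordering D"
  shows "mvs D (rev \<sigma>) (mvs D \<sigma> w) = w"
  by (induction \<sigma> arbitrary: w) (simp_all add: mv_mv[OF assms])

lemma mvs_append_right: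
  assumes "within \<sigma> (length u)"
  shows "mvs D \<sigma> (u @ v) = mvs D \<sigma> u @ v"
  using assms
proof (induction \<sigma> arbitrary: u)
  case (Cons i \<sigma>)
  then obtain U a b c V where u: "u = U @ a # b # c # V" and i: "i = length U"
    by (metis split3 within_simps(2))
  have "mv D i (u @ v) = mv D i u @ v"
    using mv_append[of D U a b c V] mv_append[of D U a b c "V @ v"] by (simp add: u i)
  then show ?case using Cons by simp
qed simp

lemma mv_append_left: "mv D (length u + i) (u @ v) = u @ mv D i v"
proof (cases "i + 2 < length v")
  case True
  then obtain U a b c V where "v = U @ a # b # c # V" "length U = i"
    by (rule split3)
  then show ?thesis
    using mv_append[of D U a b c V] mv_append[of D "u @ U" a b c V] by simp
qed (simp add: mv_def)

lemma ordering_less [simp]: "ordering ((<) :: nat \<Rightarrow> nat \<Rightarrow> bool)"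
  and ordering_greater [simp]: "ordering (\<lambda>a b :: nat. b < a)"
  by (auto simp: ordering_def)

section \<open>Lattice words\<close>

definition inc :: "nat \<Rightarrow> partition \<Rightarrow> partition" where
  "inc g \<kappa> = \<kappa>(g := Suc (\<kappa> g))"

definition incs :: "partition \<Rightarrow> nat list \<Rightarrow> partition" where
  "incs \<kappa> \<alpha> = fold inc \<alpha> \<kappa>"

definition addable :: "partition \<Rightarrow> nat \<Rightarrow> bool" where
  "addable \<kappa> g \<longleftrightarrow> g = 0 \<or> \<kappa> g < \<kappa> (g - 1)"

primrec lattice_from :: "partition \<Rightarrow> nat list \<Rightarrow> bool" where
  "lattice_from \<kappa> [] \<longleftrightarrow> True"
| "lattice_from \<kappa> (g # \<alpha>) \<longleftrightarrow> addable \<kappa> g \<and> lattice_from (inc g \<kappa>) \<alpha>"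

abbreviation lattice :: "nat list \<Rightarrow> bool" where
  "lattice \<equiv> lattice_from empty_partition"

lemma incs_simps [simp]:
  "incs \<kappa> [] = \<kappa>" "incs \<kappa> (g # \<alpha>) = incs (inc g \<kappa>) \<alpha>" "incs \<kappa> (\<alpha> @ \<beta>) = incs (incs \<kappa> \<alpha>) \<beta>"
  by (simp_all add: incs_def)

lemma incs_count: "incs \<kappa> \<alpha> = (\<lambda>i. \<kappa> i + count (mset \<alpha>) i)"
  by (induction \<alpha> arbitrary: \<kappa>) (auto simp: inc_def)

lemma lattice_from_append [simp]:
  "lattice_from \<kappa> (\<alpha> @ \<beta>) \<longleftrightarrow> lattice_from \<kappa> \<alpha> \<and> lattice_from (incs \<kappa> \<alpha>) \<beta>"
  by (induction \<alpha> arbitrary: \<kappa>) simp_all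

lemma incs_mset_cong: "mset \<alpha> = mset \<beta> \<Longrightarrow> incs \<kappa> \<alpha> = incs \<kappa> \<beta>"
  by (simp add: incs_count)

lemma inc_decreasing:
  assumes "\<And>i. \<kappa> (Suc i) \<le> \<kappa> i" "addable \<kappa> g"
  shows "inc g \<kappa> (Suc i) \<le> inc g \<kappa> i"
  using assms(1)[of i] assms(2) by (auto simp: inc_def addable_def le_Suc_eq)

lemma incs_decreasing:
  assumes "\<And>i. \<kappa> (Suc i) \<le> \<kappa> i" "lattice_from \<kappa> \<alpha>"
  shows "incs \<kappa> \<alpha> (Suc i) \<le> incs \<kappa> \<alpha> i"
  using assms by (induction \<alpha> arbitrary: \<kappa>) (simp_all add: inc_decreasing)

lemma lattice_decreasing: "lattice \<alpha> \<Longrightarrow> incs empty_partition \<alpha> (Suc i) \<le> incs empty_partition \<alpha> i"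
  by (rule incs_decreasing) (simp_all add: empty_partition_def)

section \<open>Lattice words with prescribed content: existence, connectedness, recognition by
  descents\<close>

lemma partition_lattice_word:
  fixes M :: "nat multiset"
  assumes "\<And>i. count M (Suc i) \<le> count M i"
  obtains \<alpha> where "lattice \<alpha>" "mset \<alpha> = M"
proof -
  have "\<exists>\<alpha>. lattice \<alpha> \<and> mset \<alpha> = M" using assms
  proof (induction "size M" arbitrary: M)
    case 0
    then show ?case by (intro exI[of _ "[]"]) simp
  next
    case (Suc n)
    then have ne: "M \<noteq> {#}" by auto
    \<comment> \<open>The largest letter belongs to the topmost row of the shape, from which a cell
      can always be removed; so this letter may come last.\<close>
    define c where "c = Max (set_mset M)"
    have c: "c \<in># M" using ne Max_in[of "set_mset M"] by (simp add: c_def)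
    have "Suc c \<notin># M"
    proof
      assume "Suc c \<in># M"
      then have "Suc c \<le> c" unfolding c_def by (intro Max_ge) simp_all
      then show False by simp
    qed
    with c have c2: "count M (Suc c) = 0" "count M c > 0" by (auto simp: not_in_iff)
    have "count (M - {#c#}) (Suc i) \<le> count (M - {#c#}) i" for i
      using Suc(3)[of i] c2 by (cases "i = c") auto
    moreover have "n = size (M - {#c#})" using Suc(2) c by (simp add: size_Diff_singleton)
    ultimately obtain \<alpha> where a: "lattice \<alpha>" "mset \<alpha> = M - {#c#}"
      using Suc(1)[of "M - {#c#}"] by blast
    have "addable (incs empty_partition \<alpha>) c"
      using Suc(3)[of "c - 1"] c2
      by (cases c) (auto simp: addable_def incs_count a empty_partition_def simp del: count_greater_zero_iff)
    then show ?case using a c by (intro exI[of _ "\<alpha> @ [c]"]) simp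
  qed
  then show thesis using that by blast
qed

text \<open>Row \<open>c\<close> ends in a corner of the shape, and some standard tableau of this
  shape has its largest entry in that corner.\<close>

lemma lattice_last_corner:
  assumes "lattice \<alpha>" "count (mset \<alpha>) (Suc c) < count (mset \<alpha>) c"
  obtains \<beta> where "lattice (\<beta> @ [c])" "mset (\<beta> @ [c]) = mset \<alpha>"
proof -
  have le: "count (mset \<alpha>) (Suc i) \<le> count (mset \<alpha>) i" for i
    using lattice_decreasing[OF assms(1), of i] by (simp add: incs_count empty_partition_def)
  have "count (mset \<alpha> - {#c#}) (Suc i) \<le> count (mset \<alpha> - {#c#}) i" for i
    using le[of i] assms(2) by (cases "i = c") auto
  then obtain \<beta> where b: "lattice \<beta>" "mset \<beta> = mset \<alpha> - {#c#}"
    using partition_lattice_word by blast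
  have c: "c \<in># mset \<alpha>" using assms(2) by (metis count_inI not_less_zero)
  have "addable (incs empty_partition \<beta>) c"
    using le[of "c - 1"] assms(2) by (cases c) (auto simp: addable_def incs_count b empty_partition_def)
  then show thesis using b c by (intro that[of \<beta>]) simp_all
qed

text \<open>Induction on the length. If the last letters are \<open>a < b\<close>, the induction
  hypothesis leads from the two words to words ending in \<open>b - 1, b, a\<close> and
  \<open>b - 1, a, b\<close> with the same beginning. As \<open>a \<le> b - 1 < b\<close>, a single
  move links these.\<close>

lemma lattice_connected:
  assumes "lattice \<alpha>" "lattice \<beta>" "mset \<alpha> = mset \<beta>"
  obtains \<sigma> where "within \<sigma> (length \<alpha>)" "mvs (<) \<sigma> \<alpha> = \<beta>"
proof -
  let ?R = "\<lambda>\<alpha> \<beta>. \<exists>\<sigma>. within \<sigma> (length \<alpha>) \<and> mvs (<) \<sigma> \<alpha> = \<beta>"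
  have sym: "?R \<beta> \<alpha>" if r: "?R \<alpha> \<beta>" for \<alpha> \<beta> :: "nat list"
  proof -
    from r obtain \<sigma> where "within \<sigma> (length \<alpha>)" "mvs (<) \<sigma> \<alpha> = \<beta>" by blast
    then show ?thesis using mvs_rev_mvs[of "(<)" \<sigma> \<alpha>] by (intro exI[of _ "rev \<sigma>"]) auto
  qed
  have trans: "?R \<alpha> \<gamma>" if "?R \<alpha> \<beta>" "?R \<beta> \<gamma>" for \<alpha> \<beta> \<gamma> :: "nat list"
  proof -
    from that obtain \<sigma> \<tau> where "within \<sigma> (length \<alpha>)" "mvs (<) \<sigma> \<alpha> = \<beta>"
      "within \<tau> (length \<beta>)" "mvs (<) \<tau> \<beta> = \<gamma>" by blast
    then show ?thesis by (intro exI[of _ "\<sigma> @ \<tau>"]) auto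
  qed
  have snoc: "?R (\<alpha> @ [a]) (\<beta> @ [a])" if "?R \<alpha> \<beta>" for \<alpha> \<beta> :: "nat list" and a
  proof -
    from that obtain \<sigma> where "within \<sigma> (length \<alpha>)" "mvs (<) \<sigma> \<alpha> = \<beta>" by blast
    then show ?thesis by (intro exI[of _ \<sigma>]) (auto simp: mvs_append_right within_def)
  qed
  have "?R \<alpha> \<beta>" if "n = length \<alpha>" for n
    using assms that
  proof (induction n arbitrary: \<alpha> \<beta>)
    case 0
    then show ?case by (intro exI[of _ "[]"]) auto
  next
    case (Suc n)
    have main: "?R (\<alpha> @ [a]) (\<beta> @ [b])"
      if "lattice (\<alpha> @ [a])" "lattice (\<beta> @ [b])" "mset (\<alpha> @ [a]) = mset (\<beta> @ [b])" "length \<alpha> = n" "a < b"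
      for \<alpha> \<beta> a b
    proof -
      let ?M = "mset \<alpha> + {#a#}"
      have M: "?M = mset \<beta> + {#b#}" using that(3) by simp
      \<comment> \<open>The letter \<open>c = b - 1\<close> separates the two:
        \<open>a \<le> c < b\<close> for every \<open>a < b\<close>.\<close>
      obtain c where b: "b = Suc c" using \<open>a < b\<close> by (cases b) auto
      have le: "count ?M (Suc i) \<le> count ?M i" for i
        using lattice_decreasing[OF that(1), of i] by (simp add: incs_count empty_partition_def)
      have lea: "count (mset \<alpha>) (Suc i) \<le> count (mset \<alpha>) i" for i
        using lattice_decreasing[of \<alpha> i] that(1) by (simp add: incs_count empty_partition_def)
      have leb: "count (mset \<beta>) (Suc i) \<le> count (mset \<beta>) i" for i
        using lattice_decreasing[of \<beta> i] that(2) by (simp add: incs_count empty_partition_def)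
      have eq: "count (mset \<alpha>) i + (if a = i then 1 else 0) = count (mset \<beta>) i + (if b = i then 1 else 0)" for i
        using arg_cong[OF M, of "\<lambda>m. count m i"] by auto
      have ba: "b \<in># mset \<alpha>" using eq[of b] \<open>a < b\<close> by (metis count_inI less_irrefl_nat add_is_0 zero_neq_one)
      \<comment> \<open>The content that remains when both last letters, \<open>a\<close> and
        \<open>b\<close>, are removed.\<close>
      define N where "N = mset \<alpha> - {#b#}"
      have N: "mset \<alpha> = N + {#b#}" using ba by (simp add: N_def)
      have Nb: "mset \<beta> = N + {#a#}" using M N by simp
      have Nle: "count N (Suc i) \<le> count N i" for i
        using lea[of i] leb[of i] \<open>a < b\<close> by (auto simp: N Nb split: if_splits)
      \<comment> \<open>\<open>N\<close> with \<open>b\<close> added is still a partition, so row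
        \<open>c\<close> of \<open>N\<close> is longer than row \<open>b\<close>. Hence it ends in a
        corner, and \<open>c\<close> can be the letter before the last two.\<close>
      have Nc: "count N (Suc c) < count N c"
        using lea[of c] leb[of c] \<open>a < b\<close> by (auto simp: N Nb b split: if_splits)
      obtain \<nu> where nu: "lattice \<nu>" "mset \<nu> = N" using partition_lattice_word[OF Nle] by blast
      obtain \<delta> where d: "lattice (\<delta> @ [c])" "mset (\<delta> @ [c]) = N"
        using lattice_last_corner[OF nu(1), of c] Nc nu(2) by metis
      have inc: "incs empty_partition \<delta> i + (if c = i then 1 else 0) = count N i" for i
        using arg_cong[OF d(2), of "\<lambda>m. count m i"] by (auto simp: incs_count empty_partition_def)
      have m1: "mset (\<delta> @ [c, b]) = mset \<alpha>" and m2: "mset (\<delta> @ [c, a]) = mset \<beta>"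
        using d(2) N Nb by (simp_all add: add_mset_commute)
      have l1: "lattice (\<delta> @ [c, b])"
        using d(1) Nc by (simp add: addable_def inc_def b incs_count empty_partition_def flip: d(2))
      have l2: "lattice (\<delta> @ [c, a])"
      proof -
        have "a = 0 \<or> count N a < count N (a - 1)"
          using leb[of "a - 1"] by (cases a) (auto simp: Nb)
        then have "addable (incs empty_partition (\<delta> @ [c])) a"
          unfolding addable_def incs_count d(2) empty_partition_def by simp
        then show ?thesis using d(1) by simp
      qed
      have lat: "lattice \<alpha>" "lattice \<beta>" using that(1,2) by simp_all
      have "length (\<delta> @ [c, a]) = n"
        using mset_eq_length[OF m2] mset_eq_length[OF that(3)] that(4) by simp
      then have "?R \<alpha> (\<delta> @ [c, b])" "?R (\<delta> @ [c, a]) \<beta>"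
        using Suc.IH[OF lat(1) l1 m1[symmetric]] Suc.IH[OF l2 lat(2) m2] that(4) by force+
      then have r1: "?R (\<alpha> @ [a]) ((\<delta> @ [c, b]) @ [a])" and r2: "?R ((\<delta> @ [c, a]) @ [b]) (\<beta> @ [b])"
        using snoc by blast+
      have "mv3 (<) c b a = [c, a, b]" using \<open>a < b\<close> by (auto simp: mv3_def b)
      then have "mv (<) (length \<delta>) (\<delta> @ c # b # a # []) = \<delta> @ c # a # b # []"
        by (simp add: mv_append)
      then have "?R ((\<delta> @ [c, b]) @ [a]) ((\<delta> @ [c, a]) @ [b])"
        by (intro exI[of _ "[length \<delta>]"]) simp
      with r1 r2 show ?thesis using trans by blast
    qed
    obtain \<alpha>' a where a: "\<alpha> = \<alpha>' @ [a]" using Suc.prems(4) by (cases \<alpha> rule: rev_cases) auto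
    have len: "length \<beta> = Suc n" using Suc.prems by (metis mset_eq_length)
    then obtain \<beta>' b where b: "\<beta> = \<beta>' @ [b]" by (cases \<beta> rule: rev_cases) auto
    consider "a = b" | "a < b" | "b < a" by linarith
    then show ?case
    proof cases
      case 1
      then have "?R \<alpha>' \<beta>'" using Suc.IH[of \<alpha>' \<beta>'] Suc.prems by (simp add: a b)
      then show ?thesis using snoc 1 by (simp add: a b)
    next
      case 2
      have "length \<alpha>' = n" using Suc.prems(4) by (simp add: a)
      then show ?thesis
        using main[of \<alpha>' a \<beta>' b] 2 Suc.prems(1-3) unfolding a b by blast
    next
      case 3
      have "length \<beta>' = n" using len by (simp add: b)
      then have "?R \<beta> \<alpha>"
        using main[of \<beta>' b \<alpha>' a] 3 Suc.prems(1,2) Suc.prems(3)[symmetric] unfolding a b by blast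
      then show ?thesis by (rule sym)
    qed
  qed
  then show thesis using that by blast
qed

text \<open>Two lattice words with the same prefix and different last letters \<open>a < b\<close> are told apart
  after rearranging the prefix so that it ends with \<open>b - 1\<close>.\<close>

lemma lattice_eqI:
  assumes "lattice \<alpha>" "lattice \<beta>" "length \<alpha> = length \<beta>"
    and "\<And>\<sigma> i. within \<sigma> (length \<alpha>) \<Longrightarrow> Suc i < length \<alpha> \<Longrightarrow>
      (mvs (<) \<sigma> \<alpha> ! i < mvs (<) \<sigma> \<alpha> ! Suc i) = (mvs (<) \<sigma> \<beta> ! i < mvs (<) \<sigma> \<beta> ! Suc i)"
  shows "\<alpha> = \<beta>"
  using assms
proof (induction "length \<alpha>" arbitrary: \<alpha> \<beta>)
  case 0
  then show ?case by simp
next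
  case (Suc n)
  obtain \<alpha>' a where a: "\<alpha> = \<alpha>' @ [a]" using Suc.hyps(2) by (cases \<alpha> rule: rev_cases) auto
  obtain \<beta>' b where b: "\<beta> = \<beta>' @ [b]" using Suc.hyps(2) Suc.prems(3) by (cases \<beta> rule: rev_cases) auto
  have len: "length \<alpha>' = n" "length \<beta>' = n" using Suc.hyps(2) Suc.prems(3) by (simp_all add: a b)
  have key: "(mvs (<) \<sigma> \<alpha>' @ [a]) ! i < (mvs (<) \<sigma> \<alpha>' @ [a]) ! Suc i \<longleftrightarrow>
      (mvs (<) \<sigma> \<beta>' @ [b]) ! i < (mvs (<) \<sigma> \<beta>' @ [b]) ! Suc i" if "within \<sigma> n" "Suc i \<le> n" for \<sigma> i
  proof -
    have "within \<sigma> (length \<alpha>)" using that len by (auto simp: within_def a)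
    then show ?thesis
      using Suc.prems(4)[of \<sigma> i] that len by (simp add: a b mvs_append_right)
  qed
  have "\<alpha>' = \<beta>'"
  proof (rule Suc.hyps(1))
    fix \<sigma> i assume "within \<sigma> (length \<alpha>')" "Suc i < length \<alpha>'"
    then show "(mvs (<) \<sigma> \<alpha>' ! i < mvs (<) \<sigma> \<alpha>' ! Suc i) = (mvs (<) \<sigma> \<beta>' ! i < mvs (<) \<sigma> \<beta>' ! Suc i)"
      using key[of \<sigma> i] len by (simp add: nth_append)
  qed (use len Suc.prems in \<open>simp_all add: a b\<close>)
  have False if "lattice (\<gamma> @ [a])" "lattice (\<gamma> @ [b])" "length \<gamma> = n" "a < b"
    "\<And>\<sigma> i. within \<sigma> n \<Longrightarrow> Suc i \<le> n \<Longrightarrow> (mvs (<) \<sigma> \<gamma> @ [a]) ! i < (mvs (<) \<sigma> \<gamma> @ [a]) ! Suc i \<longleftrightarrow>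
      (mvs (<) \<sigma> \<gamma> @ [b]) ! i < (mvs (<) \<sigma> \<gamma> @ [b]) ! Suc i" for a b \<gamma>
  proof -
    obtain c where c: "b = Suc c" using \<open>a < b\<close> by (cases b) auto
    have "count (mset \<gamma>) (Suc c) < count (mset \<gamma>) c"
      using that(2) by (simp add: addable_def c incs_count empty_partition_def)
    moreover have gam: "lattice \<gamma>" and len_gam: "length \<gamma> = n" using that(1,3) by simp_all
    ultimately obtain \<delta> where d: "lattice (\<delta> @ [c])" "mset (\<delta> @ [c]) = mset \<gamma>"
      using lattice_last_corner by blast
    obtain \<sigma> where s: "within \<sigma> n" "mvs (<) \<sigma> \<gamma> = \<delta> @ [c]"
      using lattice_connected[OF gam d(1) d(2)[symmetric]] len_gam by blast
    have "length \<delta> + 1 = n" using mset_eq_length[OF d(2)] len_gam by simp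
    then show False using that(5)[OF s(1), of "length \<delta>"] \<open>a < b\<close>
      by (simp add: s(2) nth_append c)
  qed
  note no = this
  have "lattice (\<alpha>' @ [a])" "lattice (\<alpha>' @ [b])"
    using Suc.prems(1,2) \<open>\<alpha>' = \<beta>'\<close> by (simp_all add: a b)
  then have "\<not> a < b" "\<not> b < a"
    using no[of \<alpha>' a b] no[of \<alpha>' b a] key len(1) \<open>\<alpha>' = \<beta>'\<close> by blast+
  then have "a = b" by simp
  then show ?case using \<open>\<alpha>' = \<beta>'\<close> by (simp add: a b)
qed

section \<open>Growth diagrams of permutations by edge labels\<close>

text \<open>The label of an edge of a growth diagram is the number of the part that increases along the
  edge (counted from 0), or None if the two partitions agree.  From the labels of the left and the
  bottom edge of a cell, the local rule determines those of its right and its top edge.\<close>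

definition edge_rule :: "bool \<Rightarrow> nat option \<Rightarrow> nat option \<Rightarrow> nat option \<times> nat option" where
  "edge_rule one d a = (if one then (Some 0, Some 0)
     else if d = a then (map_option Suc d, map_option Suc a) else (d, a))"

text \<open>A column with its 1 in row r, with the labels d on its left border.\<close>

primrec col_label :: "(nat \<Rightarrow> nat option) \<Rightarrow> nat \<Rightarrow> nat \<Rightarrow> nat option" where
  "col_label d r 0 = None"
| "col_label d r (Suc j) = snd (edge_rule (j = r) (d j) (col_label d r j))"

definition col_out :: "(nat \<Rightarrow> nat option) \<Rightarrow> nat \<Rightarrow> nat \<Rightarrow> nat option" where
  "col_out d r j = fst (edge_rule (j = r) (d j) (col_label d r j))"

primrec right_labels :: "(nat \<Rightarrow> nat option) \<Rightarrow> nat list \<Rightarrow> nat \<Rightarrow> nat option" where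
  "right_labels d [] = d"
| "right_labels d (r # p) = right_labels (col_out d r) p"

text \<open>For \<open>r < N\<close> the use of \<open>the\<close> is harmless: above the row of its
  1, every horizontal edge of a column carries a label.\<close>

primrec top_labels :: "nat \<Rightarrow> (nat \<Rightarrow> nat option) \<Rightarrow> nat list \<Rightarrow> nat list" where
  "top_labels N d [] = []"
| "top_labels N d (r # p) = the (col_label d r N) # top_labels N (col_out d r) p"

lemma right_labels_append [simp]: "right_labels d (p @ q) = right_labels (right_labels d p) q"
  by (induction p arbitrary: d) simp_all

lemma top_labels_append [simp]:
  "top_labels N d (p @ q) = top_labels N d p @ top_labels N (right_labels d p) q"
  by (induction p arbitrary: d) simp_all

lemma length_top_labels [simp]: "length (top_labels N d p) = length p"
  by (induction p arbitrary: d) simp_all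

lemma col_label_None: "j \<le> r \<Longrightarrow> col_label d r j = None"
  by (induction j) (auto simp: edge_rule_def)

lemma col_label_Some: "r < j \<Longrightarrow> \<exists>a. col_label d r j = Some a"
proof (induction j)
  case (Suc j)
  then show ?case by (cases "j = r") (auto simp: edge_rule_def)
qed simp

lemma col_out_None_iff: "col_out d r j = None \<longleftrightarrow> d j = None \<and> j \<noteq> r"
  by (auto simp: col_out_def edge_rule_def)

lemma right_labels_None_iff: "right_labels d p j = None \<longleftrightarrow> d j = None \<and> j \<notin> set p"
  by (induction p arbitrary: d) (auto simp: col_out_None_iff)

subsection \<open>Descents\<close>

text \<open>Going upwards, the comparison is settled in the row of the higher 1 and never changes
  afterwards: a row that raises the left label passes the raised value on, and so raises the right
  label too if that was just one larger.\<close>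

lemma descent_columns:
  assumes "d r = None" "d s = None" "r \<noteq> s" "r < j" "s < j"
    and "col_label d r j = Some a" "col_label (col_out d r) s j = Some b"
  shows "a < b \<longleftrightarrow> s < r"
proof -
  have "\<exists>a b. col_label d r j = Some a \<and> col_label (col_out d r) s j = Some b \<and> (a < b \<longleftrightarrow> s < r)"
    if "r < j" "s < j" for j
    using that
  proof (induction j)
    case (Suc j)
    consider "j = r" | "j = s" "j \<noteq> r" | "r < j" "s < j" using Suc.prems by linarith
    then show ?case
    proof cases
      case 1
      then have "s < j" using Suc.prems assms(3) by simp
      then obtain b where "col_label (col_out d r) s j = Some b" using col_label_Some by blast
      moreover have "col_out d r j = Some 0" using 1 by (simp add: col_out_def edge_rule_def)
      ultimately show ?thesis using 1 assms(3) \<open>s < j\<close> by (auto simp: edge_rule_def)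
    next
      case 2
      then have "r < j" using Suc.prems by simp
      then obtain a where "col_label d r j = Some a" using col_label_Some by blast
      moreover have "col_label d r (Suc j) = Some a"
        using 2 assms(2) calculation by (auto simp: col_out_def edge_rule_def)
      ultimately show ?thesis using 2 \<open>r < j\<close> by (auto simp: edge_rule_def)
    next
      case 3
      with Suc.IH obtain a b where "col_label d r j = Some a" "col_label (col_out d r) s j = Some b"
        "a < b \<longleftrightarrow> s < r" by blast
      then show ?thesis using 3 by (cases "d j") (auto simp: edge_rule_def col_out_def[of d r j])
    qed
  qed simp
  from this[OF assms(4,5)] assms(6,7) show ?thesis by auto
qed

text \<open>The transposed statement: two adjacent rows are followed from left to right, and the
  comparison is settled in the column of the second 1. The split of \<open>p\<close> into
  \<open>u\<close> and \<open>v\<close> expresses which of the two values comes first.\<close>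

lemma descent_rows:
  assumes "distinct p" "Suc j \<in> set p" "j \<in> set p"
    and "right_labels (\<lambda>_. None) p j = Some a" "right_labels (\<lambda>_. None) p (Suc j) = Some b"
    and "p = u @ v" "j \<in> set u \<longleftrightarrow> Suc j \<notin> set u"
  shows "a < b \<longleftrightarrow> Suc j \<in> set u"
proof -
  let ?R = "right_labels (\<lambda>_. None)"
  have start: "\<exists>a b. ?R (q @ [r]) j = Some a \<and> ?R (q @ [r]) (Suc j) = Some b \<and> (a < b \<longleftrightarrow> r = j)"
    if "distinct (q @ [r])" "r = j \<and> Suc j \<in> set q \<or> r = Suc j \<and> j \<in> set q" for q r
  proof (cases "r = j")
    case True
    then have "?R q j = None" "Suc j \<in> set q" using that by (auto simp: right_labels_None_iff)
    moreover from this obtain b where "?R q (Suc j) = Some b"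
      by (metis not_None_eq right_labels_None_iff)
    ultimately show ?thesis using True
      by (auto simp: col_out_def edge_rule_def col_label_None)
  next
    case False
    then have "?R q (Suc j) = None" "j \<in> set q" "r = Suc j" using that by (auto simp: right_labels_None_iff)
    moreover from this obtain b where "?R q j = Some b"
      by (metis not_None_eq right_labels_None_iff)
    ultimately show ?thesis using False
      by (auto simp: col_out_def edge_rule_def col_label_None)
  qed
  have pass: "\<exists>a b. col_out d r j = Some a \<and> col_out d r (Suc j) = Some b \<and> (a < b \<longleftrightarrow> X)"
    if "d j = Some a'" "d (Suc j) = Some b'" "a' < b' \<longleftrightarrow> X" "r \<noteq> j" "r \<noteq> Suc j" for d r a' b' X
    using that by (cases "col_label d r j") (auto simp: col_out_def edge_rule_def)
  have main: "\<exists>a b. ?R p j = Some a \<and> ?R p (Suc j) = Some b \<and> (a < b \<longleftrightarrow> X)"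
    if "distinct p" "j \<in> set p" "Suc j \<in> set p"
      "\<And>q r s. p = q @ r # s \<Longrightarrow> r = j \<and> Suc j \<in> set q \<or> r = Suc j \<and> j \<in> set q \<Longrightarrow> (r = j) = X" for p X
    using that
  proof (induction p rule: rev_induct)
    case (snoc r p)
    show ?case
    proof (cases "r = j \<or> r = Suc j")
      case True
      then have "r = j \<and> Suc j \<in> set p \<or> r = Suc j \<and> j \<in> set p" using snoc.prems by auto
      then show ?thesis using start[of p r] snoc.prems(1) snoc.prems(4)[of p r "[]"] by simp
    next
      case False
      have "(s = j) = X" if "p = q @ s # t" "s = j \<and> Suc j \<in> set q \<or> s = Suc j \<and> j \<in> set q" for q s t
        using snoc.prems(4)[of q s "t @ [r]"] that by simp
      moreover have "distinct p" "j \<in> set p" "Suc j \<in> set p" using snoc.prems False by auto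
      ultimately obtain a b where "?R p j = Some a" "?R p (Suc j) = Some b" "(a < b) = X"
        using snoc.IH by blast
      then show ?thesis using pass[of "?R p" a b X r] False by simp
    qed
  qed simp
  have "(r = j) = (Suc j \<in> set u)"
    if "p = q @ r # s" "r = j \<and> Suc j \<in> set q \<or> r = Suc j \<and> j \<in> set q" for q r s
  proof -
    have "u @ v = q @ r # s" using that(1) assms(6) by simp
    then consider w where "u = q @ r # w" | w where "v = w @ r # s" "q = u @ w"
      by (auto simp: append_eq_append_conv2 append_eq_Cons_conv Cons_eq_append_conv)
    then show ?thesis
    proof cases
      case 1
      then show ?thesis using that(2) assms(7) by auto
    next
      case 2
      then show ?thesis using that(2) assms(1,6,7) by auto
    qed
  qed
  from main[OF assms(1,3,2) this] assms(4,5) show ?thesis by auto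
qed

subsection \<open>Moves of permutations\<close>

text \<open>One row of three adjacent columns, as a map from the left label and the three bottom
  labels to the right label and the three top labels. It allows two diagrams to be compared row by
  row.\<close>

definition row3 :: "bool \<Rightarrow> bool \<Rightarrow> bool \<Rightarrow> nat option \<Rightarrow> nat option list \<Rightarrow> nat option \<times> nat option list" where
  "row3 b1 b2 b3 d h = (case h of [h1, h2, h3] \<Rightarrow>
     (let e1 = edge_rule b1 d h1; e2 = edge_rule b2 (fst e1) h2; e3 = edge_rule b3 (fst e2) h3
      in (fst e3, [snd e1, snd e2, snd e3])) | _ \<Rightarrow> undefined)"

definition labels3 :: "(nat \<Rightarrow> nat option) \<Rightarrow> nat \<Rightarrow> nat \<Rightarrow> nat \<Rightarrow> nat \<Rightarrow> nat option list" where
  "labels3 d r s t j = [col_label d r j, col_label (col_out d r) s j,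
     col_label (col_out (col_out d r) s) t j]"

lemma labels3_0: "labels3 d r s t 0 = [None, None, None]"
  by (simp add: labels3_def)

lemma labels3_Suc:
  "labels3 d r s t (Suc j) = snd (row3 (j = r) (j = s) (j = t) (d j) (labels3 d r s t j))"
  by (simp add: labels3_def row3_def col_out_def Let_def)

lemma right_labels3:
  "right_labels d [r, s, t] j = fst (row3 (j = r) (j = s) (j = t) (d j) (labels3 d r s t j))"
  by (simp add: labels3_def row3_def col_out_def Let_def)

text \<open>Covers only proper moves; monotone triples, which \<open>mv3\<close> fixes, are
  excluded.\<close>

definition swapped_labels :: "nat option list \<Rightarrow> nat option list \<Rightarrow> bool" where
  "swapped_labels h k \<longleftrightarrow> (\<exists>a b c. (a < b) \<noteq> (b < c) \<and> h = [Some a, Some b, Some c] \<and>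
     k = map Some (mv3 (<) a b c))"

lemma swapped_labels_iff:
  "swapped_labels [Some a, Some b, Some c] [Some a', Some b', Some c'] \<longleftrightarrow>
     (a < b) \<noteq> (b < c) \<and> [a', b', c'] = mv3 (<) a b c"
  unfolding swapped_labels_def by (auto simp: mv3_def)

lemma swapped_labelsE:
  assumes "swapped_labels h k"
  obtains a b c where "a < b" "c \<le> b" "a < c" "h = [Some a, Some b, Some c]" "k = [Some b, Some a, Some c]"
  | a b c where "a < b" "c \<le> b" "c \<le> a" "h = [Some a, Some b, Some c]" "k = [Some a, Some c, Some b]"
  | a b c where "b \<le> a" "b < c" "a < c" "h = [Some a, Some b, Some c]" "k = [Some a, Some c, Some b]"
  | a b c where "b \<le> a" "b < c" "c \<le> a" "h = [Some a, Some b, Some c]" "k = [Some b, Some a, Some c]"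
proof -
  obtain a b c where *: "(a < b) \<noteq> (b < c)" "h = [Some a, Some b, Some c]" "k = map Some (mv3 (<) a b c)"
    using assms unfolding swapped_labels_def by blast
  consider "a < b" "c \<le> b" "a < c" | "a < b" "c \<le> b" "c \<le> a" | "b \<le> a" "b < c" "a < c" | "b \<le> a" "b < c" "c \<le> a"
    using *(1) by linarith
  then show thesis by cases (use * that in \<open>auto simp: mv3_def\<close>)
qed

lemma swapped_labels_row3:
  assumes "swapped_labels h k"
  shows "fst (row3 False False False d h) = fst (row3 False False False d k) \<and>
    swapped_labels (snd (row3 False False False d h)) (snd (row3 False False False d k))"
  using assms
  by (cases rule: swapped_labelsE; cases d)
    (auto simp: swapped_labels_iff row3_def edge_rule_def mv3_def Let_def)

text \<open>Invariant at height \<open>j\<close> for columns with 1's in rows \<open>x, z, y\<close>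
  (labels \<open>h\<close>) against \<open>z, x, y\<close> (labels \<open>k\<close>), where
  \<open>x < y < z\<close>. Each of the three rows starts a new stage; the inequality between
  \<open>s\<close> and \<open>t\<close> is the non-descent from \<open>x\<close> to
  \<open>y\<close>. In \<open>stageB\<close> the orders are \<open>y, x, z\<close> and
  \<open>y, z, x\<close>, with a descent from \<open>y\<close> to \<open>x\<close>.\<close>

definition stageA :: "nat \<Rightarrow> nat \<Rightarrow> nat \<Rightarrow> nat \<Rightarrow> nat option list \<Rightarrow> nat option list \<Rightarrow> bool" where
  "stageA x y z j h k \<longleftrightarrow>
     (if j \<le> x then h = [None, None, None] \<and> k = [None, None, None]
      else if j \<le> y then \<exists>s. h = [Some s, None, None] \<and> k = [None, Some s, None]
      else if j \<le> z then \<exists>s t. t \<le> s \<and> h = [Some s, None, Some t] \<and> k = [None, Some s, Some t]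
      else swapped_labels h k)"

definition stageB :: "nat \<Rightarrow> nat \<Rightarrow> nat \<Rightarrow> nat \<Rightarrow> nat option list \<Rightarrow> nat option list \<Rightarrow> bool" where
  "stageB x y z j h k \<longleftrightarrow>
     (if j \<le> x then h = [None, None, None] \<and> k = [None, None, None]
      else if j \<le> y then \<exists>s. h = [None, Some s, None] \<and> k = [None, None, Some s]
      else if j \<le> z then \<exists>s t. t < s \<and> h = [Some t, Some s, None] \<and> k = [Some t, None, Some s]
      else swapped_labels h k)"

lemma stageA_row3:
  assumes "stageA x y z j h k" "x < y" "y < z" "j \<in> {x, y, z} \<longrightarrow> d = None"
  shows "fst (row3 (j = x) (j = z) (j = y) d h) = fst (row3 (j = z) (j = x) (j = y) d k) \<and>
    stageA x y z (Suc j) (snd (row3 (j = x) (j = z) (j = y) d h)) (snd (row3 (j = z) (j = x) (j = y) d k))"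
proof -
  consider "j < x" | "j = x" | "x < j" "j < y" | "j = y" | "y < j" "j < z" | "j = z" | "z < j"
    by linarith
  then show ?thesis
  proof cases
    case 7
    then show ?thesis using assms swapped_labels_row3[of h k d] by (auto simp: stageA_def)
  qed (use assms in \<open>auto simp: stageA_def row3_def edge_rule_def swapped_labels_iff mv3_def Let_def\<close>)
qed

lemma stageB_row3:
  assumes "stageB x y z j h k" "x < y" "y < z" "j \<in> {x, y, z} \<longrightarrow> d = None"
  shows "fst (row3 (j = y) (j = x) (j = z) d h) = fst (row3 (j = y) (j = z) (j = x) d k) \<and>
    stageB x y z (Suc j) (snd (row3 (j = y) (j = x) (j = z) d h)) (snd (row3 (j = y) (j = z) (j = x) d k))"
proof -
  consider "j < x" | "j = x" | "x < j" "j < y" | "j = y" | "y < j" "j < z" | "j = z" | "z < j"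
    by linarith
  then show ?thesis
  proof cases
    case 7
    then show ?thesis using assms swapped_labels_row3[of h k d] by (auto simp: stageB_def)
  qed (use assms in \<open>auto simp: stageB_def row3_def edge_rule_def swapped_labels_iff mv3_def Let_def\<close>)
qed

lemma columnsA:
  assumes "d x = None" "d y = None" "d z = None" "x < y" "y < z"
  shows "right_labels d [x, z, y] = right_labels d [z, x, y]"
    and "z < N \<Longrightarrow> swapped_labels (labels3 d x z y N) (labels3 d z x y N)"
proof -
  have st: "stageA x y z j (labels3 d x z y j) (labels3 d z x y j)" for j
  proof (induction j)
    case 0
    then show ?case by (simp add: stageA_def labels3_0)
  next
    case (Suc j)
    show ?case unfolding labels3_Suc using stageA_row3[OF Suc assms(4,5), of "d j"] assms by auto
  qed
  show "right_labels d [x, z, y] = right_labels d [z, x, y]"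
  proof
    fix j show "right_labels d [x, z, y] j = right_labels d [z, x, y] j"
      unfolding right_labels3 using stageA_row3[OF st assms(4,5), of j "d j"] assms by auto
  qed
  show "z < N \<Longrightarrow> swapped_labels (labels3 d x z y N) (labels3 d z x y N)"
    using st[of N] assms by (simp add: stageA_def)
qed

lemma columnsB:
  assumes "d x = None" "d y = None" "d z = None" "x < y" "y < z"
  shows "right_labels d [y, x, z] = right_labels d [y, z, x]"
    and "z < N \<Longrightarrow> swapped_labels (labels3 d y x z N) (labels3 d y z x N)"
proof -
  have st: "stageB x y z j (labels3 d y x z j) (labels3 d y z x j)" for j
  proof (induction j)
    case 0
    then show ?case by (simp add: stageB_def labels3_0)
  next
    case (Suc j)
    show ?case unfolding labels3_Suc using stageB_row3[OF Suc assms(4,5), of "d j"] assms by auto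
  qed
  show "right_labels d [y, x, z] = right_labels d [y, z, x]"
  proof
    fix j show "right_labels d [y, x, z] j = right_labels d [y, z, x] j"
      unfolding right_labels3 using stageB_row3[OF st assms(4,5), of j "d j"] assms by auto
  qed
  show "z < N \<Longrightarrow> swapped_labels (labels3 d y x z N) (labels3 d y z x N)"
    using st[of N] assms by (simp add: stageB_def)
qed

lemma swapped_labels_sym: "swapped_labels h k \<Longrightarrow> swapped_labels k h"
  by (erule swapped_labelsE) (simp_all add: swapped_labels_iff mv3_def)

lemma top_labels3: "top_labels N d [r, s, t] = map the (labels3 d r s t N)"
  by (simp add: labels3_def)

lemma swapped_labels_the:
  "swapped_labels h k \<Longrightarrow> map the k = mv3 (<) (the (h ! 0)) (the (h ! 1)) (the (h ! 2))"
  by (auto simp: swapped_labels_def comp_def)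

text \<open>With the three letters sorted as \<open>x < y < z\<close>, the four pairs are the two
  Knuth relations, each in both directions.\<close>

lemma mv3_swaps:
  fixes a b c :: nat
  assumes "distinct [a, b, c]" "(b < a) \<noteq> (c < b)"
  obtains x y z where "x < y" "y < z"
    "([a, b, c], mv3 (\<lambda>a b. b < a) a b c) \<in>
      {([x, z, y], [z, x, y]), ([z, x, y], [x, z, y]), ([y, x, z], [y, z, x]), ([y, z, x], [y, x, z])}"
proof -
  have "a \<noteq> b" "b \<noteq> c" "a \<noteq> c" "b < a \<and> \<not> c < b \<or> \<not> b < a \<and> c < b" using assms by auto
  then consider "a < c" "c < b" | "b < c" "c < a" | "b < a" "a < c" | "c < a" "a < b"
    by linarith
  then show thesis
  proof cases
    case 1
    then show thesis using that[of a c b] by (simp add: mv3_def)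
  next
    case 2
    then show thesis using that[of b c a] by (simp add: mv3_def)
  next
    case 3
    then show thesis using that[of b a c] by (simp add: mv3_def)
  next
    case 4
    then show thesis using that[of c a b] by (simp add: mv3_def)
  qed
qed

lemma columns_mv3:
  assumes "d a = None" "d b = None" "d c = None" "distinct [a, b, c]" "a < N" "b < N" "c < N"
  shows "right_labels d (mv3 (\<lambda>a b. b < a) a b c) = right_labels d [a, b, c]"
    and "top_labels N d (mv3 (\<lambda>a b. b < a) a b c) =
      (case top_labels N d [a, b, c] of [a', b', c'] \<Rightarrow> mv3 (<) a' b' c')"
proof -
  let ?m = "mv3 (\<lambda>a b :: nat. b < a) a b c"
  have "right_labels d ?m = right_labels d [a, b, c] \<and>
    top_labels N d ?m = (case top_labels N d [a, b, c] of [a', b', c'] \<Rightarrow> mv3 (<) a' b' c')"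
  proof (cases "(b < a) = (c < b)")
    case True
    obtain a' b' c' where l: "labels3 d a b c N = [Some a', Some b', Some c']"
      using assms(5-7) col_label_Some unfolding labels3_def by metis
    have "a' < b' \<longleftrightarrow> b < a" "b' < c' \<longleftrightarrow> c < b"
      using l assms descent_columns[of d a b N a' b'] descent_columns[of "col_out d a" b c N b' c']
      by (auto simp: labels3_def col_out_None_iff)
    then have "mv3 (<) a' b' c' = [a', b', c']" using True by (simp add: mv3_def)
    then show ?thesis using True l by (simp add: mv3_def top_labels3 del: top_labels.simps)
  next
    case False
    then obtain x y z where xyz: "x < y" "y < z"
      and m: "([a, b, c], ?m) \<in> {([x, z, y], [z, x, y]), ([z, x, y], [x, z, y]), ([y, x, z], [y, z, x]), ([y, z, x], [y, x, z])}"
      using mv3_swaps[OF assms(4)] by metis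
    have N: "d x = None" "d y = None" "d z = None" "z < N"
      using m assms by auto
    note AB = columnsA[OF N(1-3) xyz] columnsB[OF N(1-3) xyz]
    have sw: "top_labels N d [r, s, t] = (case top_labels N d [r', s', t'] of [a', b', c'] \<Rightarrow> mv3 (<) a' b' c')"
      if "swapped_labels (labels3 d r' s' t' N) (labels3 d r s t N)" for r s t r' s' t'
      unfolding top_labels3 swapped_labels_the[OF that]
      using that by (auto simp: swapped_labels_def)
    have A: "swapped_labels (labels3 d x z y N) (labels3 d z x y N)"
      and B: "swapped_labels (labels3 d y x z N) (labels3 d y z x N)"
      using AB(2,4) N(4) by blast+
    note swaps = A B swapped_labels_sym[OF A] swapped_labels_sym[OF B]
    from m consider "[a, b, c] = [x, z, y]" "?m = [z, x, y]" | "[a, b, c] = [z, x, y]" "?m = [x, z, y]"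
      | "[a, b, c] = [y, x, z]" "?m = [y, z, x]" | "[a, b, c] = [y, z, x]" "?m = [y, x, z]"
      unfolding insert_iff prod.inject empty_iff by blast
    then show ?thesis
    proof cases
      case 1
      show ?thesis unfolding 1 using AB(1) sw[OF swaps(1)] by metis
    next
      case 2
      show ?thesis unfolding 2 using AB(1) sw[OF swaps(3)] by metis
    next
      case 3
      show ?thesis unfolding 3 using AB(3) sw[OF swaps(2)] by metis
    next
      case 4
      show ?thesis unfolding 4 using AB(3) sw[OF swaps(4)] by metis
    qed
  qed
  then show "right_labels d ?m = right_labels d [a, b, c]"
    "top_labels N d ?m = (case top_labels N d [a, b, c] of [a', b', c'] \<Rightarrow> mv3 (<) a' b' c')"
    by blast+
qed

text \<open>The columns to the left of the three are untouched, and those to the right see only the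
  vertical labels between them, which the exchange preserves. The order is reversed on the side of Q
  because a descent of the permutation is an ascent of the labels.\<close>

lemma labels_mv:
  assumes "distinct p" "\<forall>r\<in>set p. r < N"
  shows "right_labels (\<lambda>_. None) (mv (\<lambda>a b. b < a) i p) = right_labels (\<lambda>_. None) p"
    and "top_labels N (\<lambda>_. None) (mv (\<lambda>a b. b < a) i p) = mv (<) i (top_labels N (\<lambda>_. None) p)"
proof -
  let ?d = "\<lambda>_ :: nat. None :: nat option"
  have "right_labels ?d (mv (\<lambda>a b. b < a) i p) = right_labels ?d p \<and>
    top_labels N ?d (mv (\<lambda>a b. b < a) i p) = mv (<) i (top_labels N ?d p)"
  proof (cases "i + 2 < length p")
    case True
    then obtain U a b c V where p: "p = U @ a # b # c # V" and i: "length U = i"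
      by (rule split3)
    let ?e = "right_labels ?d U"
    have e: "?e a = None" "?e b = None" "?e c = None"
      using assms(1) by (auto simp: p right_labels_None_iff)
    have abc: "distinct [a, b, c]" "a < N" "b < N" "c < N" using assms by (auto simp: p)
    note c3 = columns_mv3[OF e abc]
    have q: "p = U @ [a, b, c] @ V" by (simp add: p)
    obtain a' b' c' where t: "top_labels N ?e [a, b, c] = [a', b', c']" by simp
    have "mv (<) i (top_labels N ?d p) = top_labels N ?d U @ mv3 (<) a' b' c' @ top_labels N (right_labels ?e [a, b, c]) V"
      using mv_append[of "(<)" "top_labels N ?d U" a' b' c'] t i
      unfolding q top_labels_append by simp
    then show ?thesis using c3 t i mv_append[of "\<lambda>a b. b < a" U a b c V]
      unfolding p by (simp del: top_labels.simps right_labels.simps) (simp add: p)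
  qed (simp add: mv_def)
  then show "right_labels ?d (mv (\<lambda>a b. b < a) i p) = right_labels ?d p"
    "top_labels N ?d (mv (\<lambda>a b. b < a) i p) = mv (<) i (top_labels N ?d p)" by blast+
qed

lemma labels_descent:
  assumes "distinct p" "\<forall>r\<in>set p. r < N" "Suc i < length p"
  shows "top_labels N (\<lambda>_. None) p ! i < top_labels N (\<lambda>_. None) p ! Suc i \<longleftrightarrow> p ! Suc i < p ! i"
proof -
  define U V where "U = take i p" and "V = drop (Suc (Suc i)) p"
  have p: "p = U @ p ! i # p ! Suc i # V"
    using assms(3) by (simp add: U_def V_def Cons_nth_drop_Suc)
  have len: "length U = i" using assms(3) by (simp add: U_def)
  let ?d = "right_labels (\<lambda>_. None) U"
  let ?r = "p ! i" and ?s = "p ! Suc i"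
  have d: "distinct (U @ ?r # ?s # V)" "\<forall>r\<in>set (U @ ?r # ?s # V). r < N" using assms p by metis+
  then have "?d ?r = None" "?d ?s = None" "?r \<noteq> ?s" "?r < N" "?s < N"
    by (auto simp: right_labels_None_iff)
  moreover obtain a b where "col_label ?d ?r N = Some a" "col_label (col_out ?d ?r) ?s N = Some b"
    using calculation col_label_Some by metis
  moreover have "top_labels N (\<lambda>_. None) p = top_labels N (\<lambda>_. None) U @ the (col_label ?d ?r N) #
      the (col_label (col_out ?d ?r) ?s N) # top_labels N (col_out (col_out ?d ?r) ?s) V"
    by (subst p) simp
  ultimately show ?thesis using descent_columns[of ?d ?r ?s N a b] by (simp add: nth_append len)
qed

subsection \<open>Injectivity\<close>

text \<open>Raised labels are successors, so two equal labels 0 can only leave a cell that contains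
  a 1.\<close>

lemma edge_rule_inj:
  assumes "edge_rule b d a = edge_rule b' d' a'" "b \<longrightarrow> d = None \<and> a = None" "b' \<longrightarrow> d' = None \<and> a' = None"
  shows "b = b' \<and> d = d' \<and> a = a'"
  using assms by (cases d; cases d'; cases a; cases a') (auto simp: edge_rule_def split: if_splits)

lemma column_inj:
  assumes "d r = None" "d' r' = None"
    and "col_label d r N = col_label d' r' N" "\<And>j. j < N \<Longrightarrow> col_out d r j = col_out d' r' j" "r < N" "r' < N"
  shows "r = r' \<and> (\<forall>j<N. d j = d' j)"
proof -
  have before: "(j = r) = (j = r') \<and> d j = d' j \<and> col_label d r j = col_label d' r' j"
    if "col_label d r (Suc j) = col_label d' r' (Suc j)" "j < N" for j
  proof (rule edge_rule_inj)
    show "edge_rule (j = r) (d j) (col_label d r j) = edge_rule (j = r') (d' j) (col_label d' r' j)"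
      using that assms(4)[of j] by (intro prod_eqI) (simp_all add: col_out_def)
  qed (use assms in \<open>auto simp: col_label_None\<close>)
  have "j \<le> N \<Longrightarrow> col_label d r j = col_label d' r' j" for j
  proof (induction rule: inc_induct)
    case (step j)
    then show ?case using before[of j] by blast
  qed (rule assms(3))
  then have "(j = r) = (j = r') \<and> d j = d' j" if "j < N" for j
    using before[OF _ that] that by (simp add: Suc_leI del: col_label.simps)
  then show ?thesis using assms(5) by blast
qed

text \<open>The columns are reconstructed from right to left, and each of them from top to bottom,
  by inverting the local rule.\<close>

lemma labels_inj:
  assumes "distinct p" "distinct q" "\<forall>r\<in>set p. r < N" "\<forall>r\<in>set q. r < N" "length p = length q"
    and "\<And>j. j < N \<Longrightarrow> right_labels (\<lambda>_. None) p j = right_labels (\<lambda>_. None) q j"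
    and "top_labels N (\<lambda>_. None) p = top_labels N (\<lambda>_. None) q"
  shows "p = q"
  using assms
proof (induction p arbitrary: q rule: rev_induct)
  case (snoc r p)
  obtain q' s where q: "q = q' @ [s]" using snoc.prems(5) by (cases q rule: rev_cases) auto
  let ?d = "right_labels (\<lambda>_. None) p" and ?e = "right_labels (\<lambda>_. None) q'"
  have rs: "r < N" "s < N" using snoc.prems by (auto simp: q)
  then obtain a b where ab: "col_label ?d r N = Some a" "col_label ?e s N = Some b"
    using col_label_Some by metis
  have "r = s \<and> (\<forall>j<N. ?d j = ?e j)"
  proof (rule column_inj)
    show "col_label ?d r N = col_label ?e s N" using snoc.prems(5,7) ab by (simp add: q)
    show "j < N \<Longrightarrow> col_out ?d r j = col_out ?e s j" for j using snoc.prems(6)[of j] by (simp add: q)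
  qed (use snoc.prems rs in \<open>auto simp: q right_labels_None_iff\<close>)
  then show ?case using snoc.IH[of q'] snoc.prems by (simp add: q)
qed simp

subsection \<open>Labels and partitions\<close>

definition perm_cells :: "nat list \<Rightarrow> (nat \<times> nat) set" where
  "perm_cells p = {(t, p ! t) | t. t < length p}"

definition add_label :: "nat option \<Rightarrow> partition \<Rightarrow> partition" where
  "add_label d \<kappa> = (case d of None \<Rightarrow> \<kappa> | Some g \<Rightarrow> inc g \<kappa>)"

definition decreasing :: "partition \<Rightarrow> bool" where
  "decreasing \<kappa> \<longleftrightarrow> (\<forall>i. \<kappa> (Suc i) \<le> \<kappa> i)"

lemma inc_neq: "inc g \<kappa> \<noteq> \<kappa>" "\<kappa> \<noteq> inc g \<kappa>" "inc g \<kappa> = inc h \<kappa> \<longleftrightarrow> g = h"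
  by (auto simp: inc_def fun_eq_iff split: if_splits)

lemma local_rule_labels:
  assumes "one \<longrightarrow> d = None \<and> a = None"
  shows "local_rule one \<kappa> (add_label d \<kappa>) (add_label a \<kappa>) = add_label (snd (edge_rule one d a)) (add_label d \<kappa>)"
    and "local_rule one \<kappa> (add_label d \<kappa>) (add_label a \<kappa>) = add_label (fst (edge_rule one d a)) (add_label a \<kappa>)"
proof -
  have the: "(THE i. \<kappa> i \<noteq> inc g \<kappa> i) = g" for g by (auto simp: inc_def)
  have sup: "sup \<kappa> (inc g \<kappa>) = inc g \<kappa>" "sup (inc g \<kappa>) \<kappa> = inc g \<kappa>" for g
    by (auto simp: inc_def fun_eq_iff sup_nat_def)
  have sup2: "sup (inc g \<kappa>) (inc h \<kappa>) = inc h (inc g \<kappa>)" if "g \<noteq> h" for g h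
    using that by (auto simp: inc_def fun_eq_iff sup_nat_def)
  have comm: "inc h (inc g \<kappa>) = inc g (inc h \<kappa>)" for g h
    by (auto simp: inc_def fun_eq_iff)
  have bump: "(inc g \<kappa>)(Suc g := Suc (inc g \<kappa> (Suc g))) = inc (Suc g) (inc g \<kappa>)" for g
    by (simp add: inc_def)
  show "local_rule one \<kappa> (add_label d \<kappa>) (add_label a \<kappa>) = add_label (snd (edge_rule one d a)) (add_label d \<kappa>)"
    "local_rule one \<kappa> (add_label d \<kappa>) (add_label a \<kappa>) = add_label (fst (edge_rule one d a)) (add_label a \<kappa>)"
    using assms
    by (cases d; cases a; auto simp: local_rule_def add_label_def edge_rule_def inc_neq the sup sup2 comm bump inc_def[of 0] Let_def)+
qed

text \<open>The second alternative, a 1 in a cell whose left or bottom edge already carries a label,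
  does not occur if every row and every column has at most one 1.\<close>

lemma local_rule_decreasing:
  assumes "decreasing \<kappa>" "decreasing (add_label d \<kappa>)" "decreasing (add_label a \<kappa>)"
  shows "decreasing (add_label (snd (edge_rule one d a)) (add_label d \<kappa>)) \<or> one \<and> \<not> (d = None \<and> a = None)"
proof -
  have 1: "decreasing (inc 0 \<kappa>)" using assms(1) by (auto simp: decreasing_def inc_def le_Suc_eq)
  have 2: "decreasing (inc g (inc h \<kappa>))" if "decreasing (inc g \<kappa>)" "decreasing (inc h \<kappa>)" "g \<noteq> h" for g h
    unfolding decreasing_def
  proof
    fix i show "inc g (inc h \<kappa>) (Suc i) \<le> inc g (inc h \<kappa>) i"
      using that(1)[unfolded decreasing_def, rule_format, of i] that(2)[unfolded decreasing_def, rule_format, of i] that(3)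
      by (auto simp: inc_def split: if_splits)
  qed
  have 3: "decreasing (inc (Suc g) (inc g \<kappa>))" if "decreasing (inc g \<kappa>)" for g
    unfolding decreasing_def
  proof
    fix i show "inc (Suc g) (inc g \<kappa>) (Suc i) \<le> inc (Suc g) (inc g \<kappa>) i"
      using that[unfolded decreasing_def, rule_format, of i] assms(1)[unfolded decreasing_def, rule_format, of i]
      by (auto simp: inc_def split: if_splits)
  qed
  show ?thesis using assms 1 2 3
    by (cases d; cases a) (auto simp: add_label_def edge_rule_def)
qed

lemma growth_0: "growth S i 0 = empty_partition"
  by (cases i) simp_all

text \<open>Vertical edges, partitions and horizontal edges are treated in one induction on the
  columns, as the local rule needs all of them on the lower left side of a cell.\<close>

lemma growth_labels:
  assumes "distinct p" "i \<le> length p"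
  shows "(\<forall>j. growth (perm_cells p) i (Suc j) =
            add_label (right_labels (\<lambda>_. None) (take i p) j) (growth (perm_cells p) i j)) \<and>
         (\<forall>j. decreasing (growth (perm_cells p) i j)) \<and>
         (\<forall>j k. i = Suc k \<longrightarrow> growth (perm_cells p) i j =
            add_label (col_label (right_labels (\<lambda>_. None) (take k p)) (p ! k) j) (growth (perm_cells p) k j))"
  using assms(2)
proof (induction i)
  case 0
  then show ?case by (simp add: add_label_def decreasing_def empty_partition_def)
next
  case (Suc i)
  let ?S = "perm_cells p" and ?d = "right_labels (\<lambda>_. None) (take i p)" and ?r = "p ! i"
  have IH: "growth ?S i (Suc j) = add_label (?d j) (growth ?S i j)" "decreasing (growth ?S i j)" for j
    using Suc by simp_all
  have tk: "take (Suc i) p = take i p @ [?r]" using Suc.prems by (simp add: take_Suc_conv_app_nth)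
  have "distinct (take (Suc i) p)" using assms(1) by simp
  then have d: "?d ?r = None" unfolding tk by (simp add: right_labels_None_iff)
  have S: "(i, j) \<in> ?S \<longleftrightarrow> j = ?r" for j using Suc.prems by (auto simp: perm_cells_def)
  have one: "j = ?r \<longrightarrow> ?d j = None \<and> col_label ?d ?r j = None" for j using d by (auto simp: col_label_None)
  have H: "growth ?S (Suc i) j = add_label (col_label ?d ?r j) (growth ?S i j) \<and> decreasing (growth ?S (Suc i) j)" for j
  proof (induction j)
    case 0
    then show ?case by (simp add: growth_0 add_label_def decreasing_def empty_partition_def)
  next
    case (Suc j)
    have "growth ?S (Suc i) (Suc j) = local_rule (j = ?r) (growth ?S i j)
        (add_label (?d j) (growth ?S i j)) (add_label (col_label ?d ?r j) (growth ?S i j))"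
      using Suc by (simp add: S IH)
    then have "growth ?S (Suc i) (Suc j) = add_label (col_label ?d ?r (Suc j)) (growth ?S i (Suc j))"
      using local_rule_labels(1)[OF one[of j]] by (simp add: IH)
    moreover have "decreasing \<dots>"
      using local_rule_decreasing[of "growth ?S i j" "?d j" "col_label ?d ?r j" "j = ?r"] Suc IH one[of j]
      by (metis col_label.simps(2))
    ultimately show ?case by simp
  qed
  have "growth ?S (Suc i) (Suc j) = add_label (right_labels (\<lambda>_. None) (take (Suc i) p) j) (growth ?S (Suc i) j)" for j
    using local_rule_labels(2)[OF one[of j]] H[of j] by (simp add: S IH tk col_out_def)
  moreover have "growth ?S (Suc i) j = add_label (col_label (right_labels (\<lambda>_. None) (take k p)) (p ! k) j) (growth ?S k j)"
    if "Suc i = Suc k" for j k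
    using H[of j] that by blast
  ultimately show ?case using H by blast
qed

lemma addable_of_decreasing: "decreasing (inc g \<kappa>) \<Longrightarrow> addable \<kappa> g"
  unfolding decreasing_def addable_def
  by (cases g) (auto simp: inc_def dest: spec[of _ "g - 1"] split: if_splits)

text \<open>Every step along the top border adds a cell and ends in a partition again; this is the
  lattice condition.\<close>

lemma growth_top:
  assumes "distinct p" "\<forall>r\<in>set p. r < N" "i \<le> length p"
  shows "growth (perm_cells p) i N = incs empty_partition (take i (top_labels N (\<lambda>_. None) p)) \<and>
    lattice (take i (top_labels N (\<lambda>_. None) p))"
  using assms(3)
proof (induction i)
  case (Suc i)
  let ?d = "right_labels (\<lambda>_. None) (take i p)" and ?r = "p ! i" and ?t = "top_labels N (\<lambda>_. None) p"
  have "?r < N" using Suc.prems assms(2) by simp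
  then obtain a where a: "col_label ?d ?r N = Some a" using col_label_Some by blast
  have "p = take i p @ ?r # drop (Suc i) p" using Suc.prems by (simp add: id_take_nth_drop[symmetric])
  then have "?t = top_labels N (\<lambda>_. None) (take i p @ ?r # drop (Suc i) p)" by simp
  then have "?t ! i = a" using Suc.prems a by (simp add: nth_append)
  then have tk: "take (Suc i) ?t = take i ?t @ [a]" using Suc.prems by (simp add: take_Suc_conv_app_nth)
  have gr: "growth (perm_cells p) (Suc i) N = inc a (growth (perm_cells p) i N)"
    using growth_labels[OF assms(1) Suc.prems] a by (simp add: add_label_def)
  have "decreasing (inc a (growth (perm_cells p) i N))"
    using growth_labels[OF assms(1) Suc.prems] unfolding gr[symmetric] by blast
  then show ?case using Suc gr by (simp add: tk addable_of_decreasing)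
qed simp

lemma lattice_top_labels:
  assumes "distinct p" "\<forall>r\<in>set p. r < N"
  shows "lattice (top_labels N (\<lambda>_. None) p)"
  using growth_top[OF assms order.refl] by simp

lemma growth_right:
  assumes "distinct p"
  shows "growth (perm_cells p) (length p) (Suc j) =
    add_label (right_labels (\<lambda>_. None) p j) (growth (perm_cells p) (length p) j)"
  using growth_labels[OF assms order.refl] by simp

section \<open>Words with repeated letters\<close>

text \<open>The flag \<open>ne\<close> stands for north-east: equal letters then count as increasing
  from left to right, and otherwise as increasing from right to left.\<close>

definition before :: "bool \<Rightarrow> nat list \<Rightarrow> nat \<Rightarrow> nat \<Rightarrow> bool" where
  "before ne w s t \<longleftrightarrow> w ! s < w ! t \<or> w ! s = w ! t \<and> (if ne then s < t else t < s)"

definition std :: "bool \<Rightarrow> nat list \<Rightarrow> nat list" where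
  "std ne w = map (\<lambda>t. card {s. s < length w \<and> before ne w s t}) [0..<length w]"

definition descent :: "bool \<Rightarrow> nat \<Rightarrow> nat \<Rightarrow> bool" where
  "descent ne a b \<longleftrightarrow> (if ne then b < a else b \<le> a)"

definition Q_labels :: "bool \<Rightarrow> nat list \<Rightarrow> nat list" where
  "Q_labels ne w = top_labels (length w) (\<lambda>_. None) (std ne w)"

definition P_labels :: "bool \<Rightarrow> nat list \<Rightarrow> nat \<Rightarrow> nat option" where
  "P_labels ne w = right_labels (\<lambda>_. None) (std ne w)"

lemma ordering_descent [simp]: "ordering (descent ne)"
  by (auto simp: ordering_def descent_def)

lemma length_std [simp]: "length (std ne w) = length w"
  by (simp add: std_def)

lemma std_nth: "t < length w \<Longrightarrow> std ne w ! t = card {s. s < length w \<and> before ne w s t}"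
  by (simp add: std_def)

lemma length_Q_labels [simp]: "length (Q_labels ne w) = length w"
  by (simp add: Q_labels_def)

lemma std_less:
  assumes "s < length w" "t < length w"
  shows "std ne w ! s < std ne w ! t \<longleftrightarrow> before ne w s t"
proof -
  have mono: "std ne w ! s < std ne w ! t" if "before ne w s t" "s < length w" "t < length w" for s t
  proof -
    have "{u. u < length w \<and> before ne w u s} \<subset> {u. u < length w \<and> before ne w u t}"
    proof
      show "{u. u < length w \<and> before ne w u s} \<subseteq> {u. u < length w \<and> before ne w u t}"
        using that(1) by (auto simp: before_def split: if_splits)
      have "\<not> before ne w s s" by (simp add: before_def)
      then show "{u. u < length w \<and> before ne w u s} \<noteq> {u. u < length w \<and> before ne w u t}"
        using that by blast
    qed
    then show ?thesis using that by (simp add: std_def psubset_card_mono)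
  qed
  have "before ne w s t \<or> before ne w t s \<or> s = t" by (auto simp: before_def)
  then show ?thesis using mono[of s t] mono[of t s] assms by auto
qed

lemma distinct_std: "distinct (std ne w)"
proof (unfold distinct_conv_nth, intro allI impI)
  fix s t assume "s < length (std ne w)" "t < length (std ne w)" "s \<noteq> t"
  moreover from this have "before ne w s t \<or> before ne w t s" by (auto simp: before_def)
  ultimately show "std ne w ! s \<noteq> std ne w ! t"
    using std_less[of s w t ne] std_less[of t w s ne] by auto
qed

lemma std_bound: "r \<in> set (std ne w) \<Longrightarrow> r < length w"
proof -
  assume "r \<in> set (std ne w)"
  then obtain t where t: "t < length w" "r = card {s. s < length w \<and> before ne w s t}"
    by (auto simp: std_def)
  have "{s. s < length w \<and> before ne w s t} \<subset> {..<length w}"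
    using t(1) by (auto simp: before_def)
  then have "card {s. s < length w \<and> before ne w s t} < card {..<length w}"
    by (intro psubset_card_mono) simp_all
  then show ?thesis by (simp add: t(2))
qed

lemma set_std: "set (std ne w) = {..<length w}"
proof (rule card_subset_eq)
  show "card (set (std ne w)) = card {..<length w}" by (simp add: distinct_card[OF distinct_std])
qed (auto dest: std_bound)

lemma std_descent:
  assumes "s < t" "t < length w"
  shows "std ne w ! t < std ne w ! s \<longleftrightarrow> descent ne (w ! s) (w ! t)"
  using std_less[of t w s ne] assms by (auto simp: before_def descent_def)

text \<open>Exchanging two unequal neighbours does not change the order of any two equal letters, so
  every letter takes its rank along.\<close>

lemma std_swap:
  assumes "a \<noteq> b" "std ne (U @ a # b # V) = U' @ x # y # V'" "length U' = length U"
  shows "std ne (U @ b # a # V) = U' @ y # x # V'"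
proof -
  let ?w = "U @ a # b # V" and ?v = "U @ b # a # V" and ?i = "length U"
  define f where "f t = (if t = ?i then Suc ?i else if t = Suc ?i then ?i else t)" for t
  have ff: "f (f t) = t" and fl: "f t < length ?w \<longleftrightarrow> t < length ?w" for t by (auto simp: f_def)
  have nf: "?v ! f t = ?w ! t" for t
    by (auto simp: f_def nth_append nth_Cons' Suc_diff_le)
  have bf: "before ne ?v (f s) (f t) \<longleftrightarrow> before ne ?w s t" for s t
  proof (cases "?w ! s = ?w ! t")
    case True
    then have "\<not> (s = ?i \<and> t = Suc ?i)" "\<not> (s = Suc ?i \<and> t = ?i)"
      using assms(1) by (auto simp: nth_append)
    then have "f s < f t \<longleftrightarrow> s < t" "f t < f s \<longleftrightarrow> t < s" by (auto simp: f_def)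
    then show ?thesis unfolding before_def nf by simp
  qed (simp add: before_def nf)
  have cf: "std ne ?v ! f t = std ne ?w ! t" if "t < length ?w" for t
  proof -
    have "{s. s < length ?v \<and> before ne ?v s (f t)} = f ` {s. s < length ?w \<and> before ne ?w s t}"
    proof (intro equalityI subsetI)
      fix s assume "s \<in> {s. s < length ?v \<and> before ne ?v s (f t)}"
      then show "s \<in> f ` {s. s < length ?w \<and> before ne ?w s t}"
        using ff[of s] fl[of s] bf[of "f s" t] by (intro image_eqI[of _ _ "f s"]) auto
    next
      fix s assume "s \<in> f ` {s. s < length ?w \<and> before ne ?w s t}"
      then show "s \<in> {s. s < length ?v \<and> before ne ?v s (f t)}"
        using fl bf by fastforce
    qed
    then have "card {s. s < length ?v \<and> before ne ?v s (f t)} = card {s. s < length ?w \<and> before ne ?w s t}"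
      using card_image[of f "{s. s < length ?w \<and> before ne ?w s t}"] by (metis ff inj_onI)
    moreover have "f t < length ?v" using that fl[of t] by simp
    ultimately show ?thesis using that std_nth[of "f t" ?v ne] std_nth[of t ?w ne] by metis
  qed
  have len: "length (U' @ x # y # V') = length ?w"
    using assms(2) by (metis length_std)
  show ?thesis
  proof (rule nth_equalityI)
    fix t assume "t < length (std ne ?v)"
    then have t: "f t < length ?w" using fl[of t] by simp
    have "std ne ?v ! t = (U' @ x # y # V') ! f t"
      using cf[OF t] by (simp add: ff assms(2))
    also have "\<dots> = (U' @ y # x # V') ! t"
      using assms(3) by (auto simp: f_def nth_append nth_Cons' Suc_diff_le)
    finally show "std ne ?v ! t = (U' @ y # x # V') ! t" .
  qed (use len in simp)
qed

text \<open>The descents of a word are those of its standardisation, so both moves act at the same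
  places; and a move never exchanges equal letters.\<close>

lemma std_mv: "std ne (mv (descent ne) i w) = mv (\<lambda>a b. b < a) i (std ne w)"
proof (cases "i + 2 < length w")
  case True
  then obtain U a b c V where w: "w = U @ a # b # c # V" and U: "length U = i" by (rule split3)
  obtain U' x y z V' where s: "std ne w = U' @ x # y # z # V'" and U': "length U' = i"
    using True by (metis split3 length_std)
  have D: "descent ne a b \<longleftrightarrow> y < x" "descent ne b c \<longleftrightarrow> z < y" "descent ne a c \<longleftrightarrow> z < x"
    using std_descent[of i "Suc i" w ne] std_descent[of "Suc i" "Suc (Suc i)" w ne]
      std_descent[of i "Suc (Suc i)" w ne] True U U' unfolding s unfolding w by (simp_all add: nth_append)
  consider "descent ne a b = descent ne b c"
    | "descent ne a b \<noteq> descent ne b c" "descent ne a b = descent ne a c"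
    | "descent ne a b \<noteq> descent ne b c" "descent ne a b \<noteq> descent ne a c" by blast
  then show ?thesis
  proof cases
    case 1
    then have "mv3 (descent ne) a b c = [a, b, c]" "mv3 (\<lambda>a b. b < a) x y z = [x, y, z]"
      by (auto simp: mv3_def D)
    then show ?thesis using s mv_append[of "descent ne" U a b c V] mv_append[of "\<lambda>a b. b < a" U' x y z V']
      by (simp add: w U U')
  next
    case 2
    then have m: "mv3 (descent ne) a b c = [b, a, c]" "mv3 (\<lambda>a b. b < a) x y z = [y, x, z]"
      by (auto simp: mv3_def D)
    have "a \<noteq> b" using 2 by auto
    then show ?thesis
      using s m mv_append[of "descent ne" U a b c V] mv_append[of "\<lambda>a b. b < a" U' x y z V']
        std_swap[of a b ne U "c # V" U' x y "z # V'"] by (simp add: w U U')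
  next
    case 3
    then have m: "mv3 (descent ne) a b c = [a, c, b]" "mv3 (\<lambda>a b. b < a) x y z = [x, z, y]"
      by (auto simp: mv3_def D)
    have "b \<noteq> c" using 3 by auto
    then show ?thesis
      using s m mv_append[of "descent ne" U a b c V] mv_append[of "\<lambda>a b. b < a" U' x y z V']
        std_swap[of b c ne "U @ [a]" V "U' @ [x]" y z V'] by (simp add: w U U')
  qed
qed (simp add: mv_def)

lemma Q_labels_mv: "Q_labels ne (mv (descent ne) i w) = mv (<) i (Q_labels ne w)"
  and P_labels_mv: "P_labels ne (mv (descent ne) i w) = P_labels ne w"
  using labels_mv[of "std ne w" "length w" i]
  by (simp_all add: Q_labels_def P_labels_def std_mv distinct_std std_bound)

lemma Q_labels_mvs: "Q_labels ne (mvs (descent ne) \<sigma> w) = mvs (<) \<sigma> (Q_labels ne w)"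
  and P_labels_mvs: "P_labels ne (mvs (descent ne) \<sigma> w) = P_labels ne w"
  by (induction \<sigma> arbitrary: w) (simp_all add: Q_labels_mv P_labels_mv)

lemma lattice_Q_labels: "lattice (Q_labels ne w)"
  by (simp add: Q_labels_def lattice_top_labels distinct_std std_bound)

lemma Q_labels_descent:
  assumes "Suc i < length w"
  shows "Q_labels ne w ! i < Q_labels ne w ! Suc i \<longleftrightarrow> descent ne (w ! i) (w ! Suc i)"
  using labels_descent[of "std ne w" "length w" i] std_descent[of i "Suc i" w ne] assms
  by (simp add: Q_labels_def distinct_std std_bound)

section \<open>Recovering a word from its content and its labels\<close>

lemma std_bounds:
  assumes "t < length w"
  shows "size (filter_mset (\<lambda>y. y < w ! t) (mset w)) \<le> std ne w ! t"
    and "std ne w ! t < size (filter_mset (\<lambda>y. y \<le> w ! t) (mset w))"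
proof -
  have s: "size (filter_mset P (mset w)) = card {s. s < length w \<and> P (w ! s)}" for P
    by (metis length_filter_conv_card mset_filter size_mset)
  have "{s. s < length w \<and> w ! s < w ! t} \<subseteq> {s. s < length w \<and> before ne w s t}"
    by (auto simp: before_def)
  then show "size (filter_mset (\<lambda>y. y < w ! t) (mset w)) \<le> std ne w ! t"
    using assms by (simp add: s std_def card_mono)
  have "{s. s < length w \<and> before ne w s t} \<subset> {s. s < length w \<and> w ! s \<le> w ! t}"
    using assms by (auto simp: before_def)
  then show "std ne w ! t < size (filter_mset (\<lambda>y. y \<le> w ! t) (mset w))"
    using assms by (simp add: s std_def psubset_card_mono)
qed

text \<open>The ranks of the copies of \<open>z\<close> fill exactly the interval between these two
  counts.\<close>

lemma std_letter:
  assumes "t < length w" "size (filter_mset (\<lambda>y. y < z) (mset w)) \<le> std ne w ! t"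
    "std ne w ! t < size (filter_mset (\<lambda>y. y \<le> z) (mset w))"
  shows "w ! t = z"
proof -
  have mono: "size (filter_mset (\<lambda>y. y \<le> a) (mset w)) \<le> size (filter_mset (\<lambda>y. y < b) (mset w))" if "a < b" for a b
    using that by (induction w) auto
  show ?thesis
    using mono[of "w ! t" z] mono[of z "w ! t"] std_bounds[OF assms(1), of ne] assms(2,3)
    by (metis leD le_trans linorder_neqE_nat order_less_le_trans)
qed

lemma std_inj:
  assumes "mset w = mset v" "std ne w = std ne v"
  shows "w = v"
proof (rule nth_equalityI)
  show len: "length w = length v" using assms(1) by (rule mset_eq_length)
  fix t assume "t < length w"
  then show "w ! t = v ! t"
    using std_bounds[of t v ne] len by (intro std_letter[of t w _ ne]) (simp_all add: assms)
qed

lemma labels_eqD: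
  assumes "mset w = mset v" "Q_labels ne w = Q_labels ne v"
    and "\<And>j. j < length w \<Longrightarrow> P_labels ne w j = P_labels ne v j"
  shows "w = v"
proof (rule std_inj)
  have len: "length w = length v" using assms(1) by (rule mset_eq_length)
  show "std ne w = std ne v"
    by (rule labels_inj[of _ _ "length w"])
      (use assms len in \<open>auto simp: distinct_std set_std Q_labels_def P_labels_def\<close>)
qed (rule assms)

lemma P_labels_Some: "j < length w \<Longrightarrow> \<exists>a. P_labels ne w j = Some a"
  using right_labels_None_iff[of "\<lambda>_. None" "std ne w" j]
  by (auto simp: P_labels_def set_std simp flip: not_None_eq)

text \<open>Neighbouring ranks inside the block of one letter belong to two copies of it, whose
  order is given by the convention for ties. This makes the steps of P horizontal or vertical
  strips.\<close>

lemma P_labels_row: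
  assumes "size (filter_mset (\<lambda>y. y < z) (mset w)) \<le> j" "Suc j < size (filter_mset (\<lambda>y. y \<le> z) (mset w))"
    and "P_labels ne w j = Some a" "P_labels ne w (Suc j) = Some b"
  shows "a < b \<longleftrightarrow> \<not> ne"
proof -
  have "Suc j < length w"
    using assms(2) size_filter_mset_lesseq[of "\<lambda>y. y \<le> z" "mset w"] by simp
  then have "j \<in> set (std ne w)" "Suc j \<in> set (std ne w)" by (simp_all add: set_std)
  then obtain s t where s: "s < length w" "std ne w ! s = j" and t: "t < length w" "std ne w ! t = Suc j"
    by (metis in_set_conv_nth length_std)
  have "w ! s = z" "w ! t = z"
    using std_letter[of s w z ne] std_letter[of t w z ne] s t assms(1,2) by simp_all
  then have st: "if ne then s < t else t < s"
    using std_less[of s w t ne] s t by (simp add: before_def)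
  \<comment> \<open>The shortest prefix that reaches the earlier of the two positions; it does not
    reach the later one.\<close>
  define k where "k = min (Suc s) (Suc t)"
  have k: "s < k \<longleftrightarrow> ne" "t < k \<longleftrightarrow> \<not> ne"
    using st by (auto simp: k_def split: if_splits)
  have tk: "std ne w ! u \<in> set (take k (std ne w)) \<longleftrightarrow> u < k" if "u < length w" for u
    using that distinct_std[of ne w] by (auto simp: in_set_conv_nth nth_eq_iff_index_eq)
  have mem: "j \<in> set (take k (std ne w)) \<longleftrightarrow> ne" "Suc j \<in> set (take k (std ne w)) \<longleftrightarrow> \<not> ne"
    using tk[OF s(1)] tk[OF t(1)] k s t by simp_all
  show ?thesis
    using descent_rows[OF distinct_std, of j ne w a b "take k (std ne w)" "drop k (std ne w)"]
      \<open>j \<in> _\<close> \<open>Suc j \<in> _\<close> assms(3,4) mem by (simp add: P_labels_def)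
qed

lemma growth_Q_labels:
  assumes "i \<le> length w"
  shows "growth (perm_cells (std ne w)) i (length w) = incs empty_partition (take i (Q_labels ne w))"
  using growth_top[of "std ne w" "length w" i] assms by (simp add: Q_labels_def distinct_std std_bound)

lemma growth_P_labels:
  "growth (perm_cells (std ne w)) (length w) (Suc j) =
    add_label (P_labels ne w j) (growth (perm_cells (std ne w)) (length w) j)"
  using growth_right[OF distinct_std, of ne w j] by (simp add: P_labels_def)

section \<open>Jeu de taquin on lattice words\<close>

text \<open>Says that the skew shape between \<mu> and \<kappa>, that is, the set of red cells, is a
  horizontal strip.\<close>

definition interlacing :: "partition \<Rightarrow> partition \<Rightarrow> bool" where
  "interlacing \<kappa> \<mu> \<longleftrightarrow> (\<forall>i. \<mu> i \<le> \<kappa> i \<and> \<kappa> (Suc i) \<le> \<mu> i)"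

text \<open>The letter with which a green cell in row g of \<open>\<kappa>\<close> ends up when it has passed the red
  horizontal strip \<open>\<kappa> - \<mu>\<close>: it drops by one row if the cell below it is red.\<close>

definition slide_letter :: "partition \<Rightarrow> partition \<Rightarrow> nat \<Rightarrow> nat" where
  "slide_letter \<kappa> \<mu> g = (if g = 0 \<or> \<kappa> g < \<mu> (g - 1) then g else g - 1)"

primrec slide :: "partition \<Rightarrow> partition \<Rightarrow> nat list \<Rightarrow> nat list" where
  "slide \<kappa> \<mu> [] = []"
| "slide \<kappa> \<mu> (g # \<alpha>) = slide_letter \<kappa> \<mu> g # slide (inc g \<kappa>) (inc (slide_letter \<kappa> \<mu> g) \<mu>) \<alpha>"

lemma slide_append [simp]:
  "slide \<kappa> \<mu> (\<alpha> @ \<beta>) = slide \<kappa> \<mu> \<alpha> @ slide (incs \<kappa> \<alpha>) (incs \<mu> (slide \<kappa> \<mu> \<alpha>)) \<beta>"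
  by (induction \<alpha> arbitrary: \<kappa> \<mu>) simp_all

lemma length_slide [simp]: "length (slide \<kappa> \<mu> \<alpha>) = length \<alpha>"
  by (induction \<alpha> arbitrary: \<kappa> \<mu>) simp_all

lemma take_slide: "take n (slide \<kappa> \<mu> \<alpha>) = slide \<kappa> \<mu> (take n \<alpha>)"
  by (induction \<alpha> arbitrary: n \<kappa> \<mu>) (simp_all add: take_Cons split: nat.split)

text \<open>Either no red cell lies below the new green cell, which then only passes the red cells
  of its own row, or the two change places. In both cases the red cells remain a horizontal
  strip.\<close>

lemma interlacing_inc:
  assumes "interlacing \<kappa> \<mu>" "addable \<kappa> g"
  shows "interlacing (inc g \<kappa>) (inc (slide_letter \<kappa> \<mu> g) \<mu>)" "addable \<mu> (slide_letter \<kappa> \<mu> g)"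
proof -
  have il: "\<mu> i \<le> \<kappa> i" "\<kappa> (Suc i) \<le> \<mu> i" for i
    using assms(1) by (auto simp: interlacing_def)
  have "interlacing (inc g \<kappa>) (inc (slide_letter \<kappa> \<mu> g) \<mu>) \<and> addable \<mu> (slide_letter \<kappa> \<mu> g)"
  proof (cases "g = 0 \<or> \<kappa> g < \<mu> (g - 1)")
    case True
    then have s: "slide_letter \<kappa> \<mu> g = g" by (simp add: slide_letter_def)
    have "interlacing (inc g \<kappa>) (inc g \<mu>)"
      unfolding interlacing_def inc_def
    proof
      fix i show "(\<mu>(g := Suc (\<mu> g))) i \<le> (\<kappa>(g := Suc (\<kappa> g))) i \<and>
          (\<kappa>(g := Suc (\<kappa> g))) (Suc i) \<le> (\<mu>(g := Suc (\<mu> g))) i"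
        using il[of i] True by (auto simp: le_Suc_eq)
    qed
    moreover have "addable \<mu> g" using True il(1)[of g] by (auto simp: addable_def)
    ultimately show ?thesis by (simp add: s)
  next
    case False
    then obtain h where g: "g = Suc h" by (cases g) auto
    have s: "slide_letter \<kappa> \<mu> g = h" using False by (simp add: slide_letter_def g)
    have e: "\<kappa> (Suc h) = \<mu> h" "\<mu> h < \<kappa> h"
      using False il(2)[of h] assms(2) by (auto simp: g addable_def)
    have "interlacing (inc g \<kappa>) (inc h \<mu>)"
      unfolding interlacing_def inc_def
    proof
      fix i show "(\<mu>(h := Suc (\<mu> h))) i \<le> (\<kappa>(g := Suc (\<kappa> g))) i \<and>
          (\<kappa>(g := Suc (\<kappa> g))) (Suc i) \<le> (\<mu>(h := Suc (\<mu> h))) i"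
        using il[of i] e by (auto simp: g)
    qed
    moreover have "addable \<mu> h" using e il(2)[of "h - 1"] by (cases h) (auto simp: addable_def)
    ultimately show ?thesis by (simp add: s)
  qed
  then show "interlacing (inc g \<kappa>) (inc (slide_letter \<kappa> \<mu> g) \<mu>)" "addable \<mu> (slide_letter \<kappa> \<mu> g)"
    by blast+
qed

lemma interlacing_slide:
  assumes "interlacing \<kappa> \<mu>" "lattice_from \<kappa> \<alpha>"
  shows "interlacing (incs \<kappa> \<alpha>) (incs \<mu> (slide \<kappa> \<mu> \<alpha>)) \<and> lattice_from \<mu> (slide \<kappa> \<mu> \<alpha>)"
  using assms by (induction \<alpha> arbitrary: \<kappa> \<mu>) (simp_all add: interlacing_inc)

text \<open>A letter drops by at most one, so only two cases are critical: if \<open>b = a\<close>,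
  then \<open>b\<close> drops whenever \<open>a\<close> does, and if \<open>b = a + 1\<close>, then
  \<open>b\<close> stays whenever \<open>a\<close> does.\<close>

lemma slide_descent:
  assumes "interlacing \<kappa> \<mu>" "addable \<kappa> a" "addable (inc a \<kappa>) b"
  shows "slide_letter \<kappa> \<mu> a < slide_letter (inc a \<kappa>) (inc (slide_letter \<kappa> \<mu> a) \<mu>) b \<longleftrightarrow> a < b"
proof -
  have il: "\<mu> i \<le> \<kappa> i" "\<kappa> (Suc i) \<le> \<mu> i" for i
    using assms(1) by (auto simp: interlacing_def)
  show ?thesis
  proof (cases "a < b")
    case True
    then show ?thesis
      using il(2)[of a] by (cases "b = Suc a") (auto simp: slide_letter_def inc_def)
  next
    case False
    then show ?thesis
      by (cases "a = b") (auto simp: slide_letter_def inc_def)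
  qed
qed

lemma slide_descents:
  assumes "interlacing \<kappa> \<mu>" "lattice_from \<kappa> \<alpha>" "Suc i < length \<alpha>"
  shows "slide \<kappa> \<mu> \<alpha> ! i < slide \<kappa> \<mu> \<alpha> ! Suc i \<longleftrightarrow> \<alpha> ! i < \<alpha> ! Suc i"
  using assms
proof (induction \<alpha> arbitrary: \<kappa> \<mu> i)
  case (Cons a \<alpha>)
  show ?case
  proof (cases i)
    case 0
    then obtain b \<beta> where "\<alpha> = b # \<beta>" using Cons.prems(3) by (cases \<alpha>) auto
    then show ?thesis using slide_descent[of \<kappa> \<mu> a b] Cons.prems 0 by simp
  next
    case (Suc j)
    then show ?thesis using Cons interlacing_inc by simp
  qed
qed simp

lemma mv_eq_0: "mv D 0 [a, b, c] = mv3 D a b c"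
  by (simp add: mv_def)

text \<open>In general \<open>a\<close> and \<open>b\<close> slide independently of each other and
  the claim follows from the preservation of descents. One configuration, in which \<open>a\<close>
  keeps \<open>b\<close> from dropping, needs a computation.\<close>

lemma slide_mv_first:
  assumes "interlacing \<kappa> \<mu>" "lattice_from \<kappa> [a, b, c]" "lattice_from \<kappa> [b, a, c]" "a < c" "c \<le> b"
  shows "slide \<kappa> \<mu> [b, a, c] = mv3 (<) (slide \<kappa> \<mu> [a, b, c] ! 0) (slide \<kappa> \<mu> [a, b, c] ! 1) (slide \<kappa> \<mu> [a, b, c] ! 2)"
proof -
  have il: "\<mu> i \<le> \<kappa> i" "\<kappa> (Suc i) \<le> \<mu> i" for i
    using assms(1) by (auto simp: interlacing_def)
  have ab: "a < b" using assms by simp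
  let ?a = "slide_letter \<kappa> \<mu> a" and ?b = "slide_letter \<kappa> \<mu> b"
  let ?b' = "slide_letter (inc a \<kappa>) (inc ?a \<mu>) b"
  have a: "slide_letter (inc b \<kappa>) (inc ?b \<mu>) a = ?a"
    using ab by (auto simp: slide_letter_def inc_def)
  have comm: "inc x (inc y \<nu>) = inc y (inc x \<nu>)" for x y \<nu> by (auto simp: inc_def fun_eq_iff)
  note d1 = slide_descents[OF assms(1,2)] and d2 = slide_descents[OF assms(1,3)]
  show ?thesis
  proof (cases "?b' = ?b")
    case True
    let ?c = "slide_letter (inc b (inc a \<kappa>)) (inc ?b (inc ?a \<mu>)) c"
    have "?a < ?b" "\<not> ?b < ?c" "?a < ?c"
      using d1[of 0] d1[of 1] d2[of 1] ab assms(4,5) True by (simp_all add: a comm[of a b] comm[of ?a ?b])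
    then have "mv3 (<) ?a ?b ?c = [?b, ?a, ?c]" by (simp add: mv3_def)
    then show ?thesis using True by (simp add: a comm[of a b] comm[of ?a ?b] numeral_2_eq_2)
  next
    case False
    \<comment> \<open>Here the slid words are \<open>a, b, a\<close> and \<open>a, a, b\<close>: an
      exchange of the first two letters becomes an exchange of the last two, which is still the move
      that \<open>mv3\<close> prescribes.\<close>
    then have *: "b = Suc a" "\<kappa> b = \<mu> a" "?a = a" "?b' = b" "?b = a"
      using ab il(2)[of "b - 1"] il(2)[of a]
      by (auto simp: slide_letter_def inc_def split: if_splits)
    have c: "c = b" using * assms(4,5) by simp
    have "slide_letter (inc b (inc a \<kappa>)) (inc b (inc a \<mu>)) b = a"
      "slide_letter (inc a (inc b \<kappa>)) (inc a (inc a \<mu>)) b = b"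
      using *(1,2) by (simp_all add: slide_letter_def inc_def)
    then have s: "slide \<kappa> \<mu> [a, b, c] = [a, b, a]" "slide \<kappa> \<mu> [b, a, c] = [a, a, b]"
      using *(3-5) a by (simp_all add: c)
    show ?thesis using ab unfolding s by (simp add: mv3_def)
  qed
qed

text \<open>Once \<open>a\<close> has been added, \<open>b\<close> and \<open>c\<close> slide in the
  same way in either order, so both triples consist of the same slid letters and the descents
  decide.\<close>

lemma slide_mv_last:
  assumes "interlacing \<kappa> \<mu>" "lattice_from \<kappa> [a, b, c]" "lattice_from \<kappa> [a, c, b]" "a < b" "c \<le> a"
  shows "slide \<kappa> \<mu> [a, c, b] = mv3 (<) (slide \<kappa> \<mu> [a, b, c] ! 0) (slide \<kappa> \<mu> [a, b, c] ! 1) (slide \<kappa> \<mu> [a, b, c] ! 2)"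
proof -
  have il: "\<mu> i \<le> \<kappa> i" "\<kappa> (Suc i) \<le> \<mu> i" for i
    using assms(1) by (auto simp: interlacing_def)
  let ?a = "slide_letter \<kappa> \<mu> a"
  let ?\<kappa> = "inc a \<kappa>" and ?\<mu> = "inc ?a \<mu>"
  let ?b = "slide_letter ?\<kappa> ?\<mu> b" and ?c = "slide_letter ?\<kappa> ?\<mu> c"
  have comm: "inc x (inc y \<nu>) = inc y (inc x \<nu>)" for x y \<nu> by (auto simp: inc_def fun_eq_iff)
  note d1 = slide_descents[OF assms(1,2)] and d2 = slide_descents[OF assms(1,3)]
  have "b - 1 \<le> ?b" by (simp add: slide_letter_def)
  then have "inc b ?\<kappa> c = ?\<kappa> c" "c = 0 \<or> inc ?b ?\<mu> (c - 1) = ?\<mu> (c - 1)"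
    using assms(4,5) by (auto simp: inc_def[of b] inc_def[of ?b])
  then have c: "slide_letter (inc b ?\<kappa>) (inc ?b ?\<mu>) c = ?c"
    unfolding slide_letter_def[of _ _ c] by auto
  have ac: "?c \<le> ?a" using d2[of 0] assms(5) by simp
  \<comment> \<open>The letter \<open>c\<close> could influence \<open>b\<close> only by ending in
    the row below \<open>b\<close>, which forces \<open>b = a + 1\<close> and
    \<open>c = a\<close>.\<close>
  have b: "slide_letter (inc c ?\<kappa>) (inc ?c ?\<mu>) b = ?b"
  proof (cases "?c = b - 1")
    case True
    have "?c \<le> c" "?a \<le> a" by (auto simp: slide_letter_def)
    then have e: "c = a" "b = Suc a" "?a = a" "?c = a" using True ac assms(4,5) by linarith+
    show ?thesis using il(2)[of a] by (simp add: e) (simp add: slide_letter_def inc_def e)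
  next
    case False
    then have "inc c ?\<kappa> b = ?\<kappa> b" "inc ?c ?\<mu> (b - 1) = ?\<mu> (b - 1)"
      using assms(4,5) by (auto simp: inc_def[of c] inc_def[of ?c])
    then show ?thesis unfolding slide_letter_def[of _ _ b] by simp
  qed
  have "?a < ?b" "\<not> ?b < ?c" "\<not> ?a < ?c"
    using d1[of 0] d1[of 1] ac assms(4,5) by (simp_all add: c)
  then have "mv3 (<) ?a ?b ?c = [?a, ?c, ?b]" using assms(4,5) by (auto simp: mv3_def)
  then show ?thesis by (simp add: b c numeral_2_eq_2)
qed

text \<open>A map on words that commutes with the two kinds of moves from \<open>a < b\<close> commutes with all moves,
  as moves are involutions.\<close>

lemma commutes_with_mv3:
  fixes f :: "nat list \<Rightarrow> nat list"
  assumes len: "\<And>\<alpha>. length (f \<alpha>) = length \<alpha>"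
    and same: "\<And>a b c. lat [a, b, c] \<Longrightarrow> (a < b) = (b < c) \<Longrightarrow> (f [a, b, c] ! 0 < f [a, b, c] ! 1) = (f [a, b, c] ! 1 < f [a, b, c] ! 2)"
    and first: "\<And>a b c. lat [a, b, c] \<Longrightarrow> lat [b, a, c] \<Longrightarrow> a < c \<Longrightarrow> c \<le> b \<Longrightarrow> f [b, a, c] = mv3 (<) (f [a, b, c] ! 0) (f [a, b, c] ! 1) (f [a, b, c] ! 2)"
    and last: "\<And>a b c. lat [a, b, c] \<Longrightarrow> lat [a, c, b] \<Longrightarrow> a < b \<Longrightarrow> c \<le> a \<Longrightarrow> f [a, c, b] = mv3 (<) (f [a, b, c] ! 0) (f [a, b, c] ! 1) (f [a, b, c] ! 2)"
    and lat: "lat [a, b, c]" "lat (mv3 (<) a b c)"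
  shows "f (mv3 (<) a b c) = mv (<) 0 (f [a, b, c])"
proof -
  have mv: "mv3 (<) (f [a, b, c] ! 0) (f [a, b, c] ! 1) (f [a, b, c] ! 2) = mv (<) 0 (f [a, b, c])" for a b c
    using len[of "[a, b, c]"] by (auto simp: length_Suc_conv mv_eq_0 numeral_3_eq_3)
  have inv: "y = mv (<) 0 x" if "x = mv (<) 0 y" for x y :: "nat list"
    using that mv_mv[OF ordering_less] by metis
  consider "(a < b) = (b < c)" | "a < b" "c \<le> b" "a < c" | "a < b" "c \<le> a"
    | "b \<le> a" "b < c" "a < c" | "b < c" "c \<le> a" by linarith
  then show ?thesis
  proof cases
    case 1
    then have m: "mv3 (<) a b c = [a, b, c]" by (simp add: mv3_def)
    have "mv (<) 0 (f [a, b, c]) = f [a, b, c]"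
      using len[of "[a, b, c]"] same[OF lat(1) 1] by (auto simp: length_Suc_conv mv_eq_0 mv3_def numeral_3_eq_3)
    then show ?thesis by (simp add: m)
  next
    case 2
    then have m: "mv3 (<) a b c = [b, a, c]" by (simp add: mv3_def)
    show ?thesis using first[of a b c] lat 2 unfolding m mv by blast
  next
    case 3
    then have m: "mv3 (<) a b c = [a, c, b]" by (auto simp: mv3_def)
    show ?thesis using last[of a b c] lat 3 unfolding m mv by blast
  next
    case 4
    then have m: "mv3 (<) a b c = [a, c, b]" by (auto simp: mv3_def)
    have "f [a, b, c] = mv (<) 0 (f [a, c, b])"
      using last[of a c b] lat 4 unfolding m mv by blast
    then show ?thesis unfolding m by (rule inv)
  next
    case 5
    then have m: "mv3 (<) a b c = [b, a, c]" by (auto simp: mv3_def)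
    have "f [a, b, c] = mv (<) 0 (f [b, a, c])"
      using first[of b a c] lat 5 unfolding m mv by blast
    then show ?thesis unfolding m by (rule inv)
  qed
qed

lemma slide_mv3:
  assumes "interlacing \<kappa> \<mu>" "lattice_from \<kappa> [a, b, c]" "lattice_from \<kappa> (mv3 (<) a b c)"
  shows "slide \<kappa> \<mu> (mv3 (<) a b c) = mv (<) 0 (slide \<kappa> \<mu> [a, b, c])"
proof (rule commutes_with_mv3[where lat = "lattice_from \<kappa>"])
  fix a b c assume "lattice_from \<kappa> [a, b, c]" "(a < b) = (b < c)"
  then show "(slide \<kappa> \<mu> [a, b, c] ! 0 < slide \<kappa> \<mu> [a, b, c] ! 1) = (slide \<kappa> \<mu> [a, b, c] ! 1 < slide \<kappa> \<mu> [a, b, c] ! 2)"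
    using slide_descents[OF assms(1), of "[a, b, c]" 0] slide_descents[OF assms(1), of "[a, b, c]" 1]
    by (simp add: numeral_2_eq_2)
qed (use assms slide_mv_first[OF assms(1)] slide_mv_last[OF assms(1)] in \<open>simp_all del: slide.simps lattice_from.simps\<close>)

text \<open>The letters after the three depend only on the shapes reached so far, and these are
  unchanged because a move preserves the content, both of the word and of its image.\<close>

lemma slide_mv:
  assumes "interlacing \<kappa> \<mu>" "lattice_from \<kappa> \<alpha>" "lattice_from \<kappa> (mv (<) i \<alpha>)"
  shows "slide \<kappa> \<mu> (mv (<) i \<alpha>) = mv (<) i (slide \<kappa> \<mu> \<alpha>)"
proof (cases "i + 2 < length \<alpha>")
  case True
  then obtain U a b c V where w: "\<alpha> = U @ [a, b, c] @ V" and i: "length U = i"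
    by (metis append_Cons append_Nil split3)
  let ?\<kappa> = "incs \<kappa> U" and ?\<mu> = "incs \<mu> (slide \<kappa> \<mu> U)"
  have m: "mv (<) i \<alpha> = U @ mv3 (<) a b c @ V"
    using mv_append[of "(<)" U a b c V] i by (simp add: w)
  have s3: "slide ?\<kappa> ?\<mu> (mv3 (<) a b c) = mv (<) 0 (slide ?\<kappa> ?\<mu> [a, b, c])"
    using assms interlacing_slide[of \<kappa> \<mu> U] by (intro slide_mv3) (simp_all add: m, simp_all add: w)
  have c1: "incs ?\<kappa> (mv3 (<) a b c) = incs ?\<kappa> [a, b, c]" by (rule incs_mset_cong) simp
  have c2: "incs ?\<mu> (mv (<) 0 (slide ?\<kappa> ?\<mu> [a, b, c])) = incs ?\<mu> (slide ?\<kappa> ?\<mu> [a, b, c])"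
    by (rule incs_mset_cong) simp
  obtain a' b' c' where t: "slide ?\<kappa> ?\<mu> [a, b, c] = [a', b', c']" by simp
  show ?thesis
    unfolding m unfolding w slide_append s3 c1 c2 unfolding t
    using mv_append[of "(<)" "slide \<kappa> \<mu> U" a' b' c'] i by (simp add: mv_eq_0)
qed (simp add: mv_def)

subsection \<open>The last block\<close>

text \<open>The cells of the horizontal strip between \<mu> and \<kappa> from left to right, hence
  from higher to lower rows, which avoids ascents.\<close>

definition strip :: "nat \<Rightarrow> partition \<Rightarrow> partition \<Rightarrow> nat list" where
  "strip N \<kappa> \<mu> = concat (map (\<lambda>i. replicate (\<kappa> i - \<mu> i) i) (rev [0..<N]))"

lemma mset_strip: "count (mset (strip N \<kappa> \<mu>)) i = (if i < N then \<kappa> i - \<mu> i else 0)"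
  unfolding strip_def by (induction N) (auto simp: less_Suc_eq)

lemma strip_sorted: "sorted (rev (strip N \<kappa> \<mu>))"
proof -
  have "sorted (rev (strip N \<kappa> \<mu>)) \<and> (\<forall>x\<in>set (strip N \<kappa> \<mu>). x < N)"
    unfolding strip_def by (induction N) (auto simp: sorted_append less_SucI)
  then show ?thesis ..
qed

lemma lattice_from_replicate:
  assumes "interlacing \<kappa> \<mu>" "n \<le> \<kappa> i - \<mu> i" "\<And>j. j < i \<Longrightarrow> \<nu> j = \<mu> j" "\<nu> i = \<mu> i"
  shows "lattice_from \<nu> (replicate n i)"
proof -
  have "lattice_from \<nu> (replicate n i) \<and> incs \<nu> (replicate n i) = \<nu>(i := \<nu> i + n)" using assms(2)
  proof (induction n)
    case (Suc n)
    have "\<kappa> i \<le> \<mu> (i - 1)" if "i > 0" using assms(1) that by (cases i) (auto simp: interlacing_def)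
    moreover have "\<mu> i + n < \<kappa> i" using Suc.prems by simp
    ultimately have "addable (\<nu>(i := \<nu> i + n)) i"
      using assms(3)[of "i - 1"] assms(4) by (cases "i = 0") (auto simp: addable_def)
    moreover have "lattice_from \<nu> (replicate n i)" and e: "incs \<nu> (replicate n i) = \<nu>(i := \<nu> i + n)"
      using Suc.IH[OF Suc_leD[OF Suc.prems]] by blast+
    moreover have "replicate (Suc n) i = replicate n i @ [i]" by (simp add: replicate_append_same)
    moreover have "inc i (\<nu>(i := \<nu> i + n)) = \<nu>(i := \<nu> i + Suc n)" by (simp add: inc_def fun_eq_iff)
    ultimately show ?case by (simp only: lattice_from_append incs_simps lattice_from.simps simp_thms)
  qed simp
  then show ?thesis ..
qed

lemma lattice_from_strip:
  assumes "interlacing \<kappa> \<mu>"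
  shows "lattice_from \<mu> (strip N \<kappa> \<mu>)"
proof -
  have "lattice_from \<nu> (strip N \<kappa> \<mu>)" if "\<And>j. j < N \<Longrightarrow> \<nu> j = \<mu> j" for \<nu>
    using that
  proof (induction N arbitrary: \<nu>)
    case (Suc N)
    have "lattice_from \<nu> (replicate (\<kappa> N - \<mu> N) N)"
      using Suc.prems by (intro lattice_from_replicate[OF assms]) auto
    moreover have "lattice_from (incs \<nu> (replicate (\<kappa> N - \<mu> N) N)) (strip N \<kappa> \<mu>)"
      using Suc.prems by (intro Suc.IH) (simp add: incs_count)
    ultimately show ?case by (simp add: strip_def)
  qed (simp add: strip_def)
  then show ?thesis by blast
qed

text \<open>Makes the length of a lattice word an admissible row bound for
  \<open>strip\<close>.\<close>

lemma lattice_letter_bound: "lattice \<alpha> \<Longrightarrow> x \<in> set \<alpha> \<Longrightarrow> x < length \<alpha>"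
proof (induction \<alpha> arbitrary: x rule: rev_induct)
  case (snoc a \<alpha>)
  have "a = 0 \<or> a - 1 \<in> set \<alpha>"
    using snoc.prems(1) by (auto simp: addable_def incs_count empty_partition_def) (metis count_inI not_less0 set_mset_mset)
  then have "a < Suc (length \<alpha>)" using snoc.IH[of "a - 1"] snoc.prems(1) by auto
  then show ?case using snoc by (auto simp: less_SucI)
qed simp

text \<open>The first \<open>k\<close> letters are the red cells. The others slide past them, and
  the vacated strip is filled by \<open>k\<close> new last letters. For \<open>k = 1\<close> this is
  the promotion of Schuetzenberger; the appended strip corresponds to the last partition that
  \<open>jdt_bar\<close> repeats.\<close>

definition theta :: "nat \<Rightarrow> nat list \<Rightarrow> nat list" where
  "theta k \<alpha> =
     (let \<beta> = slide (incs empty_partition (take k \<alpha>)) empty_partition (drop k \<alpha>)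
      in \<beta> @ strip (length \<alpha>) (incs empty_partition \<alpha>) (incs empty_partition \<beta>))"

definition theta_dom :: "nat \<Rightarrow> nat list \<Rightarrow> bool" where
  "theta_dom k \<alpha> \<longleftrightarrow> lattice \<alpha> \<and> k \<le> length \<alpha> \<and> (\<forall>i. Suc i < k \<longrightarrow> \<not> \<alpha> ! i < \<alpha> ! Suc i)"

text \<open>A lattice word begins with 0, and its first \<open>k\<close> letters contain no ascent.
  So the first \<open>k\<close> cells form a single row, which is a horizontal strip over the empty
  partition.\<close>

lemma theta_dom_zeros: "theta_dom k \<alpha> \<Longrightarrow> i < k \<Longrightarrow> \<alpha> ! i = 0"
proof (induction i)
  case 0
  then have "\<alpha> \<noteq> []" by (auto simp: theta_dom_def)
  then show ?case using 0 by (cases \<alpha>) (auto simp: theta_dom_def addable_def empty_partition_def)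
next
  case (Suc i)
  then show ?case by (auto simp: theta_dom_def)
qed

lemma theta_dom_interlacing:
  assumes "theta_dom k \<alpha>"
  shows "interlacing (incs empty_partition (take k \<alpha>)) empty_partition"
    "lattice_from (incs empty_partition (take k \<alpha>)) (drop k \<alpha>)"
proof -
  have "count (mset (take k \<alpha>)) (Suc i) = 0" for i
    using theta_dom_zeros[OF assms] by (auto simp: not_in_iff[symmetric] in_set_conv_nth)
  then show "interlacing (incs empty_partition (take k \<alpha>)) empty_partition"
    by (simp add: interlacing_def incs_count empty_partition_def)
  have "lattice (take k \<alpha> @ drop k \<alpha>)" using assms by (simp add: theta_dom_def)
  then show "lattice_from (incs empty_partition (take k \<alpha>)) (drop k \<alpha>)"
    unfolding lattice_from_append ..
qed

lemma theta_lattice: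
  assumes "theta_dom k \<alpha>"
  shows "lattice (theta k \<alpha>)" "mset (theta k \<alpha>) = mset \<alpha>" "length (theta k \<alpha>) = length \<alpha>"
proof -
  let ?\<kappa> = "incs empty_partition (take k \<alpha>)"
  let ?\<beta> = "slide ?\<kappa> empty_partition (drop k \<alpha>)"
  have "incs ?\<kappa> (drop k \<alpha>) = incs empty_partition (take k \<alpha> @ drop k \<alpha>)"
    by (simp only: incs_simps)
  then have il: "interlacing (incs empty_partition \<alpha>) (incs empty_partition ?\<beta>)" "lattice ?\<beta>"
    using interlacing_slide[OF theta_dom_interlacing[OF assms]] by simp_all
  then show "lattice (theta k \<alpha>)" by (simp add: theta_def Let_def lattice_from_strip)
  show m: "mset (theta k \<alpha>) = mset \<alpha>"
  proof (rule multiset_eqI)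
    fix i
    have le: "count (mset ?\<beta>) i \<le> count (mset \<alpha>) i"
      using il(1) unfolding interlacing_def incs_count empty_partition_def by simp
    show "count (mset (theta k \<alpha>)) i = count (mset \<alpha>) i"
    proof (cases "i < length \<alpha>")
      case True
      then show ?thesis using le
        by (simp add: theta_def Let_def mset_strip) (simp add: incs_count empty_partition_def)
    next
      case False
      then have "count (mset \<alpha>) i = 0"
        using lattice_letter_bound[of \<alpha> i] assms by (auto simp: theta_dom_def not_in_iff[symmetric])
      moreover from this have "count (mset ?\<beta>) i = 0" using le by linarith
      ultimately show ?thesis using False
        by (simp only: theta_def Let_def mset_append count_union mset_strip if_False add_0)
    qed
  qed
  show "length (theta k \<alpha>) = length \<alpha>" using m by (rule mset_eq_length)
qed

lemma theta_descent:
  assumes "theta_dom k \<alpha>" "Suc (k + i) < length \<alpha>"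
  shows "theta k \<alpha> ! i < theta k \<alpha> ! Suc i \<longleftrightarrow> \<alpha> ! (k + i) < \<alpha> ! Suc (k + i)"
proof -
  have "k + i < length \<alpha>" "Suc i < length \<alpha> - k" using assms(2) by linarith+
  then show ?thesis
    using slide_descents[OF theta_dom_interlacing[OF assms(1)], of i] assms(2)
    by (simp add: theta_def Let_def nth_append)
qed

lemma theta_last_block:
  assumes "theta_dom k \<alpha>" "length \<alpha> \<le> i + k" "Suc i < length \<alpha>"
  shows "\<not> theta k \<alpha> ! i < theta k \<alpha> ! Suc i"
proof -
  let ?s = "strip (length \<alpha>) (incs empty_partition \<alpha>)
    (incs empty_partition (slide (incs empty_partition (take k \<alpha>)) empty_partition (drop k \<alpha>)))"
  let ?j = "i - (length \<alpha> - k)"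
  have l: "length ?s = k" using theta_lattice(3)[OF assms(1)] assms by (simp add: theta_def Let_def theta_dom_def)
  have j: "Suc ?j < k" using assms by linarith
  have "rev ?s ! (k - 1 - Suc ?j) \<le> rev ?s ! (k - 1 - ?j)"
    using j l by (intro sorted_nth_mono[OF strip_sorted]) auto
  then have "?s ! Suc ?j \<le> ?s ! ?j" using j l by (simp add: rev_nth Suc_diff_Suc)
  moreover have "Suc i - (length \<alpha> - k) = Suc ?j" using assms by linarith
  ultimately show ?thesis using assms by (auto simp: theta_def Let_def nth_append)
qed

text \<open>The slide commutes with the move, while the contents of the whole word and of its slid
  part stay the same, and with them the appended strip.\<close>

lemma theta_mv:
  assumes "theta_dom k \<alpha>" "lattice (mv (<) (k + i) \<alpha>)" "k + i + 2 < length \<alpha>"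
  shows "theta_dom k (mv (<) (k + i) \<alpha>)" "theta k (mv (<) (k + i) \<alpha>) = mv (<) i (theta k \<alpha>)"
proof -
  let ?m = "mv (<) (k + i) \<alpha>"
  have k: "k \<le> length \<alpha>" using assms(1) by (simp add: theta_dom_def)
  have m: "?m = take k \<alpha> @ mv (<) i (drop k \<alpha>)"
    using mv_append_left[of "(<)" "take k \<alpha>" i "drop k \<alpha>"] k by (simp add: min_absorb2)
  have nth: "?m ! j = \<alpha> ! j" if "j < k" for j
    using that k unfolding m by (simp add: nth_append)
  then show dom: "theta_dom k ?m" using assms by (auto simp: theta_dom_def)
  let ?\<kappa> = "incs empty_partition (take k \<alpha>)"
  have tk: "take k ?m = take k \<alpha>" "drop k ?m = mv (<) i (drop k \<alpha>)" using k by (simp_all add: m min_absorb2)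
  have s: "slide ?\<kappa> empty_partition (mv (<) i (drop k \<alpha>)) = mv (<) i (slide ?\<kappa> empty_partition (drop k \<alpha>))"
    using theta_dom_interlacing[OF dom] theta_dom_interlacing[OF assms(1)] by (intro slide_mv) (simp_all add: tk)
  have c: "incs empty_partition (mv (<) i \<beta>) = incs empty_partition \<beta>" for i \<beta>
    by (rule incs_mset_cong) simp
  let ?\<beta> = "slide ?\<kappa> empty_partition (drop k \<alpha>)"
  have "mv (<) i (?\<beta> @ v) = mv (<) i ?\<beta> @ v" for v
    using mvs_append_right[of "[i]" ?\<beta> "(<)" v] assms(3) by simp
  then show "theta k ?m = mv (<) i (theta k \<alpha>)"
    unfolding theta_def Let_def tk s c by simp
qed

subsection \<open>Comparison with the definition by colours\<close>

text \<open>The letters decrease weakly, so row \<open>b\<close> still has its original length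
  whenever row \<open>b + 1\<close> grows.\<close>

lemma horizontal_strip:
  assumes "lattice_from \<kappa> \<gamma>" "sorted_wrt (\<ge>) \<gamma>" "decreasing \<kappa>"
  shows "incs \<kappa> \<gamma> (Suc b) \<le> \<kappa> b"
  using assms
proof (induction \<gamma> rule: rev_induct)
  case Nil
  then show ?case by (simp add: decreasing_def)
next
  case (snoc g \<gamma>)
  have g: "\<forall>x\<in>set \<gamma>. g \<le> x" using snoc.prems(2) by (simp add: sorted_wrt_append)
  have IH: "incs \<kappa> \<gamma> (Suc b) \<le> \<kappa> b" using snoc by (simp add: sorted_wrt_append)
  show ?case
  proof (cases "g = Suc b")
    case True
    then have "b \<notin> set \<gamma>" using g by auto
    then have "incs \<kappa> \<gamma> b = \<kappa> b" by (simp add: incs_count count_mset_0_iff)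
    then show ?thesis using snoc.prems(1) True by (simp add: addable_def inc_def)
  next
    case False
    then show ?thesis using IH by (simp add: inc_def)
  qed
qed

text \<open>The piecewise linear toggle behind the Bender-Knuth involution: the middle shape
  \<kappa> is reflected within the range that its neighbours \<mu> and
  \<open>incs \<kappa> \<gamma>\<close> allow. The term \<open>\<kappa> b\<close> stands on the left
  to avoid truncated subtraction.\<close>

lemma slide_block:
  assumes "lattice_from \<kappa> \<gamma>" "sorted_wrt (\<ge>) \<gamma>" "interlacing \<kappa> \<mu>"
  shows "incs \<mu> (slide \<kappa> \<mu> \<gamma>) b + \<kappa> b = max (\<mu> b) (incs \<kappa> \<gamma> (Suc b)) +
    (if b = 0 then incs \<kappa> \<gamma> b else min (\<mu> (b - 1)) (incs \<kappa> \<gamma> b))"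
  using assms
proof (induction \<gamma> arbitrary: b rule: rev_induct)
  case Nil
  then show ?case by (cases b) (auto simp: interlacing_def)
next
  case (snoc g \<gamma>)
  have il: "\<mu> i \<le> \<kappa> i" "\<kappa> (Suc i) \<le> \<mu> i" for i
    using snoc.prems(3) by (auto simp: interlacing_def)
  define K M where "K = incs \<kappa> \<gamma>" and "M = incs \<mu> (slide \<kappa> \<mu> \<gamma>)"
  have IH: "M b + \<kappa> b = max (\<mu> b) (K (Suc b)) + (if b = 0 then K b else min (\<mu> (b - 1)) (K b))" for b
    using snoc.IH[of b] snoc.prems by (simp add: sorted_wrt_append K_def M_def)
  have g: "\<forall>x\<in>set \<gamma>. g \<le> x" using snoc.prems(2) by (simp add: sorted_wrt_append)
  have low: "K i = \<kappa> i" if "i < g" for i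
    using g that by (auto simp: K_def incs_count count_mset_0_iff)
  have add: "addable K g" using snoc.prems(1) by (simp add: K_def)
  have L: "incs \<kappa> (\<gamma> @ [g]) = inc g K" "incs \<mu> (slide \<kappa> \<mu> (\<gamma> @ [g])) = inc (slide_letter K M g) M"
    by (simp_all add: K_def M_def)
  show ?case
  proof (cases g)
    case 0
    then have s: "slide_letter K M g = 0" by (simp add: slide_letter_def)
    show ?thesis unfolding L s using IH[of b] 0 by (auto simp: inc_def)
  next
    case (Suc h)
    have Mh: "M h = max (\<mu> h) (K g)"
      using IH[of h] low[of h] il(2)[of "h - 1"] Suc by (cases h) auto
    have Kg: "K g < \<kappa> h" using add low[of h] Suc by (simp add: addable_def)
    show ?thesis
    proof (cases "K g < \<mu> h")
      case True
      then have s: "slide_letter K M g = g" using Mh Suc by (simp add: slide_letter_def)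
      show ?thesis unfolding L s using IH[of b] True Suc by (auto simp: inc_def)
    next
      case False
      then have s: "slide_letter K M g = h" using Mh Suc by (simp add: slide_letter_def)
      show ?thesis unfolding L s using IH[of b] False Suc by (auto simp: inc_def max_def)
    qed
  qed
qed

text \<open>Both sides are computed row by row. On the side of the colours it has to be counted how
  many cells of a row are red after the swap; on the other side stands the toggle formula.\<close>

lemma jdt_step_slide:
  assumes "lattice_from \<kappa> \<gamma>" "sorted_wrt (\<ge>) \<gamma>" "interlacing \<kappa> \<mu>" "decreasing \<kappa>"
  shows "jdt_step \<kappa> (incs \<kappa> \<gamma>) \<mu> = incs \<mu> (slide \<kappa> \<mu> \<gamma>)"
proof
  fix b
  define K where "K = incs \<kappa> \<gamma>"
  have il: "\<mu> i \<le> \<kappa> i" "\<kappa> (Suc i) \<le> \<mu> i" for i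
    using assms(3) by (auto simp: interlacing_def)
  have hs: "K (Suc i) \<le> \<kappa> i" for i unfolding K_def by (rule horizontal_strip[OF assms(1,2,4)])
  have ge: "\<kappa> i \<le> K i" for i by (simp add: K_def incs_count)
  have formula: "incs \<mu> (slide \<kappa> \<mu> \<gamma>) b + \<kappa> b = max (\<mu> b) (K (Suc b)) + (if b = 0 then K b else min (\<mu> (b - 1)) (K b))"
    unfolding K_def by (rule slide_block[OF assms(1-3)])
  have anti: "i \<le> j \<Longrightarrow> \<kappa> j \<le> \<kappa> i" for i j
    using assms(4) lift_Suc_antimono_le[of \<kappa>] by (auto simp: decreasing_def)
  have antiM: "i \<le> j \<Longrightarrow> \<mu> j \<le> \<mu> i" for i j
    using lift_Suc_antimono_le[of \<mu>] il by (meson le_trans)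
  have antiK: "i \<le> j \<Longrightarrow> K j \<le> K i" for i j
    using lift_Suc_antimono_le[of K] hs ge by (meson le_trans)
  show "jdt_step \<kappa> (incs \<kappa> \<gamma>) \<mu> b = incs \<mu> (slide \<kappa> \<mu> \<gamma>) b"
  proof (cases "K = \<kappa>")
    case True
    then show ?thesis using formula il[of b] il[of "b - 1"]
      by (cases b) (auto simp: jdt_step_def K_def[symmetric] max_def min_def split: if_splits)
  next
    case False
    let ?green = "diagram K - diagram \<kappa>" and ?red = "diagram \<kappa> - diagram \<mu>"
    have G: "a \<in> fst ` ?green \<longleftrightarrow> (\<exists>i. \<kappa> i \<le> a \<and> a < K i)" for a
      by (force simp: diagram_def)
    have R: "a \<in> fst ` ?red \<longleftrightarrow> (\<exists>i. \<mu> i \<le> a \<and> a < \<kappa> i)" for a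
      by (force simp: diagram_def)
    \<comment> \<open>As both colours form horizontal strips, a green cell in the column of a red
      cell of row \<open>b\<close> lies directly above it, in row \<open>b + 1\<close>. The next
      claim is the same seen from the green cell.\<close>
    have G': "a \<in> fst ` ?green \<longleftrightarrow> a < K (Suc b)" if a: "\<mu> b \<le> a" "a < \<kappa> b" for a
    proof
      assume "a \<in> fst ` ?green"
      then obtain i where i: "\<kappa> i \<le> a" "a < K i" unfolding G by blast
      then have "b < i" using anti[of i b] a by (meson leD le_trans not_le_imp_less order_le_less_trans)
      then show "a < K (Suc b)" using antiK[of "Suc b" i] i by simp
    next
      assume "a < K (Suc b)"
      then show "a \<in> fst ` ?green" unfolding G using il(2)[of b] a by (intro exI[of _ "Suc b"]) simp
    qed
    have R': "a \<in> fst ` ?red \<longleftrightarrow> b > 0 \<and> \<mu> (b - 1) \<le> a" if a: "\<kappa> b \<le> a" "a < K b" for a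
    proof
      assume "a \<in> fst ` ?red"
      then obtain i where i: "\<mu> i \<le> a" "a < \<kappa> i" unfolding R by blast
      then have "i < b" using anti[of b i] a by (meson leD le_trans not_le_imp_less order_le_less_trans)
      then have "b > 0" "i \<le> b - 1" by simp_all
      then show "b > 0 \<and> \<mu> (b - 1) \<le> a" using antiM[of i "b - 1"] i by linarith
    next
      assume "b > 0 \<and> \<mu> (b - 1) \<le> a"
      then show "a \<in> fst ` ?red" unfolding R using hs[of "b - 1"] a by (intro exI[of _ "b - 1"]) simp
    qed
    \<comment> \<open>The first interval are the red cells that keep their colour, the second one
      the green cells that turn red.\<close>
    have set: "{a. (a, b) \<in> ?red \<and> a \<notin> fst ` ?green \<or> (a, b) \<in> ?green \<and> a \<in> fst ` ?red} =
        {max (\<mu> b) (K (Suc b))..<\<kappa> b} \<union> (if b = 0 then {} else {max (\<kappa> b) (\<mu> (b - 1))..<K b})"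
      (is "?L = ?A \<union> ?B")
    proof (intro set_eqI)
      fix a
      have "(a, b) \<in> ?red \<longleftrightarrow> \<mu> b \<le> a \<and> a < \<kappa> b" "(a, b) \<in> ?green \<longleftrightarrow> \<kappa> b \<le> a \<and> a < K b"
        by (auto simp: diagram_def)
      then have "a \<in> ?L \<longleftrightarrow> (\<mu> b \<le> a \<and> a < \<kappa> b) \<and> \<not> a < K (Suc b) \<or>
          (\<kappa> b \<le> a \<and> a < K b) \<and> b > 0 \<and> \<mu> (b - 1) \<le> a"
        unfolding mem_Collect_eq using G'[of a] R'[of a] by blast
      also have "\<dots> \<longleftrightarrow> a \<in> ?A \<union> ?B" by (cases "b = 0") (simp_all, linarith+)
      finally show "a \<in> ?L \<longleftrightarrow> a \<in> ?A \<union> ?B" .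
    qed
    have "card (?A \<union> ?B) = card ?A + card ?B" by (intro card_Un_disjoint) auto
    then have c: "card ?L = (\<kappa> b - max (\<mu> b) (K (Suc b))) + (if b = 0 then 0 else K b - \<mu> (b - 1))"
      unfolding set using il(2)[of "b - 1"] by (cases b) (simp_all add: max_absorb2)
    have "jdt_step \<kappa> K \<mu> b = K b - card ?L" using False by (simp add: jdt_step_def Let_def)
    also have "\<dots> = incs \<mu> (slide \<kappa> \<mu> \<gamma>) b"
    proof (cases b)
      case 0
      then show ?thesis unfolding c using formula il[of b] hs[of b] ge[of b] by simp
    next
      case (Suc h)
      have "x = K b - ((\<kappa> b - m) + (K b - \<mu> h))"
        if "x + \<kappa> b = m + min (\<mu> h) (K b)" "m \<le> \<kappa> b" "\<kappa> b \<le> K b" "\<kappa> b \<le> \<mu> h" for x m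
        using that by (simp add: min_def split: if_splits)
      then show ?thesis unfolding c using formula il(1)[of b] il(2)[of h] hs[of b] ge[of b] Suc by simp
    qed
    finally show ?thesis by (simp add: K_def)
  qed
qed

text \<open>Without red cells nothing moves. This covers an empty first column, for which
  \<open>jdt\<close> just drops the first partition.\<close>

lemma slide_same: "lattice_from \<kappa> \<alpha> \<Longrightarrow> slide \<kappa> \<kappa> \<alpha> = \<alpha>"
  by (induction \<alpha> arbitrary: \<kappa>) (auto simp: slide_letter_def addable_def)

lemma incs_eq_empty_iff: "incs empty_partition \<alpha> = empty_partition \<longleftrightarrow> \<alpha> = []"
proof
  assume "incs empty_partition \<alpha> = empty_partition"
  then have "count (mset \<alpha>) i = 0" for i by (simp add: incs_count empty_partition_def fun_eq_iff)
  then have "mset \<alpha> = {#}" by (intro multiset_eqI) simp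
  then show "\<alpha> = []" by simp
qed simp

lemma take_drop_diff: "i \<le> j \<Longrightarrow> take j \<alpha> = take i \<alpha> @ take (j - i) (drop i \<alpha>)"
  by (metis le_add_diff_inverse take_add)

lemma incs_decreasing_empty: "lattice \<alpha> \<Longrightarrow> decreasing (incs empty_partition \<alpha>)"
  using lattice_decreasing by (simp add: decreasing_def)

lemma lattice_take: "lattice \<alpha> \<Longrightarrow> lattice (take i \<alpha>) \<and> lattice_from (incs empty_partition (take i \<alpha>)) (drop i \<alpha>)"
  by (metis append_take_drop_id lattice_from_append)

lemma lattice_from_take: "lattice_from \<kappa> \<alpha> \<Longrightarrow> lattice_from \<kappa> (take i \<alpha>)"
  by (metis append_take_drop_id lattice_from_append)

section \<open>Words cut into blocks, one for each column, and the partitions at the cuts\<close>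

definition blocks :: "bool \<Rightarrow> nat \<Rightarrow> (nat \<Rightarrow> nat) \<Rightarrow> nat list \<Rightarrow> bool" where
  "blocks ne n c \<alpha> \<longleftrightarrow> c 0 = 0 \<and> mono_on {..n} c \<and> c n = length \<alpha> \<and>
     (\<forall>x<n. \<forall>i. c x \<le> i \<longrightarrow> Suc i < c (Suc x) \<longrightarrow> (\<alpha> ! i < \<alpha> ! Suc i \<longleftrightarrow> \<not> ne))"

lemma blocks_mono: "blocks ne n c \<alpha> \<Longrightarrow> x \<le> y \<Longrightarrow> y \<le> n \<Longrightarrow> c x \<le> c y"
  by (auto simp: blocks_def intro: mono_onD)

lemma blocks_le_length: "blocks ne n c \<alpha> \<Longrightarrow> x \<le> n \<Longrightarrow> c x \<le> length \<alpha>"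
  using blocks_mono[of ne n c \<alpha> x n] by (auto simp: blocks_def)

lemma blocks_sorted:
  assumes "blocks True n c \<alpha>" "x < n"
  shows "sorted_wrt (\<ge>) (take (c (Suc x) - c x) (drop (c x) \<alpha>))"
  unfolding sorted_wrt_iff_nth_Suc_transp[OF transp_on_ge]
proof (intro allI impI)
  fix i assume i: "Suc i < length (take (c (Suc x) - c x) (drop (c x) \<alpha>))"
  have "c (Suc x) \<le> length \<alpha>" using assms by (intro blocks_le_length) auto
  then show "take (c (Suc x) - c x) (drop (c x) \<alpha>) ! i \<ge> take (c (Suc x) - c x) (drop (c x) \<alpha>) ! Suc i"
    using i assms unfolding blocks_def by (auto simp: not_less dest!: spec[of _ "c x + i"])
qed

text \<open>Here \<open>n\<close> counts the partitions, so a word with \<open>n\<close> blocks has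
  all its boundaries in \<open>boundary (Suc n)\<close>.\<close>

definition boundary :: "nat \<Rightarrow> (nat \<Rightarrow> nat) \<Rightarrow> nat list \<Rightarrow> partition list" where
  "boundary n c \<alpha> = map (\<lambda>x. incs empty_partition (take (c x) \<alpha>)) [0..<n]"

lemma nth_boundary: "x < n \<Longrightarrow> boundary n c \<alpha> ! x = incs empty_partition (take (c x) \<alpha>)"
  by (simp add: boundary_def)

lemma theta_dom_blocks:
  assumes "blocks True n c \<alpha>" "lattice \<alpha>" "0 < n"
  shows "theta_dom (c 1) \<alpha>"
  using assms blocks_le_length[OF assms(1), of 1] by (auto simp: theta_dom_def blocks_def)

text \<open>A single step of \<open>jdt_part\<close> slides a whole block, since the letters of a
  block decrease weakly and so add a horizontal strip.\<close>

lemma jdt_part_slide: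
  assumes "blocks True n c \<alpha>" "lattice \<alpha>" "x < n"
  shows "jdt_part (boundary (Suc n) c \<alpha>) x = incs empty_partition
    (slide (incs empty_partition (take (c 1) \<alpha>)) empty_partition (take (c (Suc x) - c 1) (drop (c 1) \<alpha>)))"
  using assms(3)
proof (induction x)
  case (Suc x)
  let ?\<kappa> = "incs empty_partition (take (c 1) \<alpha>)"
  let ?\<beta> = "take (c (Suc x) - c 1) (drop (c 1) \<alpha>)"
  let ?\<gamma> = "take (c (Suc (Suc x)) - c (Suc x)) (drop (c (Suc x)) \<alpha>)"
  let ?\<mu> = "incs empty_partition (slide ?\<kappa> empty_partition ?\<beta>)"
  have c: "c 1 \<le> c (Suc x)" "c (Suc x) \<le> c (Suc (Suc x))"
    using Suc.prems by (auto intro: blocks_mono[OF assms(1)])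
  have dom: "theta_dom (c 1) \<alpha>" using theta_dom_blocks[OF assms(1,2)] Suc.prems by simp
  have b: "take (c (Suc x)) \<alpha> = take (c 1) \<alpha> @ ?\<beta>"
    using c(1) by (rule take_drop_diff)
  have "drop (c 1) (take (c (Suc (Suc x))) \<alpha>) = drop (c 1) (take (c (Suc x)) \<alpha> @ ?\<gamma>)"
    using take_drop_diff[OF c(2), of \<alpha>] by simp
  also have "\<dots> = ?\<beta> @ ?\<gamma>"
  proof -
    have "length (take (c 1) \<alpha>) = c 1" using dom by (simp add: theta_dom_def)
    then show ?thesis unfolding b by (metis append.assoc append_eq_conv_conj)
  qed
  finally have g: "take (c (Suc (Suc x)) - c 1) (drop (c 1) \<alpha>) = ?\<beta> @ ?\<gamma>"
    by (simp add: drop_take)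
  have k: "incs ?\<kappa> ?\<beta> = incs empty_partition (take (c (Suc x)) \<alpha>)"
    unfolding b by simp
  have il: "interlacing (incs ?\<kappa> ?\<beta>) ?\<mu>"
    using interlacing_slide[OF theta_dom_interlacing(1)[OF dom], of ?\<beta>]
      lattice_from_take[OF theta_dom_interlacing(2)[OF dom]] by blast
  have "incs (incs ?\<kappa> ?\<beta>) ?\<gamma> = incs empty_partition (take (c (Suc (Suc x))) \<alpha>)"
    unfolding k take_drop_diff[OF c(2), of \<alpha>] by simp
  moreover have "jdt_step (incs ?\<kappa> ?\<beta>) (incs (incs ?\<kappa> ?\<beta>) ?\<gamma>) ?\<mu> =
      incs ?\<mu> (slide (incs ?\<kappa> ?\<beta>) ?\<mu> ?\<gamma>)"
  proof (rule jdt_step_slide[OF _ _ il])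
    show "lattice_from (incs ?\<kappa> ?\<beta>) ?\<gamma>"
      unfolding k using lattice_take[OF assms(2)] lattice_from_take by blast
    show "sorted_wrt (\<ge>) ?\<gamma>" using Suc.prems by (intro blocks_sorted[OF assms(1)]) simp
    show "decreasing (incs ?\<kappa> ?\<beta>)"
      unfolding k using lattice_take[OF assms(2)] incs_decreasing_empty by blast
  qed
  moreover have "jdt_part (boundary (Suc n) c \<alpha>) x = ?\<mu>" using Suc by simp
  moreover have "boundary (Suc n) c \<alpha> ! Suc x = incs ?\<kappa> ?\<beta>"
    "boundary (Suc n) c \<alpha> ! Suc (Suc x) = incs empty_partition (take (c (Suc (Suc x))) \<alpha>)"
    using Suc.prems unfolding k by (simp_all add: nth_boundary)
  ultimately show ?case
    unfolding jdt_part.simps g slide_append incs_simps by (simp only:)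
qed simp

lemma jdt_boundary:
  assumes "blocks True n c \<alpha>" "lattice \<alpha>" "0 < n"
  shows "jdt (boundary (Suc n) c \<alpha>) = boundary n (\<lambda>x. c (Suc x) - c 1) (theta (c 1) \<alpha>)"
proof -
  let ?\<kappa> = "incs empty_partition (take (c 1) \<alpha>)"
  have dom: "theta_dom (c 1) \<alpha>" using theta_dom_blocks[OF assms(1-3)] .
  have len: "c x \<le> length \<alpha>" if "x \<le> n" for x using blocks_le_length[OF assms(1) that] .
  have tk: "take (c (Suc x) - c 1) (theta (c 1) \<alpha>) =
      slide ?\<kappa> empty_partition (take (c (Suc x) - c 1) (drop (c 1) \<alpha>))" if "x < n" for x
    using len[of "Suc x"] that by (simp add: theta_def Let_def take_slide)
  show ?thesis
  proof (cases "boundary (Suc n) c \<alpha> ! 1 = empty_partition")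
    case True
    then have "take (c 1) \<alpha> = []" using assms(3) by (simp add: nth_boundary incs_eq_empty_iff)
    then have c1: "c (Suc 0) = 0" using len[of 1] assms(3) by auto
    have "tl (boundary (Suc n) c \<alpha>) = map (\<lambda>x. incs empty_partition (take (c x) \<alpha>)) (map Suc [0..<n])"
      by (simp add: boundary_def map_tl[symmetric] tl_upt map_Suc_upt del: upt_Suc)
    also have "\<dots> = boundary n (\<lambda>x. c (Suc x) - c 1) (theta (c 1) \<alpha>)"
      unfolding boundary_def using tk assms(2) lattice_from_take
      by (auto simp: c1 slide_same)
    finally show ?thesis using True by (simp add: jdt_def)
  next
    case False
    then show ?thesis
      using jdt_part_slide[OF assms(1,2)] tk
      by (simp add: jdt_def boundary_def[of n] boundary_def[of "Suc n"] del: upt_Suc)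
  qed
qed

section \<open>Conjugation\<close>

definition is_partition :: "partition \<Rightarrow> bool" where
  "is_partition \<kappa> \<longleftrightarrow> decreasing \<kappa> \<and> (\<exists>N. \<forall>i\<ge>N. \<kappa> i = 0)"

lemma decreasing_le: "decreasing \<kappa> \<Longrightarrow> i \<le> j \<Longrightarrow> \<kappa> j \<le> \<kappa> i"
  using lift_Suc_antimono_le[of \<kappa>] by (auto simp: decreasing_def)

text \<open>Replaces the cardinality in the definition of \<open>conjugate\<close> by a symmetric
  condition on cells, from which the other facts on conjugates follow.\<close>

lemma less_conjugate_iff:
  assumes "is_partition \<kappa>"
  shows "i < conjugate \<kappa> j \<longleftrightarrow> j < \<kappa> i"
proof -
  define m where "m = (LEAST i. \<kappa> i \<le> j)"
  obtain N where "\<kappa> N \<le> j" using assms unfolding is_partition_def by (metis le0 order.refl)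
  then have m: "\<kappa> m \<le> j" unfolding m_def by (rule LeastI)
  have "j < \<kappa> i \<longleftrightarrow> i < m" for i
  proof
    assume "j < \<kappa> i"
    then have "\<not> \<kappa> i \<le> \<kappa> m" using m by simp
    then show "i < m" using assms decreasing_le[of \<kappa> m i] unfolding is_partition_def by linarith
  next
    assume "i < m"
    then have "\<not> \<kappa> i \<le> j" unfolding m_def by (rule not_less_Least)
    then show "j < \<kappa> i" by simp
  qed
  then show ?thesis by (simp add: conjugate_def)
qed

lemma nat_eqI: "(\<And>i. i < a \<longleftrightarrow> i < b) \<Longrightarrow> a = (b :: nat)"
  by (metis linorder_neqE_nat less_irrefl)

lemma is_partition_conjugate:
  assumes "is_partition \<kappa>"
  shows "is_partition (conjugate \<kappa>)"
  unfolding is_partition_def decreasing_def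
proof (intro conjI exI[of _ "\<kappa> 0"] allI impI)
  fix j show "conjugate \<kappa> (Suc j) \<le> conjugate \<kappa> j"
  proof (rule leI, rule notI)
    assume "conjugate \<kappa> j < conjugate \<kappa> (Suc j)"
    then have "Suc j < \<kappa> (conjugate \<kappa> j)" by (rule less_conjugate_iff[OF assms, THEN iffD1])
    then have "conjugate \<kappa> j < conjugate \<kappa> j"
      by (intro less_conjugate_iff[OF assms, THEN iffD2]) simp
    then show False by simp
  qed
next
  fix j assume "\<kappa> 0 \<le> j"
  then show "conjugate \<kappa> j = 0"
    using less_conjugate_iff[OF assms, of 0 j] by auto
qed

lemma conjugate_conjugate: "is_partition \<kappa> \<Longrightarrow> conjugate (conjugate \<kappa>) = \<kappa>"
  by (intro ext nat_eqI) (simp add: less_conjugate_iff is_partition_conjugate)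

lemma is_partition_inc:
  assumes "is_partition \<kappa>" "addable \<kappa> g"
  shows "is_partition (inc g \<kappa>)"
proof -
  from assms(1) obtain N where "\<forall>i\<ge>N. \<kappa> i = 0" by (auto simp: is_partition_def)
  then have "\<forall>i\<ge>max N (Suc g). inc g \<kappa> i = 0" by (simp add: inc_def)
  then show ?thesis
    using assms inc_decreasing[of \<kappa> g] unfolding is_partition_def decreasing_def by blast
qed

lemma conjugate_addable:
  assumes "is_partition \<kappa>" "addable \<kappa> g"
  shows "conjugate \<kappa> (\<kappa> g) = g" "addable (conjugate \<kappa>) (\<kappa> g)"
proof -
  show c: "conjugate \<kappa> (\<kappa> g) = g"
  proof (rule nat_eqI)
    fix i
    have "\<kappa> g < \<kappa> i" if "i < g"
    proof -
      have "decreasing \<kappa>" using assms(1) unfolding is_partition_def by blast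
      then have "\<kappa> (g - 1) \<le> \<kappa> i" by (rule decreasing_le) (use that in linarith)
      moreover have "\<kappa> g < \<kappa> (g - 1)" using assms(2) that by (simp add: addable_def)
      ultimately show ?thesis by simp
    qed
    moreover have "i < g" if "\<kappa> g < \<kappa> i"
      using that decreasing_le[of \<kappa> g i] assms unfolding is_partition_def by linarith
    ultimately show "i < conjugate \<kappa> (\<kappa> g) \<longleftrightarrow> i < g"
      using less_conjugate_iff[OF assms(1)] by blast
  qed
  show "addable (conjugate \<kappa>) (\<kappa> g)"
    using less_conjugate_iff[OF assms(1), of g "\<kappa> g - 1"] by (auto simp: addable_def c)
qed

lemma conjugate_inc:
  assumes "is_partition \<kappa>" "addable \<kappa> g"
  shows "conjugate (inc g \<kappa>) = inc (\<kappa> g) (conjugate \<kappa>)"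
proof (intro ext nat_eqI)
  fix j i
  have "i < conjugate (inc g \<kappa>) j \<longleftrightarrow> j < \<kappa> i \<or> i = g \<and> j = \<kappa> g"
    unfolding less_conjugate_iff[OF is_partition_inc[OF assms]] by (auto simp: inc_def)
  also have "\<dots> \<longleftrightarrow> i < inc (\<kappa> g) (conjugate \<kappa>) j"
    using less_conjugate_iff[OF assms(1), of i j] conjugate_addable(1)[OF assms]
    by (auto simp: inc_def less_Suc_eq)
  finally show "i < conjugate (inc g \<kappa>) j \<longleftrightarrow> i < inc (\<kappa> g) (conjugate \<kappa>) j" .
qed

text \<open>Replaces the row of every added cell by its column.\<close>

primrec conj_from :: "partition \<Rightarrow> nat list \<Rightarrow> nat list" where
  "conj_from \<kappa> [] = []"
| "conj_from \<kappa> (g # \<alpha>) = \<kappa> g # conj_from (inc g \<kappa>) \<alpha>"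

abbreviation conj_word :: "nat list \<Rightarrow> nat list" where
  "conj_word \<equiv> conj_from empty_partition"

lemma is_partition_empty [simp]: "is_partition empty_partition"
  by (simp add: is_partition_def decreasing_def empty_partition_def)

lemma conjugate_empty [simp]: "conjugate empty_partition = empty_partition"
  by (simp add: conjugate_def empty_partition_def)

lemma conj_from_append [simp]:
  "conj_from \<kappa> (\<alpha> @ \<beta>) = conj_from \<kappa> \<alpha> @ conj_from (incs \<kappa> \<alpha>) \<beta>"
  by (induction \<alpha> arbitrary: \<kappa>) simp_all

lemma length_conj_from [simp]: "length (conj_from \<kappa> \<alpha>) = length \<alpha>"
  by (induction \<alpha> arbitrary: \<kappa>) simp_all

lemma take_conj_from: "take n (conj_from \<kappa> \<alpha>) = conj_from \<kappa> (take n \<alpha>)"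
  by (induction \<alpha> arbitrary: n \<kappa>) (simp_all add: take_Cons split: nat.split)

lemma conj_from_lattice:
  assumes "is_partition \<kappa>" "lattice_from \<kappa> \<alpha>"
  shows "lattice_from (conjugate \<kappa>) (conj_from \<kappa> \<alpha>)"
    "incs (conjugate \<kappa>) (conj_from \<kappa> \<alpha>) = conjugate (incs \<kappa> \<alpha>)"
    "conj_from (conjugate \<kappa>) (conj_from \<kappa> \<alpha>) = \<alpha>"
    "is_partition (incs \<kappa> \<alpha>)"
proof -
  have "lattice_from (conjugate \<kappa>) (conj_from \<kappa> \<alpha>) \<and>
    incs (conjugate \<kappa>) (conj_from \<kappa> \<alpha>) = conjugate (incs \<kappa> \<alpha>) \<and>
    conj_from (conjugate \<kappa>) (conj_from \<kappa> \<alpha>) = \<alpha> \<and> is_partition (incs \<kappa> \<alpha>)"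
    using assms
  proof (induction \<alpha> arbitrary: \<kappa>)
    case (Cons g \<alpha>)
    then show ?case
      using Cons.IH[of "inc g \<kappa>"] conjugate_addable[of \<kappa> g] by (simp add: conjugate_inc is_partition_inc)
  qed simp
  then show "lattice_from (conjugate \<kappa>) (conj_from \<kappa> \<alpha>)"
    "incs (conjugate \<kappa>) (conj_from \<kappa> \<alpha>) = conjugate (incs \<kappa> \<alpha>)"
    "conj_from (conjugate \<kappa>) (conj_from \<kappa> \<alpha>) = \<alpha>"
    "is_partition (incs \<kappa> \<alpha>)" by blast+
qed

lemma conj_word_lattice:
  assumes "lattice \<alpha>"
  shows "lattice (conj_word \<alpha>)" "conj_word (conj_word \<alpha>) = \<alpha>"
    "incs empty_partition (take i (conj_word \<alpha>)) = conjugate (incs empty_partition (take i \<alpha>))"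
    "is_partition (incs empty_partition (take i \<alpha>))"
  using conj_from_lattice[OF is_partition_empty assms]
    conj_from_lattice(2,4)[OF is_partition_empty lattice_from_take[OF assms, of i]]
  by (simp_all add: take_conj_from)

text \<open>Of two cells added consecutively, the later one lies either strictly above and weakly to
  the left of the earlier one, or weakly below and strictly to the right of it.\<close>

lemma conj_from_descents:
  assumes "is_partition \<kappa>" "lattice_from \<kappa> \<alpha>" "Suc i < length \<alpha>"
  shows "conj_from \<kappa> \<alpha> ! i < conj_from \<kappa> \<alpha> ! Suc i \<longleftrightarrow> \<not> \<alpha> ! i < \<alpha> ! Suc i"
  using assms
proof (induction \<alpha> arbitrary: \<kappa> i)
  case (Cons a \<alpha>)
  show ?case
  proof (cases i)
    case 0
    then obtain b \<beta> where b: "\<alpha> = b # \<beta>" using Cons.prems(3) by (cases \<alpha>) auto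
    have dec: "decreasing \<kappa>" using Cons.prems(1) by (simp add: is_partition_def)
    have add: "addable \<kappa> a" using Cons.prems(2) by simp
    consider "a < b" | "a = b" | "b < a" by linarith
    then have "\<kappa> a < inc a \<kappa> b \<longleftrightarrow> \<not> a < b"
    proof cases
      case 1
      then show ?thesis using decreasing_le[OF dec, of a b] by (simp add: inc_def)
    next
      case 3
      then have "b \<le> a - 1" "\<kappa> a < \<kappa> (a - 1)" using add by (auto simp: addable_def)
      then show ?thesis using 3 decreasing_le[OF dec, of b "a - 1"] by (simp add: inc_def)
    qed (simp add: inc_def)
    then show ?thesis by (simp add: 0 b)
  next
    case (Suc j)
    then show ?thesis using Cons is_partition_inc by simp
  qed
qed simp

text \<open>Transposition reverses all the comparisons involved, and \<open>mv3\<close> depends only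
  on which of them agree. The two exchanged cells lie in different rows, so the exchange does not
  affect their columns.\<close>

lemma conj_from_mv3:
  assumes "is_partition \<kappa>" "lattice_from \<kappa> [a, b, c]" "lattice_from \<kappa> (mv3 (<) a b c)"
  shows "conj_from \<kappa> (mv3 (<) a b c) = mv (<) 0 (conj_from \<kappa> [a, b, c])"
proof (rule commutes_with_mv3[where lat = "lattice_from \<kappa>"])
  note d = conj_from_descents[OF assms(1), of "[_, _, _]" 0] conj_from_descents[OF assms(1), of "[_, _, _]" 1]
  have comm: "inc x (inc y \<nu>) = inc y (inc x \<nu>)" for x y \<nu> by (auto simp: inc_def fun_eq_iff)
  { fix a b c assume "lattice_from \<kappa> [a, b, c]" "(a < b) = (b < c)"
    then show "(conj_from \<kappa> [a, b, c] ! 0 < conj_from \<kappa> [a, b, c] ! 1) = (conj_from \<kappa> [a, b, c] ! 1 < conj_from \<kappa> [a, b, c] ! 2)"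
      using d[of a b c] by (simp add: numeral_2_eq_2) }
  { fix a b c assume *: "lattice_from \<kappa> [a, b, c]" "lattice_from \<kappa> [b, a, c]" "a < c" "c \<le> b"
    define x where "x = inc b (inc a \<kappa>) c"
    have x': "inc a (inc b \<kappa>) c = x" by (simp add: x_def comm)
    have ab: "inc a \<kappa> b = \<kappa> b" "inc b \<kappa> a = \<kappa> a" using *(3,4) by (simp_all add: inc_def)
    have "\<not> \<kappa> a < \<kappa> b" "\<kappa> b < x" "\<not> \<kappa> a < x"
      using d[of a b c, OF *(1)] d(2)[of b a c, OF *(2)] *(3,4) by (simp_all add: ab x' flip: x_def)
    then show "conj_from \<kappa> [b, a, c] = mv3 (<) (conj_from \<kappa> [a, b, c] ! 0) (conj_from \<kappa> [a, b, c] ! 1) (conj_from \<kappa> [a, b, c] ! 2)"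
      by (simp add: ab x' mv3_def flip: x_def) }
  { fix a b c assume *: "lattice_from \<kappa> [a, b, c]" "lattice_from \<kappa> [a, c, b]" "a < b" "c \<le> a"
    define x y where "x = inc a \<kappa> b" and "y = inc a \<kappa> c"
    have bc: "inc b (inc a \<kappa>) c = y" "inc c (inc a \<kappa>) b = x"
      using *(3,4) by (simp_all add: x_def y_def inc_def)
    have "\<not> \<kappa> a < x" "x < y" "\<kappa> a < y"
      using d[of a b c, OF *(1)] d(1)[of a c b, OF *(2)] *(3,4) by (simp_all add: bc flip: x_def y_def)
    then show "conj_from \<kappa> [a, c, b] = mv3 (<) (conj_from \<kappa> [a, b, c] ! 0) (conj_from \<kappa> [a, b, c] ! 1) (conj_from \<kappa> [a, b, c] ! 2)"
      by (simp add: bc mv3_def flip: x_def y_def) }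
qed (use assms in simp_all)

lemma conj_word_mv:
  assumes "lattice \<alpha>" "lattice (mv (<) i \<alpha>)"
  shows "conj_word (mv (<) i \<alpha>) = mv (<) i (conj_word \<alpha>)"
proof (cases "i + 2 < length \<alpha>")
  case True
  then obtain U a b c V where w: "\<alpha> = U @ [a, b, c] @ V" and i: "length U = i"
    by (metis append_Cons append_Nil split3)
  let ?\<kappa> = "incs empty_partition U"
  have m: "mv (<) i \<alpha> = U @ mv3 (<) a b c @ V"
    using mv_append[of "(<)" U a b c V] i by (simp add: w)
  have part: "is_partition ?\<kappa>"
    using assms(1) conj_from_lattice(4)[OF is_partition_empty, of U] by (simp add: w)
  have s3: "conj_from ?\<kappa> (mv3 (<) a b c) = mv (<) 0 (conj_from ?\<kappa> [a, b, c])"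
    using assms part by (intro conj_from_mv3) (simp_all add: m, simp_all add: w)
  have c1: "incs ?\<kappa> (mv3 (<) a b c) = incs ?\<kappa> [a, b, c]" by (rule incs_mset_cong) simp
  obtain a' b' c' where t: "conj_from ?\<kappa> [a, b, c] = [a', b', c']" by simp
  show ?thesis
    unfolding m unfolding w conj_from_append s3 c1 unfolding t
    using mv_append[of "(<)" "conj_word U" a' b' c'] i by (simp add: mv_eq_0)
qed (simp add: mv_def)

section \<open>Jeu de taquin for all variants\<close>

text \<open>Vertical strips are reduced to horizontal ones by transposition. The flag will be
  \<open>column_NE\<close>, in contrast to the \<open>ne\<close> of \<open>descent\<close> and
  \<open>Q_labels\<close>, which will be \<open>row_NE\<close>.\<close>

definition Theta :: "bool \<Rightarrow> nat \<Rightarrow> nat list \<Rightarrow> nat list" where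
  "Theta ne k \<alpha> = (if ne then theta k \<alpha> else conj_word (theta k (conj_word \<alpha>)))"

definition Theta_dom :: "bool \<Rightarrow> nat \<Rightarrow> nat list \<Rightarrow> bool" where
  "Theta_dom ne k \<alpha> \<longleftrightarrow> lattice \<alpha> \<and> k \<le> length \<alpha> \<and>
     (\<forall>i. Suc i < k \<longrightarrow> (\<alpha> ! i < \<alpha> ! Suc i \<longleftrightarrow> \<not> ne))"

lemma conj_word_descents:
  "lattice \<alpha> \<Longrightarrow> Suc i < length \<alpha> \<Longrightarrow>
    conj_word \<alpha> ! i < conj_word \<alpha> ! Suc i \<longleftrightarrow> \<not> \<alpha> ! i < \<alpha> ! Suc i"
  by (rule conj_from_descents) simp_all

lemma Theta_dom_theta:
  assumes "Theta_dom ne k \<alpha>"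
  shows "theta_dom k (if ne then \<alpha> else conj_word \<alpha>)"
  using assms conj_word_lattice(1)[of \<alpha>] conj_word_descents[of \<alpha>]
  by (auto simp: Theta_dom_def theta_dom_def)

lemma mset_eq_of_incs: "incs empty_partition \<alpha> = incs empty_partition \<beta> \<Longrightarrow> mset \<alpha> = mset \<beta>"
  by (rule multiset_eqI) (simp add: incs_count empty_partition_def fun_eq_iff)

lemma Theta_lattice:
  assumes "Theta_dom ne k \<alpha>"
  shows "lattice (Theta ne k \<alpha>)" "mset (Theta ne k \<alpha>) = mset \<alpha>" "length (Theta ne k \<alpha>) = length \<alpha>"
proof -
  have lat: "lattice \<alpha>" using assms by (simp add: Theta_dom_def)
  note th = theta_lattice[OF Theta_dom_theta[OF assms]]
  show "lattice (Theta ne k \<alpha>)" using th conj_word_lattice(1) by (auto simp: Theta_def)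
  show m: "mset (Theta ne k \<alpha>) = mset \<alpha>"
  proof (cases ne)
    case False
    have "incs empty_partition (theta k (conj_word \<alpha>)) = incs empty_partition (conj_word \<alpha>)"
      using th False by (intro incs_mset_cong) simp
    then have "incs empty_partition (Theta ne k \<alpha>) = incs empty_partition \<alpha>"
      using False th conj_word_lattice(3)[of "theta k (conj_word \<alpha>)" "length \<alpha>"]
        conj_word_lattice(3)[of \<alpha> "length \<alpha>"] conj_word_lattice(4)[OF lat, of "length \<alpha>"] lat
      by (simp add: Theta_def conjugate_conjugate)
    then show ?thesis by (rule mset_eq_of_incs)
  qed (use th in \<open>simp add: Theta_def\<close>)
  then show "length (Theta ne k \<alpha>) = length \<alpha>" by (rule mset_eq_length)
qed

lemma Theta_descent:
  assumes "Theta_dom ne k \<alpha>" "Suc (k + i) < length \<alpha>"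
  shows "Theta ne k \<alpha> ! i < Theta ne k \<alpha> ! Suc i \<longleftrightarrow> \<alpha> ! (k + i) < \<alpha> ! Suc (k + i)"
  using theta_descent[OF Theta_dom_theta[OF assms(1)], of i] assms
    theta_lattice[OF Theta_dom_theta[OF assms(1)]]
  by (auto simp: Theta_def conj_word_descents Theta_dom_def)

lemma Theta_last_block:
  assumes "Theta_dom ne k \<alpha>" "length \<alpha> \<le> i + k" "Suc i < length \<alpha>"
  shows "Theta ne k \<alpha> ! i < Theta ne k \<alpha> ! Suc i \<longleftrightarrow> \<not> ne"
  using theta_last_block[OF Theta_dom_theta[OF assms(1)], of i] assms
    theta_lattice[OF Theta_dom_theta[OF assms(1)]]
  by (auto simp: Theta_def conj_word_descents)

lemma Theta_mv:
  assumes "Theta_dom ne k \<alpha>" "lattice (mv (<) (k + i) \<alpha>)" "k + i + 2 < length \<alpha>"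
  shows "Theta_dom ne k (mv (<) (k + i) \<alpha>)" "Theta ne k (mv (<) (k + i) \<alpha>) = mv (<) i (Theta ne k \<alpha>)"
proof -
  let ?m = "mv (<) (k + i) \<alpha>"
  have k: "k \<le> length \<alpha>" and lat: "lattice \<alpha>" using assms(1) by (simp_all add: Theta_dom_def)
  have m: "?m = take k \<alpha> @ mv (<) i (drop k \<alpha>)"
    using mv_append_left[of "(<)" "take k \<alpha>" i "drop k \<alpha>"] k by (simp add: min_absorb2)
  have nth: "?m ! j = \<alpha> ! j" if "j < k" for j
    using that k unfolding m by (simp add: nth_append)
  then show dom: "Theta_dom ne k ?m" using assms by (auto simp: Theta_dom_def)
  show "Theta ne k ?m = mv (<) i (Theta ne k \<alpha>)"
  proof (cases ne)
    case True
    then show ?thesis using theta_mv[of k \<alpha> i] Theta_dom_theta[OF assms(1)] assms by (simp add: Theta_def)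
  next
    case False
    have c: "conj_word ?m = mv (<) (k + i) (conj_word \<alpha>)" by (rule conj_word_mv[OF lat assms(2)])
    have dom': "theta_dom k (conj_word \<alpha>)" using Theta_dom_theta[OF assms(1)] False by simp
    have "lattice (mv (<) (k + i) (conj_word \<alpha>))" using conj_word_lattice(1)[OF assms(2)] c by simp
    note t = theta_mv[OF dom' this]
    have "lattice (mv (<) i (theta k (conj_word \<alpha>)))"
      using theta_lattice(1)[OF t(1)] t(2) assms(3) by simp
    then have "conj_word (mv (<) i (theta k (conj_word \<alpha>))) = mv (<) i (conj_word (theta k (conj_word \<alpha>)))"
      by (intro conj_word_mv theta_lattice(1)[OF dom'])
    then show ?thesis using False t(2) assms(3) by (simp add: Theta_def c)
  qed
qed

lemma Theta_dom_blocks: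
  assumes "blocks ne n c \<alpha>" "lattice \<alpha>" "0 < n"
  shows "Theta_dom ne (c 1) \<alpha>"
  using assms blocks_le_length[OF assms(1), of 1] by (auto simp: Theta_dom_def blocks_def)

lemma boundary_conj_word: "lattice \<alpha> \<Longrightarrow> boundary n c (conj_word \<alpha>) = map conjugate (boundary n c \<alpha>)"
  by (simp add: boundary_def conj_word_lattice)

lemma jdt_variant_boundary:
  assumes "blocks (column_NE v) n c \<alpha>" "lattice \<alpha>" "0 < n"
  shows "jdt_variant v (boundary (Suc n) c \<alpha>) =
    boundary n (\<lambda>x. c (Suc x) - c 1) (Theta (column_NE v) (c 1) \<alpha>)"
proof (cases "column_NE v")
  case True
  then show ?thesis using jdt_boundary[of n c \<alpha>] assms by (simp add: jdt_variant_def Theta_def)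
next
  case False
  have bl: "blocks True n c (conj_word \<alpha>)"
    unfolding blocks_def
  proof (intro conjI allI impI)
    fix x i assume x: "x < n" "c x \<le> i" "Suc i < c (Suc x)"
    moreover from x have "Suc i < length \<alpha>"
      using blocks_le_length[OF assms(1), of "Suc x"] by simp
    ultimately show "conj_word \<alpha> ! i < conj_word \<alpha> ! Suc i \<longleftrightarrow> \<not> True"
      using assms(1) False conj_word_descents[OF assms(2)] by (auto simp: blocks_def)
  qed (use assms(1) in \<open>simp_all add: blocks_def\<close>)
  have "theta_dom (c 1) (conj_word \<alpha>)"
    by (rule theta_dom_blocks[OF bl conj_word_lattice(1)[OF assms(2)] assms(3)])
  then show ?thesis
    using jdt_boundary[OF bl conj_word_lattice(1)[OF assms(2)] assms(3)] False
    by (simp add: jdt_variant_def Theta_def boundary_conj_word assms(2) theta_lattice)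
qed

text \<open>The cuts after the first block has been taken away and a block of the same length has
  been appended at the end.\<close>

definition shift_blocks :: "nat \<Rightarrow> (nat \<Rightarrow> nat) \<Rightarrow> nat \<Rightarrow> nat" where
  "shift_blocks n c x = (if x < n then c (Suc x) - c 1 else c n)"

lemma jdt_bar_boundary:
  assumes "blocks (column_NE v) n c \<alpha>" "lattice \<alpha>" "0 < n"
  shows "jdt_bar v (boundary (Suc n) c \<alpha>) =
    boundary (Suc n) (shift_blocks n c) (Theta (column_NE v) (c 1) \<alpha>)"
proof -
  note th = Theta_lattice[OF Theta_dom_blocks[OF assms], unfolded One_nat_def]
  have cn: "c n = length \<alpha>" using assms(1) by (simp add: blocks_def)
  have "last (boundary (Suc n) c \<alpha>) = incs empty_partition \<alpha>"
    by (simp add: boundary_def cn)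
  also have "\<dots> = incs empty_partition (Theta (column_NE v) (c 1) \<alpha>)"
    by (rule incs_mset_cong) (simp add: th)
  finally show ?thesis
    using jdt_variant_boundary[OF assms] th(3)
    by (simp add: jdt_bar_def boundary_def shift_blocks_def cn)
qed

text \<open>All blocks but the last inherit their descents from the block one place further right;
  the last one is the appended strip.\<close>

lemma blocks_Theta:
  assumes "blocks ne n c \<alpha>" "lattice \<alpha>" "0 < n"
  shows "blocks ne n (shift_blocks n c) (Theta ne (c 1) \<alpha>)"
  unfolding blocks_def
proof (intro conjI allI impI)
  note dom = Theta_dom_blocks[OF assms]
  note th = Theta_lattice[OF dom, unfolded One_nat_def]
  have cn: "c n = length \<alpha>" using assms(1) by (simp add: blocks_def)
  have mono: "c x \<le> c y" if "x \<le> y" "y \<le> n" for x y using blocks_mono[OF assms(1) that] .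
  show "shift_blocks n c 0 = 0" using assms(3) by (simp add: shift_blocks_def)
  show "shift_blocks n c n = length (Theta ne (c 1) \<alpha>)" by (simp add: shift_blocks_def cn th)
  show "mono_on {..n} (shift_blocks n c)"
  proof (rule mono_onI)
    fix x y assume "x \<in> {..n}" "y \<in> {..n}" "x \<le> y"
    then show "shift_blocks n c x \<le> shift_blocks n c y"
      using mono[of "Suc x" "Suc y"] mono[of "Suc x" n] by (auto simp: shift_blocks_def intro: diff_le_mono le_trans[OF diff_le_self])
  qed
  fix x i assume x: "x < n" "shift_blocks n c x \<le> i" "Suc i < shift_blocks n c (Suc x)"
  have c1: "c 1 \<le> c (Suc x)" using mono[of 1 "Suc x"] x(1) by simp
  show "Theta ne (c 1) \<alpha> ! i < Theta ne (c 1) \<alpha> ! Suc i \<longleftrightarrow> \<not> ne"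
  proof (cases "Suc x < n")
    case True
    then have i: "c (Suc x) \<le> c 1 + i" "Suc (c 1 + i) < c (Suc (Suc x))"
      using x c1 by (auto simp: shift_blocks_def)
    moreover have "c (Suc (Suc x)) \<le> length \<alpha>" using True cn mono[of "Suc (Suc x)" n] by simp
    ultimately show ?thesis
      using Theta_descent[OF dom, of i] assms(1) True by (auto simp: blocks_def)
  next
    case False
    then have "n = Suc x" using x(1) by simp
    then show ?thesis using Theta_last_block[OF dom, of i] x c1 cn by (simp add: shift_blocks_def)
  qed
qed

section \<open>Words of fillings of rectangles\<close>

text \<open>The rows of the units of a column, in the order in which standardisation places these
  units.\<close>

definition col_word :: "variant \<Rightarrow> nat \<Rightarrow> (nat \<Rightarrow> nat) \<Rightarrow> nat list" where
  "col_word v m f = concat (map (\<lambda>y. replicate (f y) y) (if column_NE v then [0..<m] else rev [0..<m]))"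

definition word :: "variant \<Rightarrow> nat \<Rightarrow> nat \<Rightarrow> (nat \<Rightarrow> nat \<Rightarrow> nat) \<Rightarrow> nat list" where
  "word v n m F = concat (map (\<lambda>x. col_word v m (F x)) [0..<n])"

lemma word_0 [simp]: "word v 0 m F = []"
  and word_Suc: "word v (Suc n) m F = word v n m F @ col_word v m (F n)"
  by (simp_all add: word_def)

lemma count_col_word: "count (mset (col_word v m f)) y = (if y < m then f y else 0)"
proof (cases "column_NE v")
  case True
  then show ?thesis unfolding col_word_def by (induction m) (auto simp: less_Suc_eq)
next
  case False
  then show ?thesis unfolding col_word_def by (induction m) (auto simp: less_Suc_eq)
qed

lemma set_col_word: "y \<in> set (col_word v m f) \<Longrightarrow> y < m"
  by (auto simp: col_word_def split: if_splits)

lemma length_col_word: "length (col_word v m f) = (\<Sum>y<m. f y)"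
  unfolding col_word_def by (induction m) (auto split: if_splits)

lemma length_word: "length (word v n m F) = column_start m F n"
  unfolding column_start_def by (induction n) (simp_all add: word_Suc length_col_word)

lemma count_word: "count (mset (word v n m F)) y = (if y < m then \<Sum>x<n. F x y else 0)"
  by (induction n) (simp_all add: word_Suc count_col_word)

lemma set_word: "y \<in> set (word v n m F) \<Longrightarrow> y < m"
  by (auto simp: word_def dest: set_col_word)

lemma word_split:
  assumes "x \<le> n"
  obtains r where "word v n m F = word v x m F @ r" "count (mset r) = (\<lambda>y. if y < m then \<Sum>x\<in>{x..<n}. F x y else 0)"
  using assms
proof (induction n arbitrary: thesis)
  case 0
  then show ?case by (intro "0.prems"(1)[of "[]"]) auto
next
  case (Suc n)
  show ?case
  proof (cases "x = Suc n")
    case True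
    then show ?thesis by (intro Suc.prems(1)[of "[]"]) auto
  next
    case False
    then have le: "x \<le> n" using Suc.prems(2) by simp
    then obtain r where r: "word v n m F = word v x m F @ r"
      "count (mset r) = (\<lambda>y. if y < m then \<Sum>x\<in>{x..<n}. F x y else 0)"
      using Suc.IH by blast
    then show ?thesis using le
      by (intro Suc.prems(1)[of "r @ col_word v m (F n)"]) (auto simp: word_Suc count_col_word fun_eq_iff)
  qed
qed

lemma take_word:
  assumes "x \<le> n"
  shows "take (column_start m F x) (word v n m F) = word v x m F"
  using assms by (metis word_split length_word append_eq_conv_conj)

lemma size_filter_sum:
  fixes M :: "nat multiset"
  shows "size (filter_mset (\<lambda>z. z < y) M) = (\<Sum>z<y. count M z)"
proof (induction y)
  case (Suc y)
  have "filter_mset (\<lambda>z. z < Suc y) M = filter_mset (\<lambda>z. z < y) M + filter_mset (\<lambda>z. z = y) M"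
    by (rule multiset_eqI) auto
  then show ?case using Suc by (simp add: filter_eq_replicate_mset)
qed simp

lemma row_start_word:
  assumes "y \<le> m"
  shows "row_start n F y = size (filter_mset (\<lambda>z. z < y) (mset (word v n m F)))"
  using assms by (simp add: row_start_def size_filter_sum count_word)

lemma row_start_length: "row_start n F m = length (word v n m F)"
proof -
  have "filter_mset (\<lambda>z. z < m) (mset (word v n m F)) = mset (word v n m F)"
    by (simp add: filter_mset_eq_conv set_word)
  then show ?thesis by (simp add: row_start_word[of m m n F v])
qed

subsection \<open>Standardisation\<close>

definition col_offset :: "variant \<Rightarrow> nat \<Rightarrow> (nat \<Rightarrow> nat) \<Rightarrow> nat \<Rightarrow> nat" where
  "col_offset v m f y = (if column_NE v then \<Sum>y'<y. f y' else \<Sum>y'\<in>{y<..<m}. f y')"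

lemma col_word_split:
  assumes "y < m"
  obtains p q where "col_word v m f = p @ replicate (f y) y @ q" "length p = col_offset v m f y"
    "y \<notin> set p" "y \<notin> set q"
proof -
  let ?g = "\<lambda>y. replicate (f y) y"
  have u: "[0..<m] = [0..<y] @ y # [Suc y..<m]"
    using assms by (metis upt_add_eq_append upt_conv_Cons le_add_diff_inverse less_imp_le_nat zero_le)
  show thesis
  proof (cases "column_NE v")
    case True
    have "length (concat (map ?g [0..<y])) = (\<Sum>y'<y. f y')" by (induction y) simp_all
    then show thesis
      using True by (intro that[of "concat (map ?g [0..<y])" "concat (map ?g [Suc y..<m])"])
        (auto simp: col_word_def col_offset_def u)
  next
    case False
    have "length (concat (map ?g (rev [a..<b]))) = (\<Sum>y'\<in>{a..<b}. f y')" for a b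
      by (induction b) (auto simp: sum.atLeastLessThan_Suc)
    moreover have "{Suc y..<m} = {y<..<m}" by auto
    ultimately show thesis
      using False by (intro that[of "concat (map ?g (rev [Suc y..<m]))" "concat (map ?g (rev [0..<y]))"])
        (auto simp: col_word_def col_offset_def u)
  qed
qed

lemma col_word_position:
  assumes "t < length (col_word v m f)"
  obtains y k where "y < m" "k < f y" "t = col_offset v m f y + k"
proof (cases "column_NE v")
  case True
  have "\<exists>y k. y < m \<and> k < f y \<and> t = (\<Sum>y'<y. f y') + k" if "t < (\<Sum>y<m. f y)"
    using that
  proof (induction m)
    case (Suc m)
    show ?case
    proof (cases "t < (\<Sum>y<m. f y)")
      case True
      then show ?thesis using Suc.IH less_SucI by blast
    next
      case False
      then show ?thesis using Suc.prems by (intro exI[of _ m] exI[of _ "t - (\<Sum>y<m. f y)"]) auto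
    qed
  qed simp
  then show thesis using that assms True by (auto simp: length_col_word col_offset_def)
next
  case False
  have "\<exists>y k. y < m \<and> k < f y \<and> t = (\<Sum>y'\<in>{y<..<m}. f y') + k" if "t < (\<Sum>y<m. f y)"
    using that
  proof (induction m arbitrary: t)
    case (Suc m)
    show ?case
    proof (cases "t < f m")
      case True
      have "{m<..<Suc m} = {}" by auto
      then show ?thesis using True by (intro exI[of _ m] exI[of _ t]) simp
    next
      case False
      then have "t - f m < (\<Sum>y<m. f y)" using Suc.prems by simp
      then obtain y k where yk: "y < m" "k < f y" "t - f m = (\<Sum>y'\<in>{y<..<m}. f y') + k"
        using Suc.IH by blast
      have "{y<..<Suc m} = insert m {y<..<m}" using yk(1) by auto
      then have "t = (\<Sum>y'\<in>{y<..<Suc m}. f y') + k" using yk False by simp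
      then show ?thesis using yk by (intro exI[of _ y] exI[of _ k]) auto
    qed
  qed simp
  then show thesis using that assms False by (auto simp: length_col_word col_offset_def)
qed

lemma word_position:
  assumes "t < length (word v n m F)"
  obtains x t' where "x < n" "t' < length (col_word v m (F x))" "t = column_start m F x + t'"
proof -
  have "\<exists>x t'. x < n \<and> t' < length (col_word v m (F x)) \<and> t = column_start m F x + t'"
    using assms
  proof (induction n)
    case (Suc n)
    show ?case
    proof (cases "t < length (word v n m F)")
      case True
      then show ?thesis using Suc.IH less_SucI by blast
    next
      case False
      then show ?thesis using Suc.prems
        by (intro exI[of _ n] exI[of _ "t - column_start m F n"]) (auto simp: word_Suc length_word)
    qed
  qed simp
  then show thesis using that by blast
qed

lemma std_split:
  "std ne (A @ y # B) ! length A = size (filter_mset (\<lambda>z. z < y) (mset (A @ y # B))) +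
    (if ne then count (mset A) y else count (mset B) y)"
proof -
  let ?w = "A @ y # B" and ?t = "length A"
  have c: "size (filter_mset P (mset w)) = card {s. s < length w \<and> P (w ! s)}" for P and w :: "nat list"
    by (metis length_filter_conv_card mset_filter size_mset)
  have eq: "count (mset w) y = card {s. s < length w \<and> w ! s = y}" for w
    using c[of "\<lambda>z. z = y" w] by (simp add: filter_eq_replicate_mset)
  have A: "{s. s < length ?w \<and> ?w ! s = y \<and> s < ?t} = {s. s < length A \<and> A ! s = y}"
    by (auto simp: nth_append)
  have "?w ! ?t = y" "?t < length ?w" by simp_all
  then have un: "{s. s < length ?w \<and> ?w ! s = y} = {s. s < length ?w \<and> ?w ! s = y \<and> s < ?t} \<union>
      insert ?t {s. s < length ?w \<and> ?w ! s = y \<and> ?t < s}"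
    by (auto simp del: length_append)
  have disj: "{s. s < length ?w \<and> ?w ! s = y \<and> s < ?t} \<inter>
      insert ?t {s. s < length ?w \<and> ?w ! s = y \<and> ?t < s} = {}"
    by (auto simp del: length_append)
  have fin: "finite {s. s < length ?w \<and> ?w ! s = y \<and> s < ?t}"
    "finite (insert ?t {s. s < length ?w \<and> ?w ! s = y \<and> ?t < s})" by simp_all
  have "card {s. s < length ?w \<and> ?w ! s = y} = card {s. s < length ?w \<and> ?w ! s = y \<and> s < ?t} +
      card (insert ?t {s. s < length ?w \<and> ?w ! s = y \<and> ?t < s})"
    using card_Un_disjoint[OF fin disj] unfolding un .
  then have B: "card {s. s < length ?w \<and> ?w ! s = y \<and> ?t < s} = count (mset B) y"
    unfolding A using eq[of A] eq[of ?w] by (simp add: card_insert_if)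
  have "card {s. s < length ?w \<and> before ne ?w s ?t} = card {s. s < length ?w \<and> ?w ! s < y} +
      card {s. s < length ?w \<and> ?w ! s = y \<and> (if ne then s < ?t else ?t < s)}"
  proof (subst card_Un_disjoint[symmetric])
    show "card {s. s < length ?w \<and> before ne ?w s ?t} = card ({s. s < length ?w \<and> ?w ! s < y} \<union>
        {s. s < length ?w \<and> ?w ! s = y \<and> (if ne then s < ?t else ?t < s)})"
      by (rule arg_cong[of _ _ card]) (auto simp: before_def)
  qed auto
  then show ?thesis using A B c[of "\<lambda>z. z < y" ?w] eq[of A] by (simp add: std_nth)
qed

lemma unit_in_word:
  fixes v :: variant
  assumes "x < n" "y < m" "k < F x y"
  defines "t \<equiv> column_start m F x + unit_column v m F x y k"
  shows "t < length (word v n m F) \<and> word v n m F ! t = y \<and>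
    std (row_NE v) (word v n m F) ! t = row_start n F y + unit_row v n F x y k"
proof -
  obtain r where r: "word v n m F = word v (Suc x) m F @ r"
    and cr: "count (mset r) y = (\<Sum>x'\<in>{x<..<n}. F x' y)"
    using word_split[of "Suc x" n v m F] assms(1,2) by (metis Suc_leI atLeastSucLessThan_greaterThanLessThan)
  obtain p q where pq: "col_word v m (F x) = p @ replicate (F x y) y @ q"
    "length p = col_offset v m (F x) y" "y \<notin> set p" "y \<notin> set q"
    using col_word_split[OF assms(2)] by blast
  \<comment> \<open>The word is cut at unit \<open>k\<close> of the cell. The numbers of letters
    \<open>y\<close> in \<open>A\<close> and in \<open>B\<close> give \<open>unit_row\<close> for
    the two directions of the chains.\<close>
  define A B where "A = word v x m F @ p @ replicate k y"
    and "B = replicate (F x y - 1 - k) y @ q @ r"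
  have rep: "replicate (F x y) y = replicate k y @ y # replicate (F x y - 1 - k) y"
    using assms(3) by (metis Suc_diff_Suc diff_Suc_eq_diff_pred le_add_diff_inverse less_imp_le_nat replicate_Suc replicate_add)
  have w: "word v n m F = A @ y # B"
    unfolding r word_Suc pq(1) rep by (simp add: A_def B_def)
  have t: "t = length A"
    by (simp add: t_def A_def length_word unit_column_def pq(2) col_offset_def)
  have cA: "count (mset A) y = (\<Sum>x'<x. F x' y) + k"
    using pq(3) assms(2) by (simp add: A_def count_word count_mset_0_iff)
  have cB: "count (mset B) y = (\<Sum>x'\<in>{x<..<n}. F x' y) + (F x y - 1 - k)"
    using pq(4) cr by (simp add: B_def count_mset_0_iff)
  show ?thesis
    using std_split[of "row_NE v" A y B] row_start_word[of y m n F v] assms(2)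
    by (simp add: t w cA cB unit_row_def)
qed

lemma standardisation_word:
  "standardisation v n m F = perm_cells (std (row_NE v) (word v n m F))"
proof (intro equalityI subsetI)
  fix z assume "z \<in> standardisation v n m F"
  then obtain x y k where "x < n" "y < m" "k < F x y"
    "z = (column_start m F x + unit_column v m F x y k, row_start n F y + unit_row v n F x y k)"
    by (auto simp: standardisation_def)
  then show "z \<in> perm_cells (std (row_NE v) (word v n m F))"
    using unit_in_word[of x n y m k F v] by (auto simp: perm_cells_def)
next
  fix z assume "z \<in> perm_cells (std (row_NE v) (word v n m F))"
  then obtain t where t: "t < length (word v n m F)" "z = (t, std (row_NE v) (word v n m F) ! t)"
    by (auto simp: perm_cells_def)
  obtain x t' where x: "x < n" "t' < length (col_word v m (F x))" "t = column_start m F x + t'"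
    using word_position[OF t(1)] by blast
  obtain y k where y: "y < m" "k < F x y" "t' = col_offset v m (F x) y + k"
    using col_word_position[OF x(2)] by blast
  have "t = column_start m F x + unit_column v m F x y k"
    using x(3) y(3) by (simp add: unit_column_def col_offset_def)
  then show "z \<in> standardisation v n m F"
    unfolding standardisation_def using unit_in_word[of x n y m k F v] x(1) y(1,2) t(2) by blast
qed

subsection \<open>The sequences P and Q\<close>

text \<open>The counterpart of \<open>Q_labels\<close> on the right border. All these labels exist,
  as every row of the standardisation contains a 1.\<close>

definition P_word :: "bool \<Rightarrow> nat list \<Rightarrow> nat list" where
  "P_word ne w = map (\<lambda>j. the (P_labels ne w j)) [0..<length w]"

lemma length_P_word [simp]: "length (P_word ne w) = length w"
  by (simp add: P_word_def)

lemma growth_P_word: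
  assumes "j \<le> length w"
  shows "growth (perm_cells (std ne w)) (length w) j = incs empty_partition (take j (P_word ne w))"
  using assms
proof (induction j)
  case (Suc j)
  then obtain a where "P_labels ne w j = Some a" using P_labels_Some[of j w ne] by auto
  then show ?case using Suc growth_P_labels[of ne w j]
    by (simp add: take_Suc_conv_app_nth P_word_def add_label_def del: growth.simps)
qed (simp add: growth_0)

lemma column_start_mono: "x \<le> n \<Longrightarrow> column_start m F x \<le> column_start m F n"
  by (simp add: column_start_def sum_mono2)

lemma row_start_mono: "x \<le> n \<Longrightarrow> row_start m F x \<le> row_start m F n"
  by (simp add: row_start_def sum_mono2)

lemma Q_seq_word:
  "Q_seq v n m F = boundary (Suc n) (column_start m F) (Q_labels (row_NE v) (word v n m F))"
proof -
  have "growth (standardisation v n m F) (column_start m F x) (row_start n F m) =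
      incs empty_partition (take (column_start m F x) (Q_labels (row_NE v) (word v n m F)))" if "x \<le> n" for x
    using growth_Q_labels[of "column_start m F x" "word v n m F"] column_start_mono[OF that, of m F]
    by (simp add: standardisation_word row_start_length[of n F m v] length_word del: growth.simps)
  then show ?thesis by (simp add: Q_seq_def boundary_def del: upt_Suc)
qed

lemma P_seq_word:
  "P_seq v n m F = boundary (Suc m) (row_start n F) (P_word (row_NE v) (word v n m F))"
proof -
  have "growth (standardisation v n m F) (column_start m F n) (row_start n F y) =
      incs empty_partition (take (row_start n F y) (P_word (row_NE v) (word v n m F)))" if "y \<le> m" for y
    using growth_P_word[of "row_start n F y" "word v n m F"] row_start_mono[OF that, of n F]
    by (simp add: standardisation_word row_start_length[of n F m v] length_word[symmetric, of m F n v] del: growth.simps)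
  then show ?thesis by (simp add: P_seq_def boundary_def del: upt_Suc)
qed

section \<open>Descents inside blocks, and uniqueness of words and fillings\<close>

lemma col_word_descents:
  assumes "zero_one v \<Longrightarrow> \<forall>y. f y \<le> 1" "Suc i < length (col_word v m f)"
  shows "descent (row_NE v) (col_word v m f ! i) (col_word v m f ! Suc i) \<longleftrightarrow> \<not> column_NE v"
proof -
  let ?R = "\<lambda>a b. descent (row_NE v) a b \<longleftrightarrow> \<not> column_NE v"
  \<comment> \<open>Two equal letters form a descent exactly if \<open>row_NE\<close> fails. This
    fits the reading direction of the column unless the variant is a 0-1 variant, and then no letter
    is repeated.\<close>
  have rep: "sorted_wrt ?R (replicate (f y) y)" for y
  proof -
    have "f y \<le> 1 \<or> ?R y y"
      using assms(1) by (cases v) (auto simp: zero_one_def row_NE_def column_NE_def descent_def)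
    then show ?thesis
      by (auto simp: sorted_wrt_iff_nth_less)
  qed
  have "sorted_wrt ?R (col_word v m f)"
  proof (cases "column_NE v")
    case True
    have "sorted_wrt ?R (concat (map (\<lambda>y. replicate (f y) y) [0..<m]))"
      using rep by (induction m) (auto simp: sorted_wrt_append descent_def True)
    then show ?thesis using True by (simp add: col_word_def)
  next
    case False
    have "sorted_wrt ?R (concat (map (\<lambda>y. replicate (f y) y) (rev [0..<m])))"
      using rep by (induction m) (auto simp: sorted_wrt_append descent_def False)
    then show ?thesis using False by (simp add: col_word_def)
  qed
  then show ?thesis using assms(2) by (simp add: sorted_wrt_iff_nth_less)
qed

lemma sorted_wrt_ge_replicate: "sorted_wrt (\<ge>) (replicate k (y :: nat))"
  by (simp add: sorted_wrt_iff_nth_less)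

text \<open>The prescribed descents make \<open>b\<close> monotone, so its content determines it. In
  the 0-1 variants they make it strictly monotone, which yields entries at most 1.\<close>

lemma col_word_unique:
  assumes "\<And>i. Suc i < length b \<Longrightarrow> descent (row_NE v) (b ! i) (b ! Suc i) \<longleftrightarrow> \<not> column_NE v"
    and "\<forall>y\<in>set b. y < m"
  shows "col_word v m (count (mset b)) = b" "zero_one v \<Longrightarrow> count (mset b) y \<le> 1"
proof -
  have m: "mset (col_word v m (count (mset b))) = mset b"
    using assms(2) by (intro multiset_eqI) (auto simp: count_col_word count_mset_0_iff)
  show "col_word v m (count (mset b)) = b"
  proof (cases "column_NE v")
    case True
    have "sorted b" unfolding sorted_iff_nth_Suc using assms(1) True
      by (force simp: descent_def split: if_splits)
    moreover have "sorted (col_word v m f)" for f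
      unfolding col_word_def using True by (induction m) (auto simp: sorted_append less_imp_le)
    ultimately show ?thesis using m by (metis properties_for_sort)
  next
    case False
    have "sorted_wrt (\<ge>) b" unfolding sorted_wrt_iff_nth_Suc_transp[OF transp_on_ge]
      using assms(1) False by (force simp: descent_def split: if_splits)
    moreover have "sorted_wrt (\<ge>) (col_word v m f)" for f
      unfolding col_word_def using False
      by (induction m) (auto simp: sorted_wrt_append less_imp_le sorted_wrt_ge_replicate)
    ultimately have "sorted (rev b)" "sorted (rev (col_word v m (count (mset b))))"
      by (simp_all add: sorted_wrt_rev)
    then show ?thesis using m by (metis mset_rev properties_for_sort rev_rev_ident)
  qed
  assume z: "zero_one v"
  have "distinct b"
  proof (cases "column_NE v")
    case True
    then have "\<not> row_NE v" using z by (cases v) (auto simp: zero_one_def row_NE_def column_NE_def)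
    then have "sorted_wrt (<) b" unfolding sorted_wrt_iff_nth_Suc_transp[OF transp_on_less]
      using assms(1) True by (force simp: descent_def split: if_splits)
    then show ?thesis by (simp add: strict_sorted_iff)
  next
    case False
    then have "row_NE v" using z by (cases v) (auto simp: zero_one_def row_NE_def column_NE_def)
    then have "sorted_wrt (>) b" unfolding sorted_wrt_iff_nth_Suc_transp[OF transp_on_greater]
      using assms(1) False by (force simp: descent_def split: if_splits)
    then have "sorted_wrt (<) (rev b)" by (simp add: sorted_wrt_rev)
    then show ?thesis by (simp add: strict_sorted_iff)
  qed
  then show "count (mset b) y \<le> 1" by (simp add: distinct_count_atmost_1)
qed

lemma word_block:
  assumes "x < n"
  shows "take (column_start m F (Suc x) - column_start m F x) (drop (column_start m F x) (word v n m F)) =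
    col_word v m (F x)"
proof -
  have "drop (column_start m F x) (take (column_start m F (Suc x)) (word v n m F)) = col_word v m (F x)"
    using assms take_word[of "Suc x" n m F v] by (simp add: word_Suc length_word)
  then show ?thesis by (simp add: drop_take)
qed

lemma blocks_word:
  assumes "rect_filling v n m F"
  shows "blocks (column_NE v) n (column_start m F) (Q_labels (row_NE v) (word v n m F))"
  unfolding blocks_def
proof (intro conjI allI impI)
  show "mono_on {..n} (column_start m F)" by (auto intro: mono_onI column_start_mono)
  fix x i assume x: "x < n" "column_start m F x \<le> i" "Suc i < column_start m F (Suc x)"
  let ?w = "word v n m F" and ?j = "i - column_start m F x"
  have le: "column_start m F (Suc x) \<le> length ?w" using x(1) column_start_mono[of "Suc x" n] by (simp add: length_word)
  have "col_word v m (F x) ! ?j = ?w ! i" "col_word v m (F x) ! Suc ?j = ?w ! Suc i"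
    unfolding word_block[OF x(1), symmetric, where m = m and F = F and v = v] using x le by simp_all
  moreover have "Suc ?j < length (col_word v m (F x))"
    using x by (simp add: length_col_word column_start_def)
  ultimately show "(Q_labels (row_NE v) ?w ! i < Q_labels (row_NE v) ?w ! Suc i) = (\<not> column_NE v)"
    using Q_labels_descent[of i ?w "row_NE v"] col_word_descents[of v "F x" ?j m] assms x le
    by (simp add: rect_filling_def)
qed (simp_all add: length_word column_start_def)

lemma blocks_P_word: "blocks (row_NE v) m (row_start n F) (P_word (row_NE v) (word v n m F))"
  unfolding blocks_def
proof (intro conjI allI impI)
  show "mono_on {..m} (row_start n F)" by (auto intro: mono_onI row_start_mono)
  show "row_start n F m = length (P_word (row_NE v) (word v n m F))" by (simp add: row_start_length)
  fix y j assume y: "y < m" "row_start n F y \<le> j" "Suc j < row_start n F (Suc y)"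
  let ?w = "word v n m F"
  have "row_start n F (Suc y) \<le> length ?w"
    using row_start_mono[of "Suc y" m n F] y(1) by (simp add: row_start_length[symmetric])
  then have j: "Suc j < length ?w" using y by simp
  then obtain a b where ab: "P_labels (row_NE v) ?w j = Some a" "P_labels (row_NE v) ?w (Suc j) = Some b"
    using P_labels_Some by (metis Suc_lessD)
  have "a < b \<longleftrightarrow> \<not> row_NE v"
    using P_labels_row[OF _ _ ab, of y] y row_start_word[of y m n F v] row_start_word[of "Suc y" m n F v]
    by (simp add: less_Suc_eq_le)
  then show "(P_word (row_NE v) ?w ! j < P_word (row_NE v) ?w ! Suc j) = (\<not> row_NE v)"
    using ab j by (simp add: P_word_def)
qed (simp add: row_start_def)

lemma blocks_descent:
  "blocks ne n c \<alpha> \<Longrightarrow> x < n \<Longrightarrow> c x \<le> i \<Longrightarrow> Suc i < c (Suc x) \<Longrightarrow> \<alpha> ! i < \<alpha> ! Suc i \<longleftrightarrow> \<not> ne"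
  unfolding blocks_def by blast

lemma run_unique:
  fixes a b :: "nat list"
  assumes "mset a = mset b" "\<And>i. Suc i < length a \<Longrightarrow> (a ! i < a ! Suc i) = s"
    "\<And>i. Suc i < length b \<Longrightarrow> (b ! i < b ! Suc i) = s"
  shows "a = b"
proof (cases s)
  case True
  then have "sorted a" "sorted b" unfolding sorted_iff_nth_Suc using assms(2,3) by (auto simp: less_imp_le)
  then show ?thesis using assms(1) by (metis properties_for_sort)
next
  case False
  then have "sorted_wrt (\<ge>) a" "sorted_wrt (\<ge>) b"
    unfolding sorted_wrt_iff_nth_Suc_transp[OF transp_on_ge] using assms(2,3) by (auto simp: not_less)
  then have "sorted (rev a)" "sorted (rev b)" by (simp_all add: sorted_wrt_rev)
  then show ?thesis using assms(1) by (metis mset_rev properties_for_sort rev_rev_ident)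
qed

text \<open>Two consecutive partitions give the content of a block, and a block is either weakly
  decreasing or strictly increasing, hence determined by its content.\<close>

lemma boundary_unique:
  assumes "blocks ne n c \<alpha>" "blocks ne n d \<beta>" "boundary (Suc n) c \<alpha> = boundary (Suc n) d \<beta>"
  shows "\<alpha> = \<beta>" "x \<le> n \<Longrightarrow> c x = d x"
proof -
  have m: "mset (take (c x) \<alpha>) = mset (take (d x) \<beta>)" if "x \<le> n" for x
    using arg_cong[OF assms(3), of "\<lambda>l. l ! x"] that by (intro mset_eq_of_incs) (simp add: nth_boundary)
  have cd: "c x = d x" if "x \<le> n" for x
    using mset_eq_length[OF m[OF that]] blocks_le_length[OF assms(1) that] blocks_le_length[OF assms(2) that]
    by simp
  then show "x \<le> n \<Longrightarrow> c x = d x" by blast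
  have "take (c x) \<alpha> = take (c x) \<beta>" if "x \<le> n" for x
    using that
  proof (induction x)
    case 0
    then show ?case using assms(1) by (simp add: blocks_def)
  next
    case (Suc x)
    have le: "c x \<le> c (Suc x)" using Suc.prems by (intro blocks_mono[OF assms(1)]) auto
    have len: "c (Suc x) \<le> length \<alpha>" "c (Suc x) \<le> length \<beta>"
      using blocks_le_length[OF assms(1) Suc.prems] blocks_le_length[OF assms(2) Suc.prems] cd[OF Suc.prems] by simp_all
    let ?a = "take (c (Suc x) - c x) (drop (c x) \<alpha>)" and ?b = "take (c (Suc x) - c x) (drop (c x) \<beta>)"
    have a: "take (c (Suc x)) \<alpha> = take (c x) \<alpha> @ ?a" "take (c (Suc x)) \<beta> = take (c x) \<beta> @ ?b"
      using le by (simp_all add: take_drop_diff)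
    have "?a = ?b"
    proof (rule run_unique)
      have "mset (take (c x) \<alpha> @ ?a) = mset (take (c x) \<beta> @ ?b)"
        using m[OF Suc.prems] unfolding cd[OF Suc.prems, symmetric] a .
      moreover have "take (c x) \<alpha> = take (c x) \<beta>" using Suc.IH Suc.prems by (simp only: Suc_leD)
      ultimately show "mset ?a = mset ?b" by (simp only: mset_append add_left_cancel)
      show "(?a ! i < ?a ! Suc i) = (\<not> ne)" if "Suc i < length ?a" for i
        using that blocks_descent[OF assms(1), of x "c x + i"] Suc.prems len by simp
      show "(?b ! i < ?b ! Suc i) = (\<not> ne)" if "Suc i < length ?b" for i
        using that blocks_descent[OF assms(2), of x "c x + i"] Suc.prems len cd[of x] cd[of "Suc x"]
        by (simp add: less_diff_conv add.commute)
    qed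
    then show ?case using Suc a by simp
  qed
  from this[of n] show "\<alpha> = \<beta>" using assms(1,2) cd[of n] by (simp add: blocks_def)
qed

subsection \<open>Fillings from words\<close>

text \<open>The inverse of \<open>word\<close>. The cuts \<open>c\<close> have to be supplied, as
  the word alone does not show where a column ends.\<close>

definition filling_of :: "nat \<Rightarrow> nat \<Rightarrow> (nat \<Rightarrow> nat) \<Rightarrow> nat list \<Rightarrow> nat \<Rightarrow> nat \<Rightarrow> nat" where
  "filling_of n m c w x y =
     (if x < n \<and> y < m then count (mset (take (c (Suc x) - c x) (drop (c x) w))) y else 0)"

lemma filling_of_word:
  assumes "blocks (column_NE v) n c (Q_labels (row_NE v) w)" "\<forall>y\<in>set w. y < m"
  shows "rect_filling v n m (filling_of n m c w)" "word v n m (filling_of n m c w) = w"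
    "x \<le> n \<Longrightarrow> column_start m (filling_of n m c w) x = c x"
proof -
  let ?G = "filling_of n m c w"
  let ?b = "\<lambda>x. take (c (Suc x) - c x) (drop (c x) w)"
  have le: "c x \<le> length w" if "x \<le> n" for x using blocks_le_length[OF assms(1) that] by simp
  have d: "descent (row_NE v) (?b x ! i) (?b x ! Suc i) \<longleftrightarrow> \<not> column_NE v"
    if "x < n" "Suc i < length (?b x)" for x i
    using that Q_labels_descent[of "c x + i" w "row_NE v"] blocks_descent[OF assms(1), of x "c x + i"] le[of "Suc x"]
    by (simp add: less_diff_conv add.commute)
  have s: "\<forall>y\<in>set (?b x). y < m" for x using assms(2) by (meson in_set_dropD in_set_takeD)
  have cw: "col_word v m (?G x) = ?b x" if "x < n" for x
  proof -
    have "col_word v m (?G x) = col_word v m (count (mset (?b x)))"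
      unfolding col_word_def using that by (auto simp: filling_of_def intro!: arg_cong[of _ _ concat])
    then show ?thesis using col_word_unique(1)[of "?b x" v m] d[OF that] s by simp
  qed
  show "rect_filling v n m ?G"
    using col_word_unique(2)[of "?b _" v m] d s
    by (auto simp: rect_filling_def filling_of_def)
  have tw: "word v x m ?G = take (c x) w" if "x \<le> n" for x
    using that
  proof (induction x)
    case 0
    then show ?case using assms(1) by (simp add: blocks_def)
  next
    case (Suc x)
    have "c x \<le> c (Suc x)" using Suc.prems by (intro blocks_mono[OF assms(1)]) auto
    then show ?case using Suc cw[of x] by (simp add: word_Suc take_drop_diff)
  qed
  then show "word v n m ?G = w" using assms(1) by (simp add: blocks_def)
  show "x \<le> n \<Longrightarrow> column_start m ?G x = c x"
    using tw[of x] le[of x] length_word[of v x m ?G] by simp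
qed

lemma filling_of_word_inverse:
  assumes "rect_filling v n m F" "\<And>x. x \<le> n \<Longrightarrow> c x = column_start m F x"
  shows "filling_of n m c (word v n m F) = F"
proof (intro ext)
  fix x y
  show "filling_of n m c (word v n m F) x y = F x y"
    using assms word_block[of x n m F v] by (auto simp: filling_of_def count_col_word rect_filling_def)
qed

text \<open>Moves keep P, so moves that carry Q to its image under jeu de taquin carry the word to
  one with the required pair. This exhibits a witness for the definite description in
  \<open>j_bar_def\<close>.\<close>

lemma j_bar_word:
  assumes "rect_filling v n m F" "0 < n"
    and "mvs (<) \<sigma> (Q_labels (row_NE v) (word v n m F)) =
      Theta (column_NE v) (column_start m F 1) (Q_labels (row_NE v) (word v n m F))"
  shows "rect_filling v n m (j_bar v n m F)"
    "word v n m (j_bar v n m F) = mvs (descent (row_NE v)) \<sigma> (word v n m F)"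
    "x \<le> n \<Longrightarrow> column_start m (j_bar v n m F) x = shift_blocks n (column_start m F) x"
proof -
  let ?w = "word v n m F" and ?r = "row_NE v"
  let ?\<alpha> = "Q_labels ?r ?w" and ?c = "column_start m F"
  let ?w' = "mvs (descent ?r) \<sigma> ?w" and ?c' = "shift_blocks n (column_start m F)"
  define G where "G = filling_of n m ?c' ?w'"
  have bl: "blocks (column_NE v) n ?c ?\<alpha>" by (rule blocks_word[OF assms(1)])
  have Q': "Q_labels ?r ?w' = Theta (column_NE v) (?c 1) ?\<alpha>" by (simp add: Q_labels_mvs assms(3))
  have bl': "blocks (column_NE v) n ?c' (Q_labels ?r ?w')"
    unfolding Q' by (rule blocks_Theta[OF bl lattice_Q_labels assms(2)])
  have "set ?w' = set ?w" using mset_mvs[of "descent ?r" \<sigma> ?w] by (rule mset_eq_setD)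
  then have "\<forall>y\<in>set ?w'. y < m" using set_word by blast
  note G = filling_of_word[OF bl' this, folded G_def]
  have QG: "Q_seq v n m G = jdt_bar v (Q_seq v n m F)"
  proof -
    have "Q_seq v n m G = boundary (Suc n) ?c' (Q_labels ?r ?w')"
      unfolding Q_seq_word G(2) using G(3) by (simp add: boundary_def)
    also have "\<dots> = jdt_bar v (Q_seq v n m F)"
      unfolding Q_seq_word Q' jdt_bar_boundary[OF bl lattice_Q_labels assms(2)] ..
    finally show ?thesis .
  qed
  have row: "row_start n G y = row_start n F y" if "y \<le> m" for y
    using row_start_word[OF that, of n G v] row_start_word[OF that, of n F v] by (simp add: G(2))
  have PG: "P_seq v n m G = P_seq v n m F"
    unfolding P_seq_word G(2) using row
    by (simp add: boundary_def P_word_def P_labels_mvs)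
  \<comment> \<open>The partitions on the two borders return the labels and the cuts; the cuts on
    the right border give the content, and content and labels determine the word.\<close>
  have uniq: "H = G" if H: "rect_filling v n m H" "P_seq v n m H = P_seq v n m F"
    "Q_seq v n m H = jdt_bar v (Q_seq v n m F)" for H
  proof -
    let ?v = "word v n m H"
    have "boundary (Suc n) (column_start m H) (Q_labels ?r ?v) = boundary (Suc n) (column_start m G) (Q_labels ?r ?w')"
      using H(3) QG Q_seq_word[of v n m H] Q_seq_word[of v n m G] by (simp add: G(2))
    moreover have "blocks (column_NE v) n (column_start m G) (Q_labels ?r ?w')"
      using blocks_word[OF G(1)] by (simp add: G(2))
    ultimately have q: "Q_labels ?r ?v = Q_labels ?r ?w'" "\<And>x. x \<le> n \<Longrightarrow> column_start m H x = column_start m G x"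
      using boundary_unique[OF blocks_word[OF H(1)]] by blast+
    have "boundary (Suc m) (row_start n H) (P_word ?r ?v) = boundary (Suc m) (row_start n G) (P_word ?r ?w')"
      using H(2) PG P_seq_word[of v n m H] P_seq_word[of v n m G] by (simp add: G(2))
    moreover have "blocks ?r m (row_start n G) (P_word ?r ?w')"
      using blocks_P_word[of v m n G] by (simp add: G(2))
    ultimately have p: "P_word ?r ?v = P_word ?r ?w'" "\<And>y. y \<le> m \<Longrightarrow> row_start n H y = row_start n G y"
      using boundary_unique[OF blocks_P_word] by blast+
    have len: "length ?v = length ?w'" using arg_cong[OF q(1), of length] by simp
    have mv: "mset ?v = mset (word v n m G)"
    proof (rule multiset_eqI)
      fix y
      show "count (mset ?v) y = count (mset (word v n m G)) y"
        using p(2)[of y] p(2)[of "Suc y"] by (simp add: count_word row_start_def)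
    qed
    have pv: "P_labels ?r ?v j = P_labels ?r ?w' j" if "j < length ?v" for j
    proof -
      have "the (P_labels ?r ?v j) = the (P_labels ?r ?w' j)"
        using arg_cong[OF p(1), of "\<lambda>l. l ! j"] that len unfolding P_word_def by simp
      then show ?thesis
        using P_labels_Some[OF that, of ?r] P_labels_Some[of j ?w' ?r] that len by auto
    qed
    have "?v = ?w'" by (rule labels_eqD[OF mv[unfolded G(2)] q(1) pv])
    then have "filling_of n m (column_start m G) (word v n m H) = filling_of n m (column_start m G) (word v n m G)"
      by (simp add: G(2))
    then show "H = G" using q(2) filling_of_word_inverse[OF H(1)] filling_of_word_inverse[OF G(1)] by simp
  qed
  have "j_bar v n m F = G"
    unfolding j_bar_def using G(1) PG QG uniq by (intro the_equality) blast+
  then show "rect_filling v n m (j_bar v n m F)"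
    "word v n m (j_bar v n m F) = ?w'"
    "x \<le> n \<Longrightarrow> column_start m (j_bar v n m F) x = ?c' x"
    using G by simp_all
qed

section \<open>Moves and restriction to an interval of rows\<close>

text \<open>Two words have the same mask if the letters from \<open>J\<close> occupy the same
  positions in both and all other letters agree.\<close>

definition mask :: "(nat \<Rightarrow> bool) \<Rightarrow> nat \<Rightarrow> nat option" where
  "mask J x = (if J x then None else Some x)"

lemma mask_eq_iff: "mask J x = mask J y \<longleftrightarrow> (if J x then J y else y = x)"
  by (auto simp: mask_def)

definition rows :: "nat \<Rightarrow> nat \<Rightarrow> nat \<Rightarrow> bool" where
  "rows b m y \<longleftrightarrow> b \<le> y \<and> y < b + m"

definition restr :: "nat \<Rightarrow> nat \<Rightarrow> nat list \<Rightarrow> nat list" where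
  "restr b m B = map (\<lambda>y. y - b) (filter (rows b m) B)"

lemma restr_append [simp]: "restr b m (B @ C) = restr b m B @ restr b m C"
  and restr_Nil [simp]: "restr b m [] = []"
  and restr_Cons: "restr b m (x # B) = (if rows b m x then (x - b) # restr b m B else restr b m B)"
  by (simp_all add: restr_def)

lemma length_restr_mask:
  "map (mask (rows b m)) B = map (mask (rows b m)) C \<Longrightarrow> length (restr b m B) = length (restr b m C)"
proof -
  assume "map (mask (rows b m)) B = map (mask (rows b m)) C"
  then have "length (filter (\<lambda>z. z = None) (map (mask (rows b m)) B)) =
      length (filter (\<lambda>z. z = None) (map (mask (rows b m)) C))" by simp
  moreover have "length (filter (\<lambda>z. z = None) (map (mask (rows b m)) B)) = length (restr b m B)" for B
    by (induction B) (auto simp: restr_Cons mask_def)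
  ultimately show ?thesis by simp
qed

text \<open>A letter outside an interval has the whole interval on one side.\<close>

lemma descent_outside:
  assumes "rows b m x" "rows b m x'" "\<not> rows b m y"
  shows "descent ne x y = descent ne x' y" "descent ne y x = descent ne y x'"
  using assms by (auto simp: rows_def descent_def)

lemma descent_mask:
  assumes "mask (rows b m) x = mask (rows b m) x'" "mask (rows b m) y = mask (rows b m) y'"
    "\<not> (rows b m x \<and> rows b m y)"
  shows "descent ne x y = descent ne x' y'"
proof (cases "rows b m x")
  case True
  then have "rows b m x'" "\<not> rows b m y" "y' = y"
    using assms by (auto simp: mask_eq_iff split: if_splits)
  then show ?thesis using descent_outside(1) True by metis
next
  case False
  then have x: "x' = x" using assms(1) by (auto simp: mask_eq_iff split: if_splits)
  show ?thesis
  proof (cases "rows b m y")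
    case True
    then have "rows b m y'" using assms(2) by (auto simp: mask_eq_iff split: if_splits)
    then show ?thesis using descent_outside(2) True False x by metis
  next
    case False
    then have "y' = y" using assms(2) by (auto simp: mask_eq_iff split: if_splits)
    then show ?thesis using x by simp
  qed
qed

lemma descent_restr: "rows b m x \<Longrightarrow> rows b m y \<Longrightarrow> descent ne (x - b) (y - b) = descent ne x y"
  by (auto simp: rows_def descent_def)

text \<open>\<open>B\<close> is the word of the taller rectangle. Restricted to the rows of the
  wider one, it is the inner part of that rectangle's word, standing between \<open>A\<close> and
  \<open>D\<close> before the move of the first column and between \<open>X\<close> and
  \<open>Y\<close> afterwards. The first column has \<open>k\<close> units, so the inner part ends
  up \<open>k\<close> places further left.\<close>

locale column_move =
  fixes ne col :: bool and k b m :: nat and A D X Y :: "nat list"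
  assumes length_X: "length A = k + length X"
begin

abbreviation "msk \<equiv> map (mask (rows b m))"

definition wd :: "nat list \<Rightarrow> nat list" where "wd B = A @ restr b m B @ D"
definition wd' :: "nat list \<Rightarrow> nat list" where "wd' B = X @ restr b m B @ Y"

text \<open>The word \<open>wd' B'\<close> arises from \<open>wd B\<close> by moving the first k letters to the end, and
  B and B' differ only in the letters from the rows that are restricted to.\<close>

definition related :: "nat list \<Rightarrow> nat list \<Rightarrow> bool" where
  "related B B' \<longleftrightarrow> msk B = msk B' \<and> mset (wd B) = mset (wd' B') \<and>
     P_labels ne (wd B) = P_labels ne (wd' B') \<and> Theta_dom col k (Q_labels ne (wd B)) \<and>
     Q_labels ne (wd' B') = Theta col k (Q_labels ne (wd B))"

text \<open>The two letters are neighbours after restriction, so the comparison is a descent of the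
  Q words at corresponding places, and \<open>Theta\<close> preserves it.\<close>

lemma related_descent:
  assumes "related (U @ a # M @ c # V) (U' @ a' # M' @ c' # V')" "msk U = msk U'"
    and "rows b m a" "rows b m c" "rows b m a'" "rows b m c'" "restr b m M = []" "restr b m M' = []"
  shows "descent ne a c = descent ne a' c'"
proof -
  let ?B = "U @ a # M @ c # V" and ?B' = "U' @ a' # M' @ c' # V'"
  let ?i = "length X + length (restr b m U)"
  have len: "length (restr b m U') = length (restr b m U)" using length_restr_mask[OF assms(2)] by simp
  have B: "wd ?B = (A @ restr b m U) @ (a - b) # (c - b) # restr b m V @ D"
    and B': "wd' ?B' = (X @ restr b m U') @ (a' - b) # (c' - b) # restr b m V' @ Y"
    using assms(3-8) by (simp_all add: wd_def wd'_def restr_Cons)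
  have s: "Suc (k + ?i) < length (wd ?B)" by (simp add: B length_X)
  have s': "Suc ?i < length (wd' ?B')" by (simp add: B' len)
  have "descent ne (a' - b) (c' - b) \<longleftrightarrow> Q_labels ne (wd' ?B') ! ?i < Q_labels ne (wd' ?B') ! Suc ?i"
    using Q_labels_descent[OF s', of ne] by (simp add: B' nth_append len)
  also have "\<dots> \<longleftrightarrow> Q_labels ne (wd ?B) ! (k + ?i) < Q_labels ne (wd ?B) ! Suc (k + ?i)"
    using Theta_descent[of col k "Q_labels ne (wd ?B)" ?i] assms(1) s by (simp add: related_def)
  also have "\<dots> \<longleftrightarrow> descent ne (a - b) (c - b)"
    using Q_labels_descent[OF s, of ne] by (simp add: B nth_append length_X)
  finally show ?thesis using assms(3-6) descent_restr by metis
qed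

lemma related_split3:
  assumes "msk B = msk B'" "i + 2 < length B"
  obtains U a b' c V U' a' b'' c' V' where "B = U @ a # b' # c # V" "B' = U' @ a' # b'' # c' # V'"
    "length U = i" "length U' = i" "msk U = msk U'" "msk V = msk V'"
    "mask (rows b m) a = mask (rows b m) a'" "mask (rows b m) b' = mask (rows b m) b''"
    "mask (rows b m) c = mask (rows b m) c'"
proof -
  have len: "length B' = length B" using assms(1) by (metis length_map)
  obtain U a b' c V where B: "B = U @ a # b' # c # V" "length U = i"
    using assms(2) by (rule split3)
  obtain U' a' b'' c' V' where B': "B' = U' @ a' # b'' # c' # V'" "length U' = i"
    using assms(2) len by (metis split3)
  have "msk U = msk U' \<and> map (mask (rows b m)) (a # b' # c # V) = map (mask (rows b m)) (a' # b'' # c' # V')"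
    using assms(1) B B' by (simp add: append_eq_append_conv)
  then show thesis using that B B' by simp
qed

text \<open>If all three letters lie in the band, the restricted words undergo moves too, at places
  that differ by \<open>k\<close>, and \<open>Theta\<close> commutes with these. Otherwise
  \<open>B\<close> and \<open>B'\<close> have the same descents among the three letters, so the same
  positions are exchanged, and the restricted words stay as they are.\<close>

lemma related_mv:
  assumes "related B B'" "i + 2 < length B"
  shows "related (mv (descent ne) i B) (mv (descent ne) i B')"
proof -
  let ?J = "rows b m"
  have mB: "msk B = msk B'" using assms(1) by (simp add: related_def)
  obtain U x y z V U' x' y' z' V' where B: "B = U @ x # y # z # V" and B': "B' = U' @ x' # y' # z' # V'"
    and len: "length U = i" "length U' = i" and UV: "msk U = msk U'" "msk V = msk V'"
    and xyz: "mask ?J x = mask ?J x'" "mask ?J y = mask ?J y'" "mask ?J z = mask ?J z'"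
    using related_split3[OF mB assms(2)] by metis
  have J: "?J x' = ?J x" "?J y' = ?J y" "?J z' = ?J z"
    and nJ: "\<not> ?J x \<Longrightarrow> x' = x" "\<not> ?J y \<Longrightarrow> y' = y" "\<not> ?J z \<Longrightarrow> z' = z"
    using xyz by (auto simp: mask_eq_iff split: if_splits)
  have mvB: "mv (descent ne) i B = U @ mv3 (descent ne) x y z @ V"
    and mvB': "mv (descent ne) i B' = U' @ mv3 (descent ne) x' y' z' @ V'"
    using mv_append[of "descent ne" U x y z V] mv_append[of "descent ne" U' x' y' z' V'] len
    by (simp_all add: B B')
  have lenR: "length (restr b m U') = length (restr b m U)" using length_restr_mask[OF UV(1)] by simp
  show ?thesis
  proof (cases "?J x \<and> ?J y \<and> ?J z")
    case True
    then have J': "?J x'" "?J y'" "?J z'" using J by auto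
    have r3: "restr b m (mv3 (descent ne) x y z) = mv3 (descent ne) (x - b) (y - b) (z - b)"
      if "?J x" "?J y" "?J z" for x y z
      using that descent_restr by (auto simp: mv3_def restr_Cons)
    let ?i = "length X + length (restr b m U)"
    have W: "wd (mv (descent ne) i B) = mv (descent ne) (k + ?i) (wd B)"
      using mv_append[of "descent ne" "A @ restr b m U" "x - b" "y - b" "z - b" "restr b m V @ D"] True r3
      unfolding wd_def mvB unfolding B by (simp add: restr_Cons length_X add.assoc)
    have W': "wd' (mv (descent ne) i B') = mv (descent ne) ?i (wd' B')"
      using mv_append[of "descent ne" "X @ restr b m U'" "x' - b" "y' - b" "z' - b" "restr b m V' @ Y"] J' r3
      unfolding wd'_def mvB' unfolding B' by (simp add: restr_Cons lenR)
    have s: "k + ?i + 2 < length (Q_labels ne (wd B))"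
      using True by (simp add: wd_def B restr_Cons length_X)
    have "lattice (mv (<) (k + ?i) (Q_labels ne (wd B)))"
      by (simp add: lattice_Q_labels flip: Q_labels_mv)
    note T = Theta_mv[OF _ this s, of col]
    have "msk (mv3 (descent ne) x y z) = msk (mv3 (descent ne) x' y' z')"
      using True J' by (simp add: mv3_def mask_def)
    then have "msk (mv (descent ne) i B) = msk (mv (descent ne) i B')"
      using UV by (simp add: mvB mvB')
    then show ?thesis
      using assms(1) T unfolding related_def W W' mset_mv P_labels_mv Q_labels_mv by simp
  next
    case False
    have xy: "descent ne x y = descent ne x' y'"
    proof (cases "?J x \<and> ?J y")
      case True
      then show ?thesis
        using related_descent[of U x "[]" y "z # V" U' x' "[]" y' "z' # V'"] assms(1) UV J by (simp add: B B')
    qed (use descent_mask xyz in blast)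
    have yz: "descent ne y z = descent ne y' z'"
    proof (cases "?J y \<and> ?J z")
      case True
      then show ?thesis
        using related_descent[of "U @ [x]" y "[]" z V "U' @ [x']" y' "[]" z' V'] assms(1) UV J xyz by (simp add: B B')
    qed (use descent_mask xyz in blast)
    have xz: "descent ne x z = descent ne x' z'"
    proof (cases "?J x \<and> ?J z")
      case True
      then have "\<not> ?J y" using False by blast
      then show ?thesis
        using related_descent[of U x "[y]" z V U' x' "[y']" z' V'] assms(1) UV J True by (simp add: B B' restr_Cons)
    qed (use descent_mask xyz in blast)
    \<comment> \<open>Two letters of the band compare alike with a third one outside it, so they are
      never the pair that is exchanged.\<close>
    have keep: "restr b m (mv3 (descent ne) x y z) = restr b m [x, y, z]"
      if "\<not> (?J x \<and> ?J y \<and> ?J z)" for x y z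
    proof -
      consider "descent ne x y = descent ne y z" | "descent ne x y \<noteq> descent ne y z" "descent ne x y = descent ne x z"
        | "descent ne x y \<noteq> descent ne y z" "descent ne x y \<noteq> descent ne x z" by blast
      then show ?thesis
      proof cases
        case 1
        then show ?thesis by (simp add: mv3_def)
      next
        case 2
        then have "\<not> (?J x \<and> ?J y)" using that descent_outside by metis
        then show ?thesis using 2 by (auto simp: mv3_def restr_Cons)
      next
        case 3
        then have "\<not> (?J y \<and> ?J z)" using that descent_outside by metis
        then show ?thesis using 3 by (auto simp: mv3_def restr_Cons)
      qed
    qed
    have "msk (mv3 (descent ne) x y z) = msk (mv3 (descent ne) x' y' z')"
      using xyz by (simp add: mv3_def xy yz xz)
    then have "msk (mv (descent ne) i B) = msk (mv (descent ne) i B')"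
      using UV by (simp add: mvB mvB')
    moreover have "wd (mv (descent ne) i B) = wd B" "wd' (mv (descent ne) i B') = wd' B'"
      using keep[of x y z] keep[of x' y' z'] False J
      by (simp_all add: wd_def wd'_def mvB mvB') (simp_all add: B B' restr_Cons)
    ultimately show ?thesis using assms(1) by (simp add: related_def)
  qed
qed

lemma related_mvs: "related B B' \<Longrightarrow> within \<sigma> (length B) \<Longrightarrow> related (mvs (descent ne) \<sigma> B) (mvs (descent ne) \<sigma> B')"
  by (induction \<sigma> arbitrary: B B') (simp_all add: related_mv)

lemma related_consecutive:
  assumes "related B B'" "Suc i < length B"
  shows "descent ne (B ! i) (B ! Suc i) = descent ne (B' ! i) (B' ! Suc i)"
proof -
  let ?J = "rows b m"
  have mB: "msk B = msk B'" using assms(1) by (simp add: related_def)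
  then have len: "length B' = length B" by (metis length_map)
  have split: "C = take i C @ C ! i # C ! Suc i # drop (Suc (Suc i)) C" if "length C = length B" for C
    using that assms(2) by (simp add: Cons_nth_drop_Suc)
  have nth: "mask ?J (B ! j) = mask ?J (B' ! j)" if "j < length B" for j
    using arg_cong[OF mB, of "\<lambda>l. l ! j"] that len by simp
  show ?thesis
  proof (cases "?J (B ! i) \<and> ?J (B ! Suc i)")
    case True
    have "?J (B' ! i)" "?J (B' ! Suc i)"
      using True nth[of i] nth[of "Suc i"] assms(2) by (auto simp: mask_eq_iff split: if_splits)
    moreover have "msk (take i B) = msk (take i B')" using mB by (metis take_map)
    moreover have "related (take i B @ B ! i # [] @ B ! Suc i # drop (Suc (Suc i)) B)
        (take i B' @ B' ! i # [] @ B' ! Suc i # drop (Suc (Suc i)) B')"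
      using assms(1) split[of B] split[of B'] len by simp
    ultimately show ?thesis
      using True related_descent[of "take i B" "B ! i" "[]" "B ! Suc i" "drop (Suc (Suc i)) B"
          "take i B'" "B' ! i" "[]" "B' ! Suc i" "drop (Suc (Suc i)) B'"] by simp
  next
    case False
    then show ?thesis using nth[of i] nth[of "Suc i"] assms(2) by (intro descent_mask) simp_all
  qed
qed

lemma related_Q_labels:
  assumes "related B B'"
  shows "Q_labels ne B = Q_labels ne B'"
proof (rule lattice_eqI)
  have len: "length B = length B'" using assms unfolding related_def by (metis length_map)
  then show "length (Q_labels ne B) = length (Q_labels ne B')" by simp
  fix \<sigma> i assume \<sigma>: "within \<sigma> (length (Q_labels ne B))" "Suc i < length (Q_labels ne B)"
  have "related (mvs (descent ne) \<sigma> B) (mvs (descent ne) \<sigma> B')"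
    using \<sigma> by (intro related_mvs assms) simp
  then show "(mvs (<) \<sigma> (Q_labels ne B) ! i < mvs (<) \<sigma> (Q_labels ne B) ! Suc i) =
      (mvs (<) \<sigma> (Q_labels ne B') ! i < mvs (<) \<sigma> (Q_labels ne B') ! Suc i)"
    using \<sigma> len Q_labels_descent[of i "mvs (descent ne) \<sigma> B" ne] Q_labels_descent[of i "mvs (descent ne) \<sigma> B'" ne]
      related_consecutive[of "mvs (descent ne) \<sigma> B" "mvs (descent ne) \<sigma> B'" i]
    by (simp add: Q_labels_mvs)
qed (simp_all add: lattice_Q_labels)

end

section \<open>Two rectangles\<close>

lemma word_add: "word v (p + q) m F = word v p m F @ word v q m (\<lambda>i. F (p + i))"
  by (induction q) (simp_all add: word_Suc)

lemma col_word_cong: "(\<And>y. y < m \<Longrightarrow> f y = g y) \<Longrightarrow> col_word v m f = col_word v m g"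
  unfolding col_word_def by (intro arg_cong[of _ _ concat] map_cong) (auto split: if_splits)

lemma word_cong: "(\<And>x y. x < n \<Longrightarrow> y < m \<Longrightarrow> F x y = G x y) \<Longrightarrow> word v n m F = word v n m G"
  unfolding word_def by (intro arg_cong[of _ _ concat] map_cong refl col_word_cong) simp

lemma column_start_Suc: "column_start m F (Suc x) = column_start m F x + (\<Sum>y<m. F x y)"
  by (simp add: column_start_def)

lemma column_start_cong: "(\<And>x'. x' < x \<Longrightarrow> (\<Sum>y<m. F x' y) = (\<Sum>y<m. G x' y)) \<Longrightarrow> column_start m F x = column_start m G x"
  by (simp add: column_start_def)

lemma upt_three: "b + m \<le> m' \<Longrightarrow> [0..<m'] = [0..<b] @ map (\<lambda>j. b + j) [0..<m] @ [b + m..<m']"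
proof -
  assume "b + m \<le> m'"
  then have "[0..<m'] = [0..<b] @ [b..<b + m] @ [b + m..<m']"
    using upt_add_eq_append[of 0 b "m' - b"] upt_add_eq_append[of b "b + m" "m' - (b + m)"] by simp
  moreover have "[b..<b + m] = map (\<lambda>j. b + j) [0..<m]"
    using map_add_upt[of b m] by (simp add: add.commute)
  ultimately show ?thesis by simp
qed

lemma restr_concat: "restr b m (concat ws) = concat (map (restr b m) ws)"
  by (induction ws) simp_all

lemma restr_replicate: "restr b m (replicate n y) = (if rows b m y then replicate n (y - b) else [])"
  by (induction n) (auto simp: restr_Cons)

lemma restr_col_word:
  assumes "b + m \<le> m'"
  shows "restr b m (col_word v m' f) = col_word v m (\<lambda>j. f (b + j))"
proof -
  let ?g = "\<lambda>y. restr b m (replicate (f y) y)"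
  have out: "concat (map ?g ys) = []" if "\<forall>y\<in>set ys. \<not> rows b m y" for ys
    using that by (simp add: restr_replicate)
  have inn: "?g (b + j) = replicate (f (b + j)) j" if "j < m" for j
    using that by (simp add: restr_replicate rows_def)
  have e: "concat (map ?g [0..<b]) = []" "concat (map ?g [b + m..<m']) = []"
    "concat (map ?g (rev [0..<b])) = []" "concat (map ?g (rev [b + m..<m'])) = []"
    by (auto simp: rows_def restr_replicate)
  have f: "map (\<lambda>j. ?g (b + j)) [0..<m] = map (\<lambda>j. replicate (f (b + j)) j) [0..<m]"
    "map (\<lambda>j. ?g (b + j)) (rev [0..<m]) = map (\<lambda>j. replicate (f (b + j)) j) (rev [0..<m])"
    using inn by (auto intro!: map_cong)
  show ?thesis
  proof (cases "column_NE v")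
    case True
    then show ?thesis
      unfolding col_word_def upt_three[OF assms] if_P[OF True] map_append concat_append restr_append
        restr_concat map_map comp_def e f by simp
  next
    case False
    then show ?thesis
      unfolding col_word_def upt_three[OF assms] if_not_P[OF False] rev_append rev_map
        map_append concat_append restr_append restr_concat map_map comp_def e f by simp
  qed
qed

lemma restr_word:
  "b + m \<le> m' \<Longrightarrow> restr b m (word v n m' F) = word v n m (\<lambda>i j. F i (b + j))"
  by (induction n) (simp_all add: word_Suc restr_col_word)

text \<open>In the word of a column the letters of the band are contiguous, so after masking only
  their number is visible.\<close>

lemma mask_col_word:
  assumes "b + m \<le> m'" "\<And>y. y < m' \<Longrightarrow> \<not> rows b m y \<Longrightarrow> f y = g y" "(\<Sum>j<m. f (b + j)) = (\<Sum>j<m. g (b + j))"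
  shows "map (mask (rows b m)) (col_word v m' f) = map (mask (rows b m)) (col_word v m' g)"
proof -
  let ?h = "\<lambda>f y. replicate (f y) (mask (rows b m) y)"
  have h: "map (mask (rows b m)) (concat (map (\<lambda>y. replicate (f y) y) ys)) = concat (map (?h f) ys)" for f ys
    by (simp add: map_concat comp_def)
  have up: "concat (map (?h f) (map (\<lambda>j. b + j) [0..<n])) = replicate (\<Sum>j<n. f (b + j)) None"
    and down: "concat (map (?h f) (rev (map (\<lambda>j. b + j) [0..<n]))) = replicate (\<Sum>j<n. f (b + j)) None"
    if "n \<le> m" for n f
    using that by (induction n) (auto simp: mask_def rows_def add.commute simp flip: replicate_add)
  have out: "map (?h f) ys = map (?h g) ys" if "\<forall>y\<in>set ys. y < m' \<and> \<not> rows b m y" for ys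
    using that assms(2) by (auto intro!: map_cong)
  have e: "map (?h f) [0..<b] = map (?h g) [0..<b]" "map (?h f) [b + m..<m'] = map (?h g) [b + m..<m']"
    using assms(1) out[of "[0..<b]"] out[of "[b + m..<m']"] by (force simp: rows_def)+
  show ?thesis
  proof (cases "column_NE v")
    case True
    then show ?thesis
      unfolding col_word_def h upt_three[OF assms(1)] if_P[OF True] map_append concat_append
        up[OF order.refl] e assms(3) by simp
  next
    case False
    then show ?thesis
      unfolding col_word_def h upt_three[OF assms(1)] if_not_P[OF False] rev_append map_append concat_append
        down[OF order.refl] assms(3)
      unfolding rev_map[symmetric] e by simp
  qed
qed

lemma mask_word:
  assumes "b + m \<le> m'" "\<And>i y. i < n \<Longrightarrow> y < m' \<Longrightarrow> \<not> rows b m y \<Longrightarrow> F i y = G i y"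
    "\<And>i. i < n \<Longrightarrow> (\<Sum>j<m. F i (b + j)) = (\<Sum>j<m. G i (b + j))"
  shows "map (mask (rows b m)) (word v n m' F) = map (mask (rows b m)) (word v n m' G)"
  unfolding word_def map_concat map_map comp_def
  by (intro arg_cong[of _ _ concat] map_cong refl mask_col_word[OF assms(1)] assms(2,3)) simp_all

lemma mask_col_wordD:
  assumes "map (mask (rows b m)) (col_word v m' f) = map (mask (rows b m)) (col_word v m' g)" "b + m \<le> m'"
  shows "(\<Sum>j<m. f (b + j)) = (\<Sum>j<m. g (b + j))" "y < m' \<Longrightarrow> \<not> rows b m y \<Longrightarrow> f y = g y"
proof -
  show "(\<Sum>j<m. f (b + j)) = (\<Sum>j<m. g (b + j))"
    using length_restr_mask[OF assms(1)] by (simp add: restr_col_word[OF assms(2)] length_col_word)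
  have c: "count (mset (map (mask (rows b m)) w)) (Some y) = count (mset w) y" if "\<not> rows b m y" for w y
    using that by (induction w) (auto simp: mask_def)
  assume "y < m'" "\<not> rows b m y"
  then show "f y = g y"
    using c[of y "col_word v m' f"] c[of y "col_word v m' g"] assms(1) by (simp add: count_col_word)
qed

section \<open>The map \<open>j_bar\<close> as a sequence of moves\<close>

lemma j_bar_moves:
  assumes "rect_filling v n m F" "0 < n"
  obtains \<sigma> where "within \<sigma> (length (word v n m F))"
    "mvs (<) \<sigma> (Q_labels (row_NE v) (word v n m F)) =
      Theta (column_NE v) (column_start m F 1) (Q_labels (row_NE v) (word v n m F))"
proof -
  let ?\<alpha> = "Q_labels (row_NE v) (word v n m F)"
  have dom: "Theta_dom (column_NE v) (column_start m F 1) ?\<alpha>"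
    by (rule Theta_dom_blocks[OF blocks_word[OF assms(1)] lattice_Q_labels assms(2)])
  show thesis
    using lattice_connected[OF lattice_Q_labels Theta_lattice(1)[OF dom] Theta_lattice(2)[OF dom, symmetric]] that
    by (metis length_Q_labels)
qed

lemma j_bar_rect:
  assumes "rect_filling v n m F" "0 < n"
  shows "rect_filling v n m (j_bar v n m F)"
  using j_bar_moves[OF assms] j_bar_word(1)[OF assms] by metis

lemma j_bar_column_sum:
  assumes "rect_filling v n m F" "Suc x < n"
  shows "(\<Sum>y<m. j_bar v n m F x y) = (\<Sum>y<m. F (Suc x) y)"
proof -
  have n: "0 < n" using assms(2) by simp
  have c: "column_start m (j_bar v n m F) x = shift_blocks n (column_start m F) x" if "x \<le> n" for x
    using j_bar_moves[OF assms(1) n] j_bar_word(3)[OF assms(1) n _ that] by metis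
  have "column_start m (j_bar v n m F) (Suc x) - column_start m (j_bar v n m F) x =
      column_start m F (Suc (Suc x)) - column_start m F (Suc x)"
    using c[of x] c[of "Suc x"] column_start_mono[of 1 "Suc x" m F] assms(2)
    by (simp add: shift_blocks_def)
  then show ?thesis by (simp add: column_start_Suc)
qed

text \<open>\<open>F\<close> fills the wider rectangle and \<open>F'\<close> the taller one. The
  columns of \<open>F'\<close> are the columns \<open>a, ..., a + n' - 1\<close> of
  \<open>F\<close>, and the rows of \<open>F\<close> are the rows \<open>b, ..., b + m - 1\<close>
  of \<open>F'\<close>. As \<open>0 < a\<close>, the column that \<open>F\<close> moves is not in
  the overlap.\<close>

locale two_rectangles =
  fixes v :: variant and n m n' m' a b :: nat and F F' :: "nat \<Rightarrow> nat \<Rightarrow> nat"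
  assumes F: "rect_filling v n m F" and F': "rect_filling v n' m' F'"
    and a: "0 < a" "a + n' \<le> n" and n': "0 < n'" and b: "b + m \<le> m'"
    and overlap: "\<And>i j. i < n' \<Longrightarrow> j < m \<Longrightarrow> F (a + i) j = F' i (b + j)"
begin

definition G where "G = j_bar v n m F"
definition G' where "G' = j_bar v n' m' F'"

text \<open>\<open>G\<close> and \<open>G'\<close> are the two rectangles after their own moves, \<open>F2\<close> and \<open>F2'\<close> after the move of the
  other one, \<open>H\<close> and \<open>H'\<close> after both; the rectangle of \<open>F'\<close> has been shifted by one column in \<open>G\<close>.\<close>

definition F2 where "F2 x j = (if a \<le> x \<and> x < a + n' \<and> j < m then G' (x - a) (b + j) else F x j)"
definition F2' where "F2' i y = (if i < n' \<and> rows b m y then G (a - 1 + i) (y - b) else F' i y)"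

definition H where "H = j_bar v n m F2"
definition H' where "H' = j_bar v n' m' F2'"

text \<open>The wider rectangle when it is moved first and the taller one second. The order reversed
  gives \<open>H\<close>, so the goal is \<open>H = K\<close>.\<close>

definition K where
  "K x j = (if a - 1 \<le> x \<and> x < a - 1 + n' \<and> j < m then H' (x - (a - 1)) (b + j) else G x j)"

text \<open>The pieces of the word of the wider rectangle on both sides of the overlap:
  \<open>p\<close> and \<open>s\<close> before its move, \<open>q\<close> and \<open>t\<close> after
  it.\<close>

definition p where "p = word v a m F"
definition s where "s = word v (n - a - n') m (\<lambda>i. F (a + n' + i))"
definition q where "q = word v (a - 1) m G"
definition t where "t = word v (Suc (n - a - n')) m (\<lambda>i. G (a - 1 + n' + i))"

lemma rects:
  "rect_filling v n m G" "rect_filling v n' m' G'" "rect_filling v n m F2" "rect_filling v n' m' F2'"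
  "rect_filling v n m H" "rect_filling v n' m' H'" "rect_filling v n m K"
proof -
  show G: "rect_filling v n m G" unfolding G_def using F a n' by (intro j_bar_rect) auto
  show G': "rect_filling v n' m' G'" unfolding G'_def using F' n' by (intro j_bar_rect) auto
  show F2: "rect_filling v n m F2" using F G' a by (auto simp: rect_filling_def F2_def)
  show F2': "rect_filling v n' m' F2'" using F' G b by (auto simp: rect_filling_def F2'_def rows_def)
  show "rect_filling v n m H" unfolding H_def using F2 a n' by (intro j_bar_rect) auto
  show H': "rect_filling v n' m' H'" unfolding H'_def using F2' n' by (intro j_bar_rect) auto
  show "rect_filling v n m K" using G H' a by (auto simp: rect_filling_def K_def)
qed

lemma words:
  "word v n m F = p @ restr b m (word v n' m' F') @ s"
  "word v n m G = q @ restr b m (word v n' m' F2') @ t"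
  "word v n m F2 = p @ restr b m (word v n' m' G') @ s"
  "word v n m K = q @ restr b m (word v n' m' H') @ t"
proof -
  have split: "word v n m f = word v x m f @ word v n' m (\<lambda>i. f (x + i)) @ word v (n - x - n') m (\<lambda>i. f (x + n' + i))"
    if "x \<le> a" for f x
    using word_add[of v "x + n'" "n - x - n'" m f] word_add[of v x n' m f] a that by simp
  have n1: "n - (a - 1) - n' = Suc (n - a - n')" using a by simp
  show "word v n m F = p @ restr b m (word v n' m' F') @ s"
    unfolding split[of a F, OF order.refl] restr_word[OF b] p_def s_def
    by (intro arg_cong2[of _ _ _ _ append] word_cong refl) (simp_all add: overlap)
  show "word v n m F2 = p @ restr b m (word v n' m' G') @ s"
    unfolding split[of a F2, OF order.refl] restr_word[OF b] p_def s_def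
    by (intro arg_cong2[of _ _ _ _ append] word_cong refl) (simp_all add: F2_def)
  show "word v n m G = q @ restr b m (word v n' m' F2') @ t"
    unfolding split[of "a - 1" G, OF diff_le_self] restr_word[OF b] q_def t_def n1
    by (intro arg_cong2[of _ _ _ _ append] word_cong refl) (simp_all add: F2'_def rows_def)
  show "word v n m K = q @ restr b m (word v n' m' H') @ t"
    unfolding split[of "a - 1" K, OF diff_le_self] restr_word[OF b] q_def t_def n1
    by (intro arg_cong2[of _ _ _ _ append] word_cong refl) (simp_all add: K_def)
qed

text \<open>The move shifts the column sums of the wider rectangle by one place to the left, and the
  overlap is shifted in the same way.\<close>

lemma column_sums: "i < n' \<Longrightarrow> (\<Sum>j<m. F' i (b + j)) = (\<Sum>j<m. F2' i (b + j))"
proof -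
  assume i: "i < n'"
  then have "(\<Sum>j<m. F2' i (b + j)) = (\<Sum>j<m. G (a - 1 + i) j)" by (simp add: F2'_def rows_def)
  also have "\<dots> = (\<Sum>j<m. F (a + i) j)"
    unfolding G_def using j_bar_column_sum[OF F, of "a - 1 + i"] a i by simp
  finally show ?thesis using i by (simp add: overlap)
qed

lemma column_start_F2': "x \<le> n' \<Longrightarrow> column_start m' F2' x = column_start m' F' x"
proof (rule column_start_cong)
  fix i assume "x \<le> n'" "i < x"
  then have "i < n'" by simp
  then have "map (mask (rows b m)) (col_word v m' (F' i)) = map (mask (rows b m)) (col_word v m' (F2' i))"
    using column_sums by (intro mask_col_word[OF b]) (simp_all add: F2'_def)
  then show "(\<Sum>y<m'. F2' i y) = (\<Sum>y<m'. F' i y)"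
    using length_col_word by (metis length_map)
qed

sublocale column_move "row_NE v" "column_NE v" "column_start m F 1" b m p s q t
proof
  have "0 < n" using a n' by simp
  then have "column_start m G (a - 1) = shift_blocks n (column_start m F) (a - 1)"
    unfolding G_def using j_bar_moves[OF F] j_bar_word(3)[OF F] a
    by (metis diff_le_self le_add1 le_trans)
  moreover have "a - 1 < n" using a n' by simp
  ultimately show "length p = column_start m F 1 + length q"
    using column_start_mono[of 1 a m F] a by (simp add: p_def q_def length_word shift_blocks_def)
qed

lemma related_start: "related (word v n' m' F') (word v n' m' F2')"
proof -
  let ?r = "row_NE v"
  have n: "0 < n" using a n' by simp
  obtain \<sigma> where \<sigma>: "mvs (<) \<sigma> (Q_labels ?r (word v n m F)) =
      Theta (column_NE v) (column_start m F 1) (Q_labels ?r (word v n m F))"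
    using j_bar_moves[OF F n] by metis
  have G: "word v n m G = mvs (descent ?r) \<sigma> (word v n m F)"
    unfolding G_def by (rule j_bar_word(2)[OF F n \<sigma>])
  have w: "wd (word v n' m' F') = word v n m F" "wd' (word v n' m' F2') = word v n m G"
    by (simp_all add: wd_def wd'_def words)
  have "map (mask (rows b m)) (word v n' m' F') = map (mask (rows b m)) (word v n' m' F2')"
    using column_sums by (intro mask_word[OF b]) (simp_all add: F2'_def)
  then show ?thesis
    unfolding related_def w G
    using \<sigma> Theta_dom_blocks[OF blocks_word[OF F] lattice_Q_labels n]
    by (simp add: P_labels_mvs Q_labels_mvs)
qed

lemma related_end: "related (word v n' m' G') (word v n' m' H')"
proof -
  let ?r = "row_NE v"
  obtain \<sigma> where \<sigma>: "within \<sigma> (length (word v n' m' F'))" "mvs (<) \<sigma> (Q_labels ?r (word v n' m' F')) =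
      Theta (column_NE v) (column_start m' F' 1) (Q_labels ?r (word v n' m' F'))"
    using j_bar_moves[OF F' n'] by metis
  \<comment> \<open>The image under \<open>Theta\<close> depends on the Q word and on the number of
    units in the first column, so both have to agree.\<close>
  have "column_start m' F2' 1 = column_start m' F' 1" using n' by (intro column_start_F2') simp
  then have \<sigma>': "mvs (<) \<sigma> (Q_labels ?r (word v n' m' F2')) =
      Theta (column_NE v) (column_start m' F2' 1) (Q_labels ?r (word v n' m' F2'))"
    using \<sigma>(2) related_Q_labels[OF related_start] by simp
  have "word v n' m' G' = mvs (descent ?r) \<sigma> (word v n' m' F')"
    "word v n' m' H' = mvs (descent ?r) \<sigma> (word v n' m' F2')"
    unfolding G'_def H'_def
    using j_bar_word(2)[OF F' n' \<sigma>(2)] j_bar_word(2)[OF rects(4) n' \<sigma>'] by simp_all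
  then show ?thesis using related_mvs[OF related_start \<sigma>(1)] by simp
qed

text \<open>By \<open>related_end\<close>, the word of \<open>K\<close> has the content and the P
  labels of the word of \<open>F2\<close>, and \<open>Theta\<close> of its Q labels. These data
  characterise the word of \<open>H\<close>.\<close>

lemma word_H: "word v n m H = word v n m K"
proof -
  let ?r = "row_NE v"
  have n: "0 < n" using a n' by simp
  have w: "wd (word v n' m' G') = word v n m F2" "wd' (word v n' m' H') = word v n m K"
    by (simp_all add: wd_def wd'_def words)
  obtain \<sigma> where \<sigma>: "mvs (<) \<sigma> (Q_labels ?r (word v n m F2)) =
      Theta (column_NE v) (column_start m F2 1) (Q_labels ?r (word v n m F2))"
    using j_bar_moves[OF rects(3) n] by metis
  have H: "word v n m H = mvs (descent ?r) \<sigma> (word v n m F2)"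
    unfolding H_def by (rule j_bar_word(2)[OF rects(3) n \<sigma>])
  have k: "column_start m F2 1 = column_start m F 1"
    using a by (intro column_start_cong) (simp add: F2_def)
  have r: "mset (word v n m F2) = mset (word v n m K)"
    "P_labels ?r (word v n m F2) = P_labels ?r (word v n m K)"
    "Q_labels ?r (word v n m K) = Theta (column_NE v) (column_start m F 1) (Q_labels ?r (word v n m F2))"
    using related_end unfolding related_def w by blast+
  show ?thesis
    unfolding H
  proof (rule labels_eqD)
    show "mset (mvs (descent ?r) \<sigma> (word v n m F2)) = mset (word v n m K)"
      unfolding mset_mvs by (rule r(1))
    show "Q_labels ?r (mvs (descent ?r) \<sigma> (word v n m F2)) = Q_labels ?r (word v n m K)"
      unfolding Q_labels_mvs \<sigma> k r(3) ..
    show "P_labels ?r (mvs (descent ?r) \<sigma> (word v n m F2)) j = P_labels ?r (word v n m K) j" for j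
      unfolding P_labels_mvs r(2) ..
  qed
qed

text \<open>The words of \<open>G'\<close> and \<open>H'\<close> have the same mask and the same
  cuts, so their masks agree column by column.\<close>

lemma mask_columns:
  assumes "i < n'"
  shows "map (mask (rows b m)) (col_word v m' (G' i)) = map (mask (rows b m)) (col_word v m' (H' i))"
proof -
  have c: "column_start m' G' x = column_start m' H' x" if "x \<le> n'" for x
  proof -
    have "column_start m' G' x = shift_blocks n' (column_start m' F') x"
      unfolding G'_def using j_bar_moves[OF F' n'] j_bar_word(3)[OF F' n' _ that] by metis
    moreover have "column_start m' H' x = shift_blocks n' (column_start m' F2') x"
      unfolding H'_def using j_bar_moves[OF rects(4) n'] j_bar_word(3)[OF rects(4) n' _ that] by metis
    moreover have "shift_blocks n' (column_start m' F2') x = shift_blocks n' (column_start m' F') x"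
      using that n' by (auto simp: shift_blocks_def column_start_F2')
    ultimately show ?thesis by simp
  qed
  have "map (mask (rows b m)) (word v n' m' G') = map (mask (rows b m)) (word v n' m' H')"
    using related_end unfolding related_def by blast
  then have e: "map (mask (rows b m)) (take l (drop k (word v n' m' G'))) =
      map (mask (rows b m)) (take l (drop k (word v n' m' H')))" for k l
    by (simp only: take_map[symmetric] drop_map[symmetric])
  have "i \<le> n'" "Suc i \<le> n'" using assms by simp_all
  note ci = c[OF this(1)] c[OF this(2)]
  show ?thesis
    unfolding word_block[OF assms, where m = m' and F = G' and v = v, symmetric]
      word_block[OF assms, where m = m' and F = H' and v = v, symmetric] ci
    by (rule e)
qed

lemma H_eq_K: "H = K"
proof -
  have n: "0 < n" using a n' by simp
  have c: "column_start m H x = column_start m K x" if "x \<le> n" for x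
  proof (cases "x = n")
    case True
    \<comment> \<open>The lemma \<open>j_bar_column_sum\<close> does not reach the last column, but
      the last cut is the length of the word.\<close>
    then show ?thesis using word_H length_word by metis
  next
    case False
    show ?thesis
    proof (rule column_start_cong)
      fix x' assume x': "x' < x"
      then have "Suc x' < n" using that False by simp
      then have "(\<Sum>y<m. H x' y) = (\<Sum>y<m. F2 (Suc x') y)"
        unfolding H_def by (rule j_bar_column_sum[OF rects(3)])
      also have "\<dots> = (\<Sum>y<m. K x' y)"
      proof (cases "a - 1 \<le> x' \<and> x' < a - 1 + n'")
        case True
        then obtain i where i: "x' = a - 1 + i" "i < n'" by (metis le_add_diff_inverse nat_add_left_cancel_less)
        then have "(\<Sum>y<m. F2 (Suc x') y) = (\<Sum>y<m. G' i (b + y))" using a by (simp add: F2_def)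
        also have "\<dots> = (\<Sum>y<m. H' i (b + y))" by (rule mask_col_wordD(1)[OF mask_columns[OF i(2)] b])
        also have "\<dots> = (\<Sum>y<m. K x' y)" using i by (simp add: K_def)
        finally show ?thesis .
      next
        case False
        then have "\<not> (a \<le> Suc x' \<and> Suc x' < a + n')" using a by linarith
        then have "(\<Sum>y<m. F2 (Suc x') y) = (\<Sum>y<m. F (Suc x') y)"
          by (intro sum.cong) (auto simp: F2_def)
        also have "\<dots> = (\<Sum>y<m. G x' y)" unfolding G_def by (rule j_bar_column_sum[OF F \<open>Suc x' < n\<close>, symmetric])
        also have "\<dots> = (\<Sum>y<m. K x' y)" using False by (auto simp: K_def intro: sum.cong)
        finally show ?thesis .
      qed
      finally show "(\<Sum>y<m. H x' y) = (\<Sum>y<m. K x' y)" .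
    qed
  qed
  have "H = filling_of n m (column_start m K) (word v n m H)"
    using filling_of_word_inverse[OF rects(5)] c by metis
  also have "\<dots> = filling_of n m (column_start m K) (word v n m K)"
    unfolding word_H ..
  also have "\<dots> = K" by (rule filling_of_word_inverse[OF rects(7) refl])
  finally show ?thesis .
qed

text \<open>These three lemmas compare the two orders cell by cell: in the overlap, beside it in the
  wider rectangle, and above or below it in the taller one.\<close>

lemma commute_inside: "i < n' \<Longrightarrow> j < m \<Longrightarrow> H' i (b + j) = H (a - 1 + i) j"
  by (simp add: H_eq_K K_def)

lemma commute_right: "\<not> (a - 1 \<le> x \<and> x < a - 1 + n') \<Longrightarrow> H x j = G x j"
  by (auto simp: H_eq_K K_def)

lemma commute_above: "i < n' \<Longrightarrow> \<not> rows b m y \<Longrightarrow> H' i y = G' i y"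
proof (cases "y < m'")
  case True
  assume "i < n'" "\<not> rows b m y"
  then show ?thesis using mask_col_wordD(2)[OF mask_columns b True] by simp
next
  case False
  then show ?thesis using rects(2,6) by (auto simp: rect_filling_def)
qed

end

section \<open>Columns of moon polyominoes\<close>

text \<open>The conditions concern only the row sets of columns, so they can be checked for the
  cells after a move as well.\<close>

lemma last_column_eqI:
  assumes "c \<le> e" "\<And>x. c \<le> x \<Longrightarrow> x \<le> e \<Longrightarrow> col_rows M c \<subseteq> col_rows M x"
    and "\<not> col_rows M c \<subseteq> col_rows M (e + 1)"
  shows "last_column M c = e"
proof -
  have sub: "{c..e'} \<times> col_rows M c \<subseteq> M \<longleftrightarrow> (\<forall>x. c \<le> x \<longrightarrow> x \<le> e' \<longrightarrow> col_rows M c \<subseteq> col_rows M x)" for e'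
    by (auto simp: col_rows_def)
  have "{e'. c \<le> e' \<and> {c..e'} \<times> col_rows M c \<subseteq> M} = {c..e}"
  proof (intro equalityI subsetI)
    fix e' assume "e' \<in> {e'. c \<le> e' \<and> {c..e'} \<times> col_rows M c \<subseteq> M}"
    then have e': "c \<le> e'" "\<forall>x. c \<le> x \<longrightarrow> x \<le> e' \<longrightarrow> col_rows M c \<subseteq> col_rows M x" by (simp_all add: sub)
    then have "\<not> e + 1 \<le> e'" using assms(1,3) e'(2)[rule_format, of "e + 1"] by linarith
    then show "e' \<in> {c..e}" using e'(1) by simp
  next
    fix e' assume "e' \<in> {c..e}"
    then show "e' \<in> {e'. c \<le> e' \<and> {c..e'} \<times> col_rows M c \<subseteq> M}"
      using assms(2) unfolding mem_Collect_eq sub by auto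
  qed
  moreover have "Max {c..e} = e" using assms(1) by (intro Max_eqI) simp_all
  ultimately show ?thesis by (simp add: last_column_def)
qed

text \<open>By convexity of the rows, the columns from \<open>c\<close> onwards that contain all
  rows of \<open>c\<close> are contiguous.\<close>

lemma moon_last_column:
  assumes "moon_polyomino M" "col_rows M c \<noteq> {}"
  shows "c \<le> last_column M c"
    and "c \<le> x \<Longrightarrow> col_rows M c \<subseteq> col_rows M x \<longleftrightarrow> x \<le> last_column M c"
proof -
  have fin: "finite M" and row: "\<And>x1 x x2 y. (x1, y) \<in> M \<Longrightarrow> (x2, y) \<in> M \<Longrightarrow> x1 \<le> x \<Longrightarrow> x \<le> x2 \<Longrightarrow> (x, y) \<in> M"
    using assms(1) unfolding moon_polyomino_def by blast+
  obtain y where y: "y \<in> col_rows M c" using assms(2) by blast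
  let ?E = "{e. c \<le> e \<and> col_rows M c \<subseteq> col_rows M e}"
  have finE: "finite ?E"
  proof (rule finite_subset)
    show "?E \<subseteq> fst ` M" using y by (force simp: col_rows_def)
  qed (use fin in simp)
  have cE: "c \<in> ?E" by simp
  define e where "e = Max ?E"
  have e: "e \<in> ?E" unfolding e_def using finE cE by (intro Max_in) auto
  have below: "col_rows M c \<subseteq> col_rows M x" if "c \<le> x" "x \<le> e" for x
    using row[of c _ e x] e that by (auto simp: col_rows_def)
  have above: "\<not> col_rows M c \<subseteq> col_rows M x" if "e < x" for x
  proof
    assume "col_rows M c \<subseteq> col_rows M x"
    then have "x \<in> ?E" using e that by simp
    then have "x \<le> e" unfolding e_def using finE by (rule Max_ge[rotated])
    then show False using that by simp
  qed
  have l: "last_column M c = e" using e below above[of "e + 1"] by (intro last_column_eqI) auto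
  show "c \<le> last_column M c" using e by (simp add: l)
  show "c \<le> x \<Longrightarrow> col_rows M c \<subseteq> col_rows M x \<longleftrightarrow> x \<le> last_column M c"
    using below above by (metis l not_le)
qed

lemma moon_col_rows_interval:
  assumes "moon_polyomino M" "col_rows M c \<noteq> {}"
  shows "col_rows M c = {Min (col_rows M c)..<Min (col_rows M c) + int (card (col_rows M c))}"
proof -
  let ?A = "col_rows M c"
  have "?A \<subseteq> snd ` M" by (force simp: col_rows_def)
  moreover have "finite M" using assms(1) unfolding moon_polyomino_def by blast
  ultimately have fin: "finite ?A" by (rule finite_subset[OF _ finite_imageI])
  have conv: "y \<in> ?A" if "y1 \<in> ?A" "y2 \<in> ?A" "y1 \<le> y" "y \<le> y2" for y1 y y2
    using assms(1) that unfolding moon_polyomino_def col_rows_def by blast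
  define lo hi where "lo = Min ?A" and "hi = Max ?A"
  have lh: "lo \<in> ?A" "hi \<in> ?A"
    unfolding lo_def hi_def using Min_in[OF fin assms(2)] Max_in[OF fin assms(2)] by blast+
  have bounds: "lo \<le> y" "y \<le> hi" if "y \<in> ?A" for y
    unfolding lo_def hi_def using Min_le[OF fin that] Max_ge[OF fin that] by blast+
  have A: "?A = {lo..hi}"
  proof (intro equalityI subsetI)
    fix y assume "y \<in> {lo..hi}"
    then show "y \<in> ?A" by (intro conv[OF lh]) simp_all
  qed (simp add: bounds)
  have "lo \<le> hi" using lh bounds by blast
  then have "lo + int (card ?A) = hi + 1" unfolding A by simp
  then show ?thesis unfolding lo_def[symmetric] unfolding A by auto
qed

section \<open>Moving columns in coordinates, for both relative positions of two columns\<close>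

definition unshift :: "int \<Rightarrow> int \<Rightarrow> int \<Rightarrow> int" where
  "unshift c l x = (if x = l then c else if c \<le> x \<and> x < l then x + 1 else x)"

definition rect_entries :: "(int \<times> int \<Rightarrow> nat) \<Rightarrow> int \<Rightarrow> int \<Rightarrow> nat \<Rightarrow> nat \<Rightarrow> nat \<Rightarrow> nat \<Rightarrow> nat" where
  "rect_entries p c r n m i j = (if i < n \<and> j < m then p (c + int i, r + int j) else 0)"

lemma shift_column_unshift:
  assumes "c \<le> last_column M c"
  shows "shift_column M c x = x' \<longleftrightarrow> x = unshift c (last_column M c) x'"
  using assms by (auto simp: shift_column_def unshift_def)

lemma inv_shift_column:
  assumes "c \<le> last_column M c"
  shows "inv (shift_column M c) = unshift c (last_column M c)"
proof
  fix x
  have "inj (shift_column M c)"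
    using shift_column_unshift[OF assms] by (metis injI)
  moreover have "shift_column M c (unshift c (last_column M c) x) = x"
    using shift_column_unshift[OF assms] by blast
  ultimately show "inv (shift_column M c) x = unshift c (last_column M c) x" by (rule inv_f_eq)
qed

text \<open>The rectangle enters through explicit data \<open>c\<close>, \<open>l\<close>,
  \<open>r\<close>, \<open>m\<close>, so the same description serves the first and the second
  move.\<close>

lemma move_column_eq:
  assumes "last_column M c = l" "c \<le> l" "col_rows M c = {r..<r + int m}" "0 < m"
  shows "move_column v c (M, p) =
    ({(x, y). (unshift c l x, y) \<in> M},
     \<lambda>(x, y). if c \<le> x \<and> x \<le> l \<and> r \<le> y \<and> y < r + int m
       then j_bar v (nat (l - c + 1)) m (rect_entries p c r (nat (l - c + 1)) m) (nat (x - c)) (nat (y - r))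
       else p (unshift c l x, y))"
proof -
  have mn: "Min (col_rows M c) = r"
    unfolding assms(3) using assms(4) by (intro Min_eqI) auto
  have cd: "card (col_rows M c) = m" unfolding assms(3) by simp
  have sh: "{(shift_column M c x, y) | x y. (x, y) \<in> M} = {(x, y). (unshift c l x, y) \<in> M}"
  proof -
    have "c \<le> last_column M c" using assms(1,2) by simp
    note su = shift_column_unshift[OF this, unfolded assms(1)]
    show ?thesis
    proof (intro equalityI subsetI)
      fix z assume "z \<in> {(shift_column M c x, y) | x y. (x, y) \<in> M}"
      then obtain x y where "z = (shift_column M c x, y)" "(x, y) \<in> M" by blast
      then show "z \<in> {(x, y). (unshift c l x, y) \<in> M}" using su[of x "shift_column M c x"] by simp
    next
      fix z assume "z \<in> {(x, y). (unshift c l x, y) \<in> M}"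
      then obtain x y where z: "z = (x, y)" "(unshift c l x, y) \<in> M" by blast
      then have "z = (shift_column M c (unshift c l x), y)" using su[of "unshift c l x" x] by simp
      then show "z \<in> {(shift_column M c x, y) | x y. (x, y) \<in> M}" using z(2) by blast
    qed
  qed
  have re: "(\<lambda>i j. if i < n \<and> j < m then p (c + int i, r + int j) else 0) = rect_entries p c r n m" for n
    by (simp add: rect_entries_def fun_eq_iff)
  have iv: "inv (shift_column M c) = unshift c l" using inv_shift_column[of c M] assms(1,2) by simp
  have rc: "(x, y) \<in> rectangle M c \<longleftrightarrow> c \<le> x \<and> x \<le> l \<and> r \<le> y \<and> y < r + int m" for x y
    unfolding rectangle_def assms(1,3) by auto
  show ?thesis
    unfolding move_column_def Let_def prod.case mn cd sh re iv rc assms(1) ..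
qed

lemma rect_filling_entries: "filling v M p \<Longrightarrow> rect_filling v n m (rect_entries p c r n m)"
  by (auto simp: filling_def rect_filling_def rect_entries_def)

lemma col_rows_unshift: "col_rows {(x, y). (unshift c l x, y) \<in> M} x = col_rows M (unshift c l x)"
  by (simp add: col_rows_def)

text \<open>Every column of the rectangle of \<open>c2\<close> contains the rows of
  \<open>c2\<close> and hence those of \<open>c1\<close>. So this rectangle starts inside the one of
  \<open>c1\<close> and ends no further right.\<close>

lemma move_columns_nested:
  assumes "moon_polyomino M" "filling v M p" "col_rows M c1 \<noteq> {}"
    and "col_rows M c1 \<subset> col_rows M c2" "c1 < c2"
  shows "move_column v (shift_column M c1 c2) (move_column v c1 (M, p)) =
    move_column v (shift_column M c2 c1) (move_column v c2 (M, p))"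
proof -
  have ne2: "col_rows M c2 \<noteq> {}" using assms(3,4) by blast
  define l1 l2 r1 r2 m1 m2 where "l1 = last_column M c1" and "l2 = last_column M c2"
    and "r1 = Min (col_rows M c1)" and "r2 = Min (col_rows M c2)"
    and "m1 = card (col_rows M c1)" and "m2 = card (col_rows M c2)"
  note last = moon_last_column[OF assms(1,3), folded l1_def] moon_last_column[OF assms(1) ne2, folded l2_def]
  have R1: "col_rows M c1 = {r1..<r1 + int m1}" and R2: "col_rows M c2 = {r2..<r2 + int m2}"
    using moon_col_rows_interval[OF assms(1,3)] moon_col_rows_interval[OF assms(1) ne2]
    by (simp_all add: r1_def r2_def m1_def m2_def)
  have m1: "0 < m1" and m2: "0 < m2" using assms(3) ne2 by (auto simp: R1 R2)
  have r: "r2 \<le> r1" "r1 + int m1 \<le> r2 + int m2"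
    using assms(4) m1 unfolding R1 R2 by (auto simp: psubset_eq)
  have l: "c2 \<le> l2" "l2 \<le> l1" "c2 \<le> l1"
  proof -
    show "c2 \<le> l2" by (rule last(3))
    show "l2 \<le> l1" using last(2)[of l2] last(4)[of l2] last(3) assms(4,5) by auto
    then show "c2 \<le> l1" using last(3) by simp
  qed
  define n1 n2 where "n1 = nat (l1 - c1 + 1)" and "n2 = nat (l2 - c2 + 1)"
  define a b where "a = nat (c2 - c1)" and "b = nat (r1 - r2)"
  let ?F1 = "rect_entries p c1 r1 n1 m1" and ?F2 = "rect_entries p c2 r2 n2 m2"
  interpret two_rectangles v n1 m1 n2 m2 a b ?F1 ?F2
  proof
    show "rect_filling v n1 m1 ?F1" "rect_filling v n2 m2 ?F2"
      using rect_filling_entries[OF assms(2)] by blast+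
    show "0 < a" "a + n2 \<le> n1" "0 < n2" "b + m1 \<le> m2"
      using assms(5) l r by (auto simp: a_def b_def n1_def n2_def)
    fix i j assume "i < n2" "j < m1"
    moreover have "a + i < n1" "b + j < m2"
      using \<open>a + n2 \<le> n1\<close> \<open>b + m1 \<le> m2\<close> calculation by simp_all
    moreover have "c1 + int (a + i) = c2 + int i" "r1 + int j = r2 + int (b + j)"
      using assms(5) r by (simp_all add: a_def b_def)
    ultimately show "?F1 (a + i) j = ?F2 i (b + j)"
      using \<open>i < n2\<close> \<open>j < m1\<close> by (simp only: rect_entries_def simp_thms if_True)
  qed
  define M1 M2 where "M1 = {(x, y). (unshift c1 l1 x, y) \<in> M}" and "M2 = {(x, y). (unshift c2 l2 x, y) \<in> M}"
  define p1 where "p1 = (\<lambda>(x, y). if c1 \<le> x \<and> x \<le> l1 \<and> r1 \<le> y \<and> y < r1 + int m1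
    then G (nat (x - c1)) (nat (y - r1)) else p (unshift c1 l1 x, y))"
  define p2 where "p2 = (\<lambda>(x, y). if c2 \<le> x \<and> x \<le> l2 \<and> r2 \<le> y \<and> y < r2 + int m2
    then G' (nat (x - c2)) (nat (y - r2)) else p (unshift c2 l2 x, y))"
  have mv1: "move_column v c1 (M, p) = (M1, p1)"
    unfolding move_column_eq[OF l1_def[symmetric] last(1) R1 m1] M1_def p1_def G_def unfolding n1_def ..
  have mv2: "move_column v c2 (M, p) = (M2, p2)"
    unfolding move_column_eq[OF l2_def[symmetric] last(3) R2 m2] M2_def p2_def G'_def unfolding n2_def ..
  have s1: "shift_column M c1 c2 = c2 - 1" and s2: "shift_column M c2 c1 = c1"
    using assms(5) l by (simp_all add: shift_column_def flip: l1_def l2_def)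
  have "unshift c1 l1 (c2 - 1) = c2" "unshift c2 l2 c1 = c1"
    using assms(5) l by (auto simp: unshift_def)
  then have C1: "col_rows M1 (c2 - 1) = col_rows M c2" and C2: "col_rows M2 c1 = col_rows M c1"
    by (simp_all add: M1_def M2_def col_rows_unshift)
  have L1: "last_column M1 (c2 - 1) = l2 - 1"
  proof (rule last_column_eqI)
    fix x assume "c2 - 1 \<le> x" "x \<le> l2 - 1"
    then have "unshift c1 l1 x = x + 1" using assms(5) l by (auto simp: unshift_def)
    then have "col_rows M1 x = col_rows M (x + 1)" by (simp add: M1_def col_rows_unshift)
    then show "col_rows M1 (c2 - 1) \<subseteq> col_rows M1 x"
      using last(4)[of "x + 1"] \<open>c2 - 1 \<le> x\<close> \<open>x \<le> l2 - 1\<close> by (simp add: C1)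
  next
    \<comment> \<open>If both rectangles end at the same place, the column that follows the shifted
      rectangle of \<open>c2\<close> is \<open>c1\<close> itself. It lacks a row of
      \<open>c2\<close> because the inclusion is strict, so it does not enlarge the
      rectangle.\<close>
    have "unshift c1 l1 l2 = (if l2 = l1 then c1 else l2 + 1)" using assms(5) l by (auto simp: unshift_def)
    then have "\<not> col_rows M c2 \<subseteq> col_rows M (unshift c1 l1 l2)"
      using last(4)[of "l2 + 1"] l assms(4) by auto
    then show "\<not> col_rows M1 (c2 - 1) \<subseteq> col_rows M1 (l2 - 1 + 1)"
      unfolding C1 by (simp add: M1_def col_rows_unshift)
  qed (use l in simp)
  have L2: "last_column M2 c1 = l1"
  proof (rule last_column_eqI)
    fix x assume x: "c1 \<le> x" "x \<le> l1"
    have "c1 \<le> unshift c2 l2 x" "unshift c2 l2 x \<le> l1" using assms(5) l x by (auto simp: unshift_def)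
    then have "col_rows M c1 \<subseteq> col_rows M (unshift c2 l2 x)" using last(2) by blast
    then show "col_rows M2 c1 \<subseteq> col_rows M2 x" unfolding C2 by (simp add: M2_def col_rows_unshift)
  next
    have "unshift c2 l2 (l1 + 1) = l1 + 1" using l by (auto simp: unshift_def)
    moreover have "\<not> col_rows M c1 \<subseteq> col_rows M (l1 + 1)" using last(2)[of "l1 + 1"] last(1) by simp
    ultimately show "\<not> col_rows M2 c1 \<subseteq> col_rows M2 (l1 + 1)"
      unfolding C2 by (simp add: M2_def col_rows_unshift)
  qed (rule last(1))
  have E1: "rect_entries p1 (c2 - 1) r2 n2 m2 = F2'"
  proof (intro ext)
    fix i j
    show "rect_entries p1 (c2 - 1) r2 n2 m2 i j = F2' i j"
    proof (cases "i < n2 \<and> j < m2")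
      case True
      then have x: "c1 \<le> c2 - 1 + int i" "c2 - 1 + int i < l1"
        using assms(5) l by (auto simp: n2_def)
      have "nat (c2 - 1 + int i - c1) = a - 1 + i" "nat (r2 + int j - r1) = j - b"
        using assms(5) r by (auto simp: a_def b_def)
      moreover have "r1 \<le> r2 + int j \<and> r2 + int j < r1 + int m1 \<longleftrightarrow> rows b m1 j"
        using r by (auto simp: rows_def b_def)
      moreover have "unshift c1 l1 (c2 - 1 + int i) = c2 + int i"
        using x by (simp add: unshift_def)
      ultimately show ?thesis
        using True x by (simp add: rect_entries_def p1_def F2'_def)
    next
      case False
      then have "\<not> (i < n2 \<and> rows b m1 j)" using b by (auto simp: rows_def)
      then show ?thesis using False by (auto simp: rect_entries_def F2'_def)
    qed
  qed
  have E2: "rect_entries p2 c1 r1 n1 m1 = F2"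
  proof (intro ext)
    fix i j
    show "rect_entries p2 c1 r1 n1 m1 i j = F2 i j"
    proof (cases "i < n1 \<and> j < m1")
      case True
      have "c2 \<le> c1 + int i \<and> c1 + int i \<le> l2 \<longleftrightarrow> a \<le> i \<and> i < a + n2"
        using assms(5) l by (auto simp: a_def n2_def)
      moreover have "r2 \<le> r1 + int j" "r1 + int j < r2 + int m2" using True r by auto
      moreover have "nat (r1 + int j - r2) = b + j" using r by (simp add: b_def)
      moreover have "nat (c1 + int i - c2) = i - a" using assms(5) by (simp add: a_def)
      moreover have "unshift c2 l2 (c1 + int i) = c1 + int i" if "\<not> (c2 \<le> c1 + int i \<and> c1 + int i \<le> l2)"
        using that l by (auto simp: unshift_def)
      ultimately show ?thesis
        using True by (auto simp: rect_entries_def p2_def F2_def)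
    next
      case False
      then show ?thesis using a by (auto simp: rect_entries_def F2_def)
    qed
  qed
  have n: "nat (l2 - 1 - (c2 - 1) + 1) = n2" "nat (l1 - c1 + 1) = n1" by (simp_all add: n1_def n2_def)
  \<comment> \<open>Both orders permute the columns alike: when \<open>c1\<close> has moved away,
    column \<open>c2\<close> stands at \<open>c2 - 1\<close> and its rectangle ends at
    \<open>l2 - 1\<close>.\<close>
  have us: "unshift c1 l1 (unshift (c2 - 1) (l2 - 1) x) = unshift c2 l2 (unshift c1 l1 x)" for x
    using assms(5) l by (auto simp: unshift_def)
  have lhs: "move_column v (c2 - 1) (M1, p1) = ({(x, y). (unshift (c2 - 1) (l2 - 1) x, y) \<in> M1},
      \<lambda>(x, y). if c2 - 1 \<le> x \<and> x \<le> l2 - 1 \<and> r2 \<le> y \<and> y < r2 + int m2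
        then H' (nat (x - (c2 - 1))) (nat (y - r2)) else p1 (unshift (c2 - 1) (l2 - 1) x, y))"
    using move_column_eq[OF L1 _ trans[OF C1 R2] m2, of v p1] l(1) unfolding n E1 H'_def by simp
  have rhs: "move_column v c1 (M2, p2) = ({(x, y). (unshift c1 l1 x, y) \<in> M2},
      \<lambda>(x, y). if c1 \<le> x \<and> x \<le> l1 \<and> r1 \<le> y \<and> y < r1 + int m1
        then H (nat (x - c1)) (nat (y - r1)) else p2 (unshift c1 l1 x, y))"
    using move_column_eq[OF L2 last(1) trans[OF C2 R1] m1, of v p2] unfolding n E2 H_def .
  show ?thesis
    unfolding mv1 mv2 s1 s2 lhs rhs
  proof (intro arg_cong2[of _ _ _ _ Pair])
    show "{(x, y). (unshift (c2 - 1) (l2 - 1) x, y) \<in> M1} = {(x, y). (unshift c1 l1 x, y) \<in> M2}"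
      by (simp add: M1_def M2_def us)
    show "(\<lambda>(x, y). if c2 - 1 \<le> x \<and> x \<le> l2 - 1 \<and> r2 \<le> y \<and> y < r2 + int m2
        then H' (nat (x - (c2 - 1))) (nat (y - r2)) else p1 (unshift (c2 - 1) (l2 - 1) x, y)) =
      (\<lambda>(x, y). if c1 \<le> x \<and> x \<le> l1 \<and> r1 \<le> y \<and> y < r1 + int m1
        then H (nat (x - c1)) (nat (y - r1)) else p2 (unshift c1 l1 x, y))"
    proof (intro ext, clarify)
      fix x y
      let ?in1 = "r1 \<le> y \<and> y < r1 + int m1" and ?in2 = "r2 \<le> y \<and> y < r2 + int m2"
      have "(if c2 - 1 \<le> x \<and> x \<le> l2 - 1 \<and> ?in2
          then H' (nat (x - (c2 - 1))) (nat (y - r2)) else p1 (unshift (c2 - 1) (l2 - 1) x, y)) =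
        (if c1 \<le> x \<and> x \<le> l1 \<and> ?in1
          then H (nat (x - c1)) (nat (y - r1)) else p2 (unshift c1 l1 x, y))"
      proof (cases "c2 - 1 \<le> x \<and> x \<le> l2 - 1")
        case True
        define i where "i = nat (x - (c2 - 1))"
        have i: "i < n2" "nat (x - c1) = a - 1 + i" "nat (x + 1 - c2) = i" "c1 \<le> x" "x \<le> l1"
          using True assms(5) l by (auto simp: i_def n2_def a_def)
        have u: "unshift c1 l1 x = x + 1" using True assms(5) l by (auto simp: unshift_def)
        \<comment> \<open>In a column that finally belongs to the overlap, the cell lies in the
          overlap, above or below it in the taller rectangle, or outside both rectangles.\<close>
        consider "?in1" | "\<not> ?in1" "?in2" | "\<not> ?in2" by blast
        then show ?thesis
        proof cases
          case 1
          define j where "j = nat (y - r1)"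
          have "?in2" "j < m1" "nat (y - r2) = b + j" using 1 r by (auto simp: j_def b_def)
          then show ?thesis
            using commute_inside[of i j] i True 1 by (simp flip: i_def j_def)
        next
          case 2
          then have "\<not> rows b m1 (nat (y - r2))" using r by (auto simp: rows_def b_def)
          then have "H' i (nat (y - r2)) = G' i (nat (y - r2))" by (rule commute_above[OF i(1)])
          moreover have "p2 (x + 1, y) = G' i (nat (y - r2))" using 2 True i by (simp add: p2_def)
          ultimately show ?thesis using 2 True by (auto simp: u simp flip: i_def)
        next
          case 3
          then have "\<not> ?in1" using r by auto
          then have "p1 (unshift (c2 - 1) (l2 - 1) x, y) = p (unshift c1 l1 (unshift (c2 - 1) (l2 - 1) x), y)"
            "p2 (unshift c1 l1 x, y) = p (unshift c2 l2 (unshift c1 l1 x), y)"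
            using 3 by (auto simp: p1_def p2_def)
          then show ?thesis using 3 \<open>\<not> ?in1\<close> us[of x] by auto
        qed
      next
        case False
        have u: "unshift (c2 - 1) (l2 - 1) x = x" using False l by (auto simp: unshift_def)
        show ?thesis
        proof (cases "c1 \<le> x \<and> x \<le> l1 \<and> ?in1")
          case True
          have "\<not> (a - 1 \<le> nat (x - c1) \<and> nat (x - c1) < a - 1 + n2)"
            using True False assms(5) l by (auto simp: a_def n2_def)
          then have "H (nat (x - c1)) (nat (y - r1)) = G (nat (x - c1)) (nat (y - r1))"
            by (rule commute_right)
          then show ?thesis using True False by (auto simp: u p1_def)
        next
          case F: False
          then have "p1 (x, y) = p (unshift c1 l1 x, y)" by (auto simp: p1_def)
          moreover have "\<not> (c2 \<le> unshift c1 l1 x \<and> unshift c1 l1 x \<le> l2)"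
            using False assms(5) l by (auto simp: unshift_def)
          then have "p2 (unshift c1 l1 x, y) = p (unshift c2 l2 (unshift c1 l1 x), y)" by (auto simp: p2_def)
          ultimately show ?thesis using False F us[of x] by (auto simp: u)
        qed
      qed
      then show "(if c2 - 1 \<le> x \<and> x \<le> l2 - 1 \<and> r2 \<le> y \<and> y < r2 + int m2
          then H' (nat (x - (c2 - 1))) (nat (y - r2)) else p1 (unshift (c2 - 1) (l2 - 1) x, y)) =
        (if c1 \<le> x \<and> x \<le> l1 \<and> r1 \<le> y \<and> y < r1 + int m1
          then H (nat (x - c1)) (nat (y - r1)) else p2 (unshift c1 l1 x, y))" .
    qed
  qed
qed

text \<open>Column \<open>c1\<close> lacks a row of \<open>c2\<close>, so the rectangle of
  \<open>c2\<close> ends to the left of \<open>c1\<close>, and the two moves concern disjoint sets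
  of columns.\<close>

lemma move_columns_disjoint:
  assumes "moon_polyomino M" "col_rows M c1 \<noteq> {}"
    and "col_rows M c1 \<subset> col_rows M c2" "c2 < c1"
  shows "move_column v (shift_column M c1 c2) (move_column v c1 (M, p)) =
    move_column v (shift_column M c2 c1) (move_column v c2 (M, p))"
proof -
  have ne2: "col_rows M c2 \<noteq> {}" using assms(2,3) by blast
  define l1 l2 r1 r2 m1 m2 where "l1 = last_column M c1" and "l2 = last_column M c2"
    and "r1 = Min (col_rows M c1)" and "r2 = Min (col_rows M c2)"
    and "m1 = card (col_rows M c1)" and "m2 = card (col_rows M c2)"
  note last = moon_last_column[OF assms(1,2), folded l1_def] moon_last_column[OF assms(1) ne2, folded l2_def]
  have R1: "col_rows M c1 = {r1..<r1 + int m1}" and R2: "col_rows M c2 = {r2..<r2 + int m2}"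
    using moon_col_rows_interval[OF assms(1,2)] moon_col_rows_interval[OF assms(1) ne2]
    by (simp_all add: r1_def r2_def m1_def m2_def)
  have m1: "0 < m1" and m2: "0 < m2" using assms(2) ne2 by (auto simp: R1 R2)
  have l: "c2 \<le> l2" "l2 < c1" "c1 \<le> l1"
    using last(1,3) last(4)[of c1] assms(3,4) by auto
  define M1 M2 where "M1 = {(x, y). (unshift c1 l1 x, y) \<in> M}" and "M2 = {(x, y). (unshift c2 l2 x, y) \<in> M}"
  define n1 n2 where "n1 = nat (l1 - c1 + 1)" and "n2 = nat (l2 - c2 + 1)"
  define p1 where "p1 = (\<lambda>(x, y). if c1 \<le> x \<and> x \<le> l1 \<and> r1 \<le> y \<and> y < r1 + int m1
    then j_bar v n1 m1 (rect_entries p c1 r1 n1 m1) (nat (x - c1)) (nat (y - r1)) else p (unshift c1 l1 x, y))"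
  define p2 where "p2 = (\<lambda>(x, y). if c2 \<le> x \<and> x \<le> l2 \<and> r2 \<le> y \<and> y < r2 + int m2
    then j_bar v n2 m2 (rect_entries p c2 r2 n2 m2) (nat (x - c2)) (nat (y - r2)) else p (unshift c2 l2 x, y))"
  have mv1: "move_column v c1 (M, p) = (M1, p1)"
    unfolding move_column_eq[OF l1_def[symmetric] last(1) R1 m1] M1_def p1_def n1_def ..
  have mv2: "move_column v c2 (M, p) = (M2, p2)"
    unfolding move_column_eq[OF l2_def[symmetric] last(3) R2 m2] M2_def p2_def n2_def ..
  have s1: "shift_column M c1 c2 = c2" and s2: "shift_column M c2 c1 = c1"
    using l by (simp_all add: shift_column_def flip: l1_def l2_def)
  have u1: "unshift c1 l1 x = x" if "x \<le> l2" for x using l that by (auto simp: unshift_def)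
  have u2: "unshift c2 l2 x = x" if "l2 < x" for x using l that by (auto simp: unshift_def)
  have C1: "col_rows M1 c2 = col_rows M c2" and C2: "col_rows M2 c1 = col_rows M c1"
    using l by (simp_all add: M1_def M2_def col_rows_unshift u1 u2)
  have L1: "last_column M1 c2 = l2"
  proof (rule last_column_eqI)
    show "col_rows M1 c2 \<subseteq> col_rows M1 x" if "c2 \<le> x" "x \<le> l2" for x
      unfolding C1 using last(4)[of x] that by (simp add: M1_def col_rows_unshift u1)
    have "l2 < unshift c1 l1 (l2 + 1)" using l by (auto simp: unshift_def)
    then have "\<not> col_rows M c2 \<subseteq> col_rows M (unshift c1 l1 (l2 + 1))"
      using last(4)[of "unshift c1 l1 (l2 + 1)"] l by simp
    then show "\<not> col_rows M1 c2 \<subseteq> col_rows M1 (l2 + 1)"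
      unfolding C1 by (simp add: M1_def col_rows_unshift)
  qed (rule l(1))
  have L2: "last_column M2 c1 = l1"
  proof (rule last_column_eqI)
    show "col_rows M2 c1 \<subseteq> col_rows M2 x" if "c1 \<le> x" "x \<le> l1" for x
      unfolding C2 using last(2)[of x] that l by (simp add: M2_def col_rows_unshift u2)
    show "\<not> col_rows M2 c1 \<subseteq> col_rows M2 (l1 + 1)"
      unfolding C2 using last(2)[of "l1 + 1"] l by (simp add: M2_def col_rows_unshift u2)
  qed (rule l(3))
  have E1: "rect_entries p1 c2 r2 n2 m2 = rect_entries p c2 r2 n2 m2"
  proof (intro ext)
    fix i j
    show "rect_entries p1 c2 r2 n2 m2 i j = rect_entries p c2 r2 n2 m2 i j"
    proof (cases "i < n2")
      case True
      then have "c2 + int i \<le> l2" by (auto simp: n2_def)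
      then show ?thesis using l by (simp add: rect_entries_def p1_def u1)
    qed (simp add: rect_entries_def)
  qed
  have E2: "rect_entries p2 c1 r1 n1 m1 = rect_entries p c1 r1 n1 m1"
    using l by (simp add: rect_entries_def fun_eq_iff p2_def u2)
  have us: "unshift c1 l1 (unshift c2 l2 x) = unshift c2 l2 (unshift c1 l1 x)" for x
    using l by (auto simp: unshift_def)
  have lhs: "move_column v c2 (M1, p1) = ({(x, y). (unshift c2 l2 x, y) \<in> M1},
      \<lambda>(x, y). if c2 \<le> x \<and> x \<le> l2 \<and> r2 \<le> y \<and> y < r2 + int m2
        then p2 (x, y) else p1 (unshift c2 l2 x, y))"
    using move_column_eq[OF L1 l(1) trans[OF C1 R2] m2, of v p1]
    unfolding n2_def[symmetric] E1 by (simp add: p2_def fun_eq_iff)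
  have rhs: "move_column v c1 (M2, p2) = ({(x, y). (unshift c1 l1 x, y) \<in> M2},
      \<lambda>(x, y). if c1 \<le> x \<and> x \<le> l1 \<and> r1 \<le> y \<and> y < r1 + int m1
        then p1 (x, y) else p2 (unshift c1 l1 x, y))"
    using move_column_eq[OF L2 l(3) trans[OF C2 R1] m1, of v p2]
    unfolding n1_def[symmetric] E2 by (simp add: p1_def fun_eq_iff)
  show ?thesis
    unfolding mv1 mv2 s1 s2 lhs rhs
  proof (intro arg_cong2[of _ _ _ _ Pair])
    show "{(x, y). (unshift c2 l2 x, y) \<in> M1} = {(x, y). (unshift c1 l1 x, y) \<in> M2}"
      by (simp add: M1_def M2_def us)
    have "(if c2 \<le> x \<and> x \<le> l2 \<and> r2 \<le> y \<and> y < r2 + int m2 then p2 (x, y) else p1 (unshift c2 l2 x, y)) =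
      (if c1 \<le> x \<and> x \<le> l1 \<and> r1 \<le> y \<and> y < r1 + int m1 then p1 (x, y) else p2 (unshift c1 l1 x, y))" for x y
    proof (cases "x \<le> l2")
      case True
      then have "unshift c2 l2 x \<le> l2" using l by (auto simp: unshift_def)
      then show ?thesis using True l u1[OF True] u1 by (auto simp: p1_def p2_def)
    next
      case False
      then have "l2 < unshift c1 l1 x" using l by (auto simp: unshift_def)
      then show ?thesis using False l u2[of x] u2[of "unshift c1 l1 x"] by (auto simp: p1_def p2_def)
    qed
    then show "(\<lambda>(x, y). if c2 \<le> x \<and> x \<le> l2 \<and> r2 \<le> y \<and> y < r2 + int m2
        then p2 (x, y) else p1 (unshift c2 l2 x, y)) =
      (\<lambda>(x, y). if c1 \<le> x \<and> x \<le> l1 \<and> r1 \<le> y \<and> y < r1 + int m1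
        then p1 (x, y) else p2 (unshift c1 l1 x, y))"
      by (simp add: fun_eq_iff)
  qed
qed

theorem theorem6p1:
  fixes v :: variant
    and M :: "(int \<times> int) set"
    and \<pi> :: "int \<times> int \<Rightarrow> nat"
    and c1 c2 :: int
  assumes "moon_polyomino M"
    and "filling v M \<pi>"
    and "col_rows M c1 \<noteq> {}"
    and "col_rows M c2 \<noteq> {}"
    and "c1 \<noteq> c2 \<Longrightarrow> col_rows M c1 \<noteq> col_rows M c2"
  shows "move_column v (shift_column M c1 c2) (move_column v c1 (M, \<pi>)) =
         move_column v (shift_column M c2 c1) (move_column v c2 (M, \<pi>))"
proof (cases "c1 = c2")
  case False
  have nested: "move_column v (shift_column M c d) (move_column v c (M, \<pi>)) =
      move_column v (shift_column M d c) (move_column v d (M, \<pi>))"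
    if "col_rows M c \<noteq> {}" "col_rows M c \<subset> col_rows M d" "c \<noteq> d" for c d
    using that move_columns_nested[OF assms(1,2), of c d] move_columns_disjoint[OF assms(1), of c d]
    by (cases "c < d") auto
  \<comment> \<open>The row sets are comparable as the polyomino is intersection-free, and different
    by assumption.\<close>
  have "col_rows M c1 \<subset> col_rows M c2 \<or> col_rows M c2 \<subset> col_rows M c1"
    using assms(1) assms(5)[OF False] unfolding moon_polyomino_def by blast
  then show ?thesis
  proof
    assume "col_rows M c1 \<subset> col_rows M c2"
    then show ?thesis using nested[OF assms(3)] False by blast
  next
    assume "col_rows M c2 \<subset> col_rows M c1"
    then show ?thesis using nested[OF assms(4)] False by (intro sym[OF nested[OF assms(4)]]) auto
  qed
qed simp

end
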